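(* Let $w\in S_\infty$ and let $r,m\ge 1$ be integers. Let $\sigma[r,m]$ be the permutation $[1,2,\dots,r-1,r+m,r,r+1,\dots]$. Then $$P_w\,P_{\sigma[r,m]}=\sum P_{w'},$$ where the sum is over all permutations $w'=w\,t_{a_1,b_1}\cdots t_{a_m,b_m}$ (with $a_i,b_i$ positive integers) such that (1) the $b_i$ are distinct and greater than $r$; (2) $a_1\le a_2\le\dots\le a_m\le r$; (3) $l(w')=l(w)+m$; (4) $w'(b_i)<w'(b_j)<w'(a_i)$ for every $i<j$ with $a_i=a_j$.
   Context: $S_\infty=\bigcup_n S_n$ is the group of permutations of $\{1,2,\dots\}$ fixing all but finitely many elements. A permutation is written in one-line notation $w=[w(1),w(2),\dots]$. Products are compositions, $(uv)(x)=u(v(x))$. $t_{a,b}$ is the transposition exchanging $a$ and $b$, and $s_i=t_{i,i+1}$. In one-line notation, $\sigma[r,m]$ sends $i\mapsto i$ for $i<r$, $r\mapsto r+m$, $i\mapsto i-1$ for $r<i\le r+m$, and fixes all $i>r+m$. The length $l(w)$ is the number of pairs $i<j$ with $w(i)>w(j)$. A reduced word of $w$ is a word $c_1\dots c_p$ with $w=s_{c_1}\cdots s_{c_p}$ and $p$ minimal (this minimal $p$ equals $l(w)$). Schubert polynomials: for a polynomial $f$ let $\partial_i f=\dfrac{f-f^{(i)}}{x_i-x_{i+1}}$, where $f^{(i)}$ is obtained from $f$ by exchanging $x_i$ and $x_{i+1}$. For a permutation $v$ put $\partial_v=\partial_{c_1}\cdots\partial_{c_p}$ for any reduced word $c_1\dots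 c_p$ of $v$ (this is independent of the choice). For $w\in S_n$ the Schubert polynomial is $P_w=\partial_{w^{-1}w_0}\,(x_1^{n-1}x_2^{n-2}\cdots x_{n-1}^1x_n^0)$ with $w_0=[n,\dots,1]$ the longest permutation of $S_n$. It does not depend on $n$ under the embedding $S_n\subset S_{n+1}$, so $P_w$ is defined for $w\in S_\infty$.
   Formalization: Condition (3) is strengthened: l(w t_{a_1,b_1}...t_{a_k,b_k}) = l(w)+k for every k=1,...,m, not only k=m. As printed the formula fails: for w=[2,3,1], r=m=2, w'=w t_{1,3} t_{2,5}=[1,5,2,4,3] meets (1)-(4) but P_{w'} does not occur in the product. *)

theory Defs
  imports
    "HOL-Combinatorics.Permutations"
    "HOL-Library.Poly_Mapping"
begin

definition S_n :: "nat \<Rightarrow> (nat \<Rightarrow> nat) set"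
  where "S_n n = {w. w permutes {1..n}}"

definition S_infinity :: "(nat \<Rightarrow> nat) set"
  where "S_infinity = (\<Union>n. S_n n)"

definition longest_perm :: "nat \<Rightarrow> nat \<Rightarrow> nat"
  where "longest_perm n i = (if i \<in> {1..n} then n + 1 - i else i)"

definition sigma :: "nat \<Rightarrow> nat \<Rightarrow> nat \<Rightarrow> nat"
  where "sigma r m i =
    (if i < r then i
     else if i = r then r + m
     else if i \<le> r + m then i - 1
     else i)"

definition len :: "(nat \<Rightarrow> nat) \<Rightarrow> nat"
  where "len w = card {(i, j). 1 \<le> i \<and> i < j \<and> w j < w i}"

definition word_perm :: "nat list \<Rightarrow> nat \<Rightarrow> nat"
  where "word_perm c = foldr (\<lambda>i v. transpose i (i + 1) \<circ> v) c id"

definition is_word_of :: "nat list \<Rightarrow> (nat \<Rightarrow> nat) \<Rightarrow> bool"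
  where "is_word_of c w \<longleftrightarrow> (\<forall>i\<in>set c. 1 \<le> i) \<and> word_perm c = w"

definition reduced_word :: "nat list \<Rightarrow> (nat \<Rightarrow> nat) \<Rightarrow> bool"
  where "reduced_word c w \<longleftrightarrow>
    is_word_of c w \<and> (\<forall>d. is_word_of d w \<longrightarrow> length c \<le> length d)"

(* A polynomial is the finitely supported map from exponent vectors to coefficients;
   the variable of index 0 never occurs below. *)
type_synonym int_mpoly = "(nat \<Rightarrow>\<^sub>0 nat) \<Rightarrow>\<^sub>0 int"

definition Var :: "nat \<Rightarrow> int_mpoly"
  where "Var i = Poly_Mapping.single (Poly_Mapping.single i 1) 1"

(* The inner map_key exchanges the entries i and i + 1 of an exponent vector; the outer one
   says that the coefficient of e in the result is the coefficient of the exchanged e in f. *)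
definition swap_vars :: "nat \<Rightarrow> int_mpoly \<Rightarrow> int_mpoly"
  where "swap_vars i f =
    Poly_Mapping.map_key (Poly_Mapping.map_key (transpose i (i + 1))) f"

lemma map_key_transpose_involution:
  "Poly_Mapping.map_key (transpose i j) (Poly_Mapping.map_key (transpose i j) e) = e"
  for e :: "nat \<Rightarrow>\<^sub>0 nat"
proof -
  have inj: "inj (transpose i j)"
    by (simp add: inj_swap)
  have "Poly_Mapping.map_key (transpose i j) (Poly_Mapping.map_key (transpose i j) e)
      = Poly_Mapping.map_key (\<lambda>x. x) e"
    by (simp add: map_key_compose[OF inj inj] id_def)
  then show ?thesis
    by (simp add: map_key_id)
qed

lemma inj_map_key_transpose:
  "inj (Poly_Mapping.map_key (transpose i j) :: (nat \<Rightarrow>\<^sub>0 nat) \<Rightarrow> _)"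
  by (rule inj_on_inverseI[where g = "Poly_Mapping.map_key (transpose i j)"])
    (rule map_key_transpose_involution)

lemma lookup_swap_vars:
  "Poly_Mapping.lookup (swap_vars i f) e =
    Poly_Mapping.lookup f (Poly_Mapping.map_key (transpose i (i + 1)) e)"
  unfolding swap_vars_def by (simp add: map_key.rep_eq[OF inj_map_key_transpose])

lemma swap_vars_Var: "swap_vars i (Var j) = Var (transpose i (i + 1) j)"
proof -
  let ?t = "transpose i (i + 1)"
  have inj: "inj ?t"
    by (simp add: inj_swap)
  have key: "Poly_Mapping.map_key ?t (Poly_Mapping.single (?t k) (1::nat)) = Poly_Mapping.single k 1" for k
    by (rule map_key_single[OF inj])
  have "Poly_Mapping.single j (1::nat)
      = Poly_Mapping.map_key ?t (Poly_Mapping.single (?t j) 1)"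
    using key by simp
  then show ?thesis
    unfolding swap_vars_def Var_def
    by (simp only: map_key_single[OF inj_map_key_transpose])
qed

(* The exact quotient, the polynomial ring being an integral domain. *)
definition divdiff :: "nat \<Rightarrow> int_mpoly \<Rightarrow> int_mpoly"
  where "divdiff i f = (THE g. (Var i - Var (i + 1)) * g = f - swap_vars i f)"

definition divdiff_perm :: "(nat \<Rightarrow> nat) \<Rightarrow> int_mpoly \<Rightarrow> int_mpoly"
  where "divdiff_perm v = foldr divdiff (SOME c. reduced_word c v)"

definition schubert_in :: "nat \<Rightarrow> (nat \<Rightarrow> nat) \<Rightarrow> int_mpoly"
  where "schubert_in n w =
    divdiff_perm (inv w \<circ> longest_perm n) (\<Prod>i\<in>{1..n}. Var i ^ (n - i))"

(* The polynomial does not depend on the n with w in S_n; the least one is used. *)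
definition schubert :: "(nat \<Rightarrow> nat) \<Rightarrow> int_mpoly"
  where "schubert w = schubert_in (LEAST n. w \<in> S_n n) w"

(* t_{a_1,b_1} ... t_{a_k,b_k} *)
definition transp_prod :: "(nat \<Rightarrow> nat) \<Rightarrow> (nat \<Rightarrow> nat) \<Rightarrow> nat \<Rightarrow> nat \<Rightarrow> nat"
  where "transp_prod a b k = foldr (\<lambda>i v. transpose (a i) (b i) \<circ> v) [1..<k + 1] id"

(* The third condition requires every transposition in turn to raise the length by one, not only
   len w' = len w + m, which is its instance k = m. With the latter alone the product formula
   fails: for w = [2,3,1] and r = m = 2 the left-hand side is P_[2,5,1,3,4], but
   w t_{1,3} t_{2,5} = [1,5,2,4,3], of length 4 = len w + 2, would be a further summand. *)
definition pieri_perms :: "(nat \<Rightarrow> nat) \<Rightarrow> nat \<Rightarrow> nat \<Rightarrow> (nat \<Rightarrow> nat) set"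
  where "pieri_perms w r m =
    {w'. \<exists>a b. w' = w \<circ> transp_prod a b m \<and>
      (\<forall>i\<in>{1..m}. 1 \<le> a i \<and> 1 \<le> b i) \<and>
      (inj_on b {1..m} \<and> (\<forall>i\<in>{1..m}. r < b i)) \<and>
      (mono_on {1..m} a \<and> (\<forall>i\<in>{1..m}. a i \<le> r)) \<and>
      (\<forall>k\<in>{1..m}. len (w \<circ> transp_prod a b k) = len w + k) \<and>
      (\<forall>i\<in>{1..m}. \<forall>j\<in>{1..m}. i < j \<and> a i = a j \<longrightarrow>
        w' (b i) < w' (b j) \<and> w' (b j) < w' (a i))}"

end

theory Submission
  imports Defs
begin

text \<open>
  The Schubert polynomial of the cycle \<open>\<sigma>[r,m]\<close> is the complete homogeneous polynomial
  \<open>h\<^sub>m(x\<^sub>1,\<dots>,x\<^sub>r)\<close>, so the theorem expands the product of a Schubert polynomial with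
  \<open>h\<^sub>m(x\<^sub>1,\<dots>,x\<^sub>r)\<close>. This is reduced to multiplication by one variable, for which Monk's rule
  (\<open>schubert_Monk\<close>) holds: \<open>x\<^sub>k P\<^sub>w\<close> is the sum of the \<open>P\<close> of all \<open>w t\<^sub>k\<^sub>b\<close> with \<open>b > k\<close> minus the
  sum of the \<open>P\<close> of all \<open>w t\<^sub>a\<^sub>k\<close> with \<open>a < k\<close>, where only transpositions that raise the length by
  one are allowed.

  Monk's rule follows by induction on the length from the recursion
  \<open>\<partial>\<^sub>i P\<^sub>w = P\<^bsub>w s\<^sub>i\<^esub>\<close> if \<open>w(i) > w(i+1)\<close> and \<open>\<partial>\<^sub>i P\<^sub>w = 0\<close> otherwise (\<open>divdiff_schubert\<close>): all
  divided differences of the two sides agree, and a homogeneous polynomial of positive degree that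
  all \<open>\<partial>\<^sub>i\<close> annihilate is symmetric in infinitely many variables, hence zero
  (\<open>homogeneous_symmetric_eq_0\<close>). The recursion itself needs that \<open>\<partial>\<^sub>v\<close> is independent of the reduced
  word, which follows from the braid relations for the \<open>\<partial>\<^sub>i\<close>, and that \<open>P\<^sub>w\<close> is independent of \<open>n\<close>.

  Write \<open>[a b]\<close> for the operator that sends a function \<open>F\<close> on permutations to the function
  \<open>w \<mapsto> F (w t\<^sub>a\<^sub>b)\<close>, extended by zero where \<open>t\<^sub>a\<^sub>b\<close> does not raise the length of \<open>w\<close> by one. Let \<open>R(r,m)\<close>
  be the sum of the products \<open>[a\<^sub>1 b\<^sub>1]\<dots>[a\<^sub>m b\<^sub>m]\<close> over \<open>a\<^sub>1 \<le> \<dots> \<le> a\<^sub>m \<le> r\<close> and distinct \<open>b\<^sub>i > r\<close>. Since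
  \<open>h\<^sub>m(x\<^sub>1,\<dots>,x\<^sub>r) = h\<^sub>m(x\<^sub>1,\<dots>,x\<^bsub>r-1\<^esub>) + x\<^sub>r h\<^bsub>m-1\<^esub>(x\<^sub>1,\<dots>,x\<^sub>r)\<close>, it suffices to prove the operator identity
  \<open>R(r,m) = R(r-1,m) + R(r,m-1) \<theta>\<^sub>r\<close>, where \<open>\<theta>\<^sub>r\<close> is the operator of multiplication by \<open>x\<^sub>r\<close> in
  Monk's rule (\<open>pieri_sum_recursion\<close>). Three relations between the operators are enough: operators with
  disjoint indices commute, a product \<open>[r b]\<dots>[r b]\<close> of operators \<open>[r c]\<close> with a repeated \<open>b\<close> vanishes, and
  \<open>[r b][a r] = [a r][a b] + [a b][r b]\<close> for \<open>a < r < b\<close>. Pushing \<open>[a r]\<close> through \<open>[r b\<^sub>1]\<dots>[r b\<^sub>k]\<close> by the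
  last relation gives \<open>[a r][a b\<^sub>1]\<dots>[a b\<^sub>k]\<close> and the products
  \<open>[a b\<^sub>j]\<dots>[a b\<^sub>k] [r b\<^sub>1]\<dots>[r b\<^sub>j]\<close>. The former account for the terms of \<open>R(r-1,m)\<close> in which some \<open>b\<^sub>i\<close>
  is \<open>r\<close>; the latter cancel the terms of \<open>R(r,m-1) \<theta>\<^sub>r\<close> in which the new \<open>b\<close> has already
  been used with an \<open>a < r\<close>.

  The same end point \<open>w'\<close> does not occur twice in \<open>R(r,m)\<close>, because \<open>a\<^sub>m\<close> is the largest element up to
  \<open>r\<close> that \<open>w\<^sup>-\<^sup>1w'\<close> moves, and \<open>b\<^sub>m\<close> is its image (\<open>path_perm_inject\<close>). The inequalities between the values
  of \<open>w'\<close> hold for every such chain, as each step raises the value at \<open>a\<^sub>i\<close> and leaves the old value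
  at \<open>b\<^sub>i\<close> for good (\<open>bruhat_path_values\<close>). Finally, from \<open>w = 1\<close> the only end point is
  \<open>\<sigma>[r,m]\<close> (\<open>pieri_perms_id\<close>), which identifies its Schubert polynomial with
  \<open>h\<^sub>m(x\<^sub>1,\<dots>,x\<^sub>r)\<close>.
\<close>

section \<open>Divided differences\<close>

lemma poly_mapping_single_add_induct [case_names zero single_add]:
  fixes P :: "('a \<Rightarrow>\<^sub>0 'b::monoid_add) \<Rightarrow> bool"
  assumes "P 0" and "\<And>a b f. P f \<Longrightarrow> P (Poly_Mapping.single a b + f)"
  shows "P f"
proof (induction f rule: update_induct)
  case const
  show ?case by (fact assms(1))
next
  case (update f a b)
  have "Poly_Mapping.update a b f = Poly_Mapping.single a b + f"
    using update(1) by (intro poly_mapping_eqI)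
      (auto simp: lookup_update lookup_add lookup_single when_def in_keys_iff)
  then show ?case
    using assms(2) update by simp
qed

lemma swap_vars_zero [simp]: "swap_vars i 0 = 0"
  by (intro poly_mapping_eqI) (simp add: lookup_swap_vars)

lemma swap_vars_add [simp]: "swap_vars i (f + g) = swap_vars i f + swap_vars i g"
  by (intro poly_mapping_eqI) (simp add: lookup_swap_vars lookup_add)

lemma swap_vars_uminus [simp]: "swap_vars i (- f) = - swap_vars i f"
  by (intro poly_mapping_eqI) (simp add: lookup_swap_vars)

lemma swap_vars_diff [simp]: "swap_vars i (f - g) = swap_vars i f - swap_vars i g"
  by (intro poly_mapping_eqI) (simp add: lookup_swap_vars lookup_minus)

lemma swap_vars_swap_vars [simp]: "swap_vars i (swap_vars i f) = f"
  by (intro poly_mapping_eqI) (simp only: lookup_swap_vars map_key_transpose_involution)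

lemma swap_vars_single:
  "swap_vars i (Poly_Mapping.single e c)
    = Poly_Mapping.single (Poly_Mapping.map_key (transpose i (i + 1)) e) c"
proof -
  let ?k = "Poly_Mapping.map_key (transpose i (i + 1)) :: (nat \<Rightarrow>\<^sub>0 nat) \<Rightarrow> _"
  have "Poly_Mapping.map_key ?k (Poly_Mapping.single (?k (?k e)) c) = Poly_Mapping.single (?k e) c"
    by (rule map_key_single[OF inj_map_key_transpose])
  then show ?thesis
    by (simp only: swap_vars_def map_key_transpose_involution)
qed

lemma swap_vars_mult [simp]: "swap_vars i (f * g) = swap_vars i f * swap_vars i g"
proof (induction f rule: poly_mapping_single_add_induct)
  case zero
  show ?case by simp
next
  case (single_add a b f)
  have "swap_vars i (Poly_Mapping.single a b * g)
      = swap_vars i (Poly_Mapping.single a b) * swap_vars i g"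
    by (induction g rule: poly_mapping_single_add_induct)
      (simp_all add: swap_vars_single mult_single distrib_left map_key_plus inj_swap)
  with single_add show ?case
    by (simp add: distrib_right)
qed

lemma swap_vars_one [simp]: "swap_vars i 1 = 1"
  unfolding single_one[symmetric] by (simp only: swap_vars_single) (simp add: inj_swap)

lemma swap_vars_single_zero [simp]:
  "swap_vars i (Poly_Mapping.single 0 c) = Poly_Mapping.single 0 c"
  by (simp only: swap_vars_single) (simp add: inj_swap)

lemma Var_eq_iff [simp]: "Var i = Var j \<longleftrightarrow> i = j"
  unfolding Var_def by (metis lookup_single_eq lookup_single_not_eq zero_neq_one)

text \<open>Write \<open>\<sigma>f\<close> for \<open>swap_vars i f\<close>. The polynomials \<open>f\<close> with such a quotient contain the constants and the
  variables, and they are closed under sums and, by \<open>fg - \<sigma>(fg) = (f - \<sigma>f) g + \<sigma>f (g - \<sigma>g)\<close>, under products.\<close>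

lemma ex_divided_difference: "\<exists>g. (Var i - Var (i + 1)) * g = f - swap_vars i f"
proof -
  define D where "D f \<longleftrightarrow> (\<exists>g. (Var i - Var (i + 1)) * g = f - swap_vars i f)" for f
  have add: "D (f + g)" if "D f" "D g" for f g
  proof -
    from that obtain f' g' where "(Var i - Var (i + 1)) * f' = f - swap_vars i f"
      and "(Var i - Var (i + 1)) * g' = g - swap_vars i g"
      unfolding D_def by blast
    then have "(Var i - Var (i + 1)) * (f' + g') = (f + g) - swap_vars i (f + g)"
      by (simp add: distrib_left)
    then show ?thesis unfolding D_def by blast
  qed
  have mult: "D (f * g)" if "D f" "D g" for f g
  proof -
    from that obtain f' g' where f': "(Var i - Var (i + 1)) * f' = f - swap_vars i f"
      and g': "(Var i - Var (i + 1)) * g' = g - swap_vars i g"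
      unfolding D_def by blast
    have "(Var i - Var (i + 1)) * (f' * g + swap_vars i f * g')
        = ((Var i - Var (i + 1)) * f') * g + swap_vars i f * ((Var i - Var (i + 1)) * g')"
      by (simp add: algebra_simps)
    also have "\<dots> = f * g - swap_vars i (f * g)"
      unfolding f' g' by (simp add: algebra_simps)
    finally show ?thesis unfolding D_def by blast
  qed
  have const: "D (Poly_Mapping.single 0 c)" for c
    unfolding D_def by (intro exI[of _ 0]) simp
  have var: "D (Var j)" for j
  proof -
    consider "j = i" | "j = i + 1" | "j \<noteq> i" "j \<noteq> i + 1" by blast
    then show ?thesis
    proof cases
      case 1
      then show ?thesis unfolding D_def by (intro exI[of _ 1]) (simp add: swap_vars_Var)
    next
      case 2
      then show ?thesis unfolding D_def by (intro exI[of _ "- 1"]) (simp add: swap_vars_Var)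
    next
      case 3
      then show ?thesis unfolding D_def by (intro exI[of _ 0]) (simp add: swap_vars_Var)
    qed
  qed
  have power: "D (Poly_Mapping.single (Poly_Mapping.single j n) 1)" for j n
  proof (induction n)
    case 0
    show ?case using const[of 1] by simp
  next
    case (Suc n)
    have "Poly_Mapping.single (Poly_Mapping.single j (Suc n)) 1
        = Var j * Poly_Mapping.single (Poly_Mapping.single j n) 1"
      by (simp add: Var_def mult_single flip: single_add)
    then show ?case using mult[OF var Suc] by simp
  qed
  have monom: "D (Poly_Mapping.single e 1)" for e
  proof (induction e rule: poly_mapping_single_add_induct)
    case zero
    show ?case by (rule const)
  next
    case (single_add a b e)
    have "Poly_Mapping.single (Poly_Mapping.single a b + e) 1
        = (Poly_Mapping.single (Poly_Mapping.single a b) 1 * Poly_Mapping.single e 1 :: int_mpoly)"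
      by (simp add: mult_single)
    then show ?case using mult[OF power single_add] by simp
  qed
  have "D f"
  proof (induction f rule: poly_mapping_single_add_induct)
    case zero
    show ?case using const[of 0] by simp
  next
    case (single_add a b f)
    have "D (Poly_Mapping.single 0 b * Poly_Mapping.single a 1)"
      by (rule mult[OF const monom])
    then have "D (Poly_Mapping.single a b)" by (simp add: mult_single)
    then show ?case by (rule add[OF _ single_add])
  qed
  then show ?thesis unfolding D_def .
qed

lemma Var_diff_mult_cancel:
  assumes "(Var i - Var j) * f = (Var i - Var j) * g" "i \<noteq> j"
  shows "f = g"
  using assms by simp

lemma divdiff_mult: "(Var i - Var (i + 1)) * divdiff i f = f - swap_vars i f"
  unfolding divdiff_def
proof (rule theI')
  show "\<exists>!g. (Var i - Var (i + 1)) * g = f - swap_vars i f"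
    using ex_divided_difference[of i f] Var_diff_mult_cancel[of i "i + 1"]
    by (metis n_not_Suc_n Suc_eq_plus1)
qed

lemma divdiff_eqI:
  assumes "(Var i - Var (i + 1)) * g = f - swap_vars i f"
  shows "divdiff i f = g"
  using divdiff_mult[of i f] assms Var_diff_mult_cancel[of i "i + 1"]
  by (metis n_not_Suc_n Suc_eq_plus1)

lemma divdiff_symmetric: "swap_vars i f = f \<Longrightarrow> divdiff i f = 0"
  by (rule divdiff_eqI) simp

lemma divdiff_eq_0_iff: "divdiff i f = 0 \<longleftrightarrow> swap_vars i f = f"
  using divdiff_mult[of i f] by (auto intro: divdiff_symmetric)

lemma divdiff_zero [simp]: "divdiff i 0 = 0"
  by (rule divdiff_symmetric) simp

lemma divdiff_add [simp]: "divdiff i (f + g) = divdiff i f + divdiff i g"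
  by (rule divdiff_eqI) (simp add: distrib_left divdiff_mult[unfolded Suc_eq_plus1[symmetric]])

lemma divdiff_uminus [simp]: "divdiff i (- f) = - divdiff i f"
  by (rule divdiff_eqI) (simp add: divdiff_mult[unfolded Suc_eq_plus1[symmetric]])

lemma divdiff_diff [simp]: "divdiff i (f - g) = divdiff i f - divdiff i g"
  using divdiff_add[of i f "- g"] by simp

lemma divdiff_sum: "divdiff i (sum f A) = (\<Sum>x\<in>A. divdiff i (f x))"
  by (induction A rule: infinite_finite_induct) simp_all

lemma divdiff_Leibniz: "divdiff i (f * g) = divdiff i f * g + swap_vars i f * divdiff i g"
proof (rule divdiff_eqI)
  have "(Var i - Var (i + 1)) * (divdiff i f * g + swap_vars i f * divdiff i g)
      = ((Var i - Var (i + 1)) * divdiff i f) * g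
        + swap_vars i f * ((Var i - Var (i + 1)) * divdiff i g)"
    by (simp add: algebra_simps)
  also have "\<dots> = f * g - swap_vars i (f * g)"
    unfolding divdiff_mult by (simp add: algebra_simps)
  finally show "(Var i - Var (i + 1)) * (divdiff i f * g + swap_vars i f * divdiff i g)
      = f * g - swap_vars i (f * g)" .
qed

lemma swap_vars_divdiff: "swap_vars i (divdiff i f) = divdiff i f"
proof (rule Var_diff_mult_cancel)
  have "swap_vars i ((Var i - Var (i + 1)) * divdiff i f) = swap_vars i (f - swap_vars i f)"
    by (simp only: divdiff_mult)
  then have "(Var (i + 1) - Var i) * swap_vars i (divdiff i f) = swap_vars i f - f"
    by (simp add: swap_vars_Var)
  then have "- ((Var (i + 1) - Var i) * swap_vars i (divdiff i f)) = f - swap_vars i f"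
    by simp
  then show "(Var i - Var (i + 1)) * swap_vars i (divdiff i f) = (Var i - Var (i + 1)) * divdiff i f"
    unfolding divdiff_mult by (simp add: algebra_simps)
qed simp

lemma divdiff_divdiff: "divdiff i (divdiff i f) = 0"
  by (rule divdiff_symmetric[OF swap_vars_divdiff])

lemma divdiff_Var:
  "divdiff i (Var j) = (if j = i then 1 else if j = i + 1 then - 1 else 0)"
  by (rule divdiff_eqI) (auto simp: swap_vars_Var)

lemma swap_vars_braid:
  "swap_vars i (swap_vars (Suc i) (swap_vars i f))
    = swap_vars (Suc i) (swap_vars i (swap_vars (Suc i) f))"
proof -
  have t: "transpose i (Suc i) (transpose (Suc i) (Suc (Suc i)) (transpose i (Suc i) x))
      = transpose (Suc i) (Suc (Suc i)) (transpose i (Suc i) (transpose (Suc i) (Suc (Suc i)) x))"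
    for x :: nat
    by (auto simp: transpose_def)
  show ?thesis
    by (intro poly_mapping_eqI, unfold lookup_swap_vars, rule arg_cong[of _ _ "Poly_Mapping.lookup f"],
        intro poly_mapping_eqI)
      (simp add: map_key.rep_eq inj_swap t)
qed

lemma swap_vars_commute:
  assumes "Suc i < j"
  shows "swap_vars i (swap_vars j f) = swap_vars j (swap_vars i f)"
proof -
  have t: "transpose i (Suc i) (transpose j (Suc j) x) = transpose j (Suc j) (transpose i (Suc i) x)"
    for x :: nat
    using assms by (auto simp: transpose_def)
  show ?thesis
    by (intro poly_mapping_eqI, unfold lookup_swap_vars, rule arg_cong[of _ _ "Poly_Mapping.lookup f"],
        intro poly_mapping_eqI)
      (simp add: map_key.rep_eq inj_swap t)
qed

lemma divdiff_commute:
  assumes "Suc i < j"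
  shows "divdiff i (divdiff j f) = divdiff j (divdiff i f)"
proof -
  let ?x = "Var i - Var (i + 1)" and ?y = "Var j - Var (j + 1)"
  have y: "?y * swap_vars i (divdiff j f) = swap_vars i f - swap_vars i (swap_vars j f)"
    using arg_cong[OF divdiff_mult[of j f], of "swap_vars i"] assms by (simp add: swap_vars_Var)
  have x: "?x * swap_vars j (divdiff i f) = swap_vars j f - swap_vars j (swap_vars i f)"
    using arg_cong[OF divdiff_mult[of i f], of "swap_vars j"] assms by (simp add: swap_vars_Var)
  have "?y * (?x * divdiff i (divdiff j f)) = ?y * divdiff j f - ?y * swap_vars i (divdiff j f)"
    by (simp only: divdiff_mult right_diff_distrib)
  also have "\<dots> = (f - swap_vars j f) - (swap_vars i f - swap_vars i (swap_vars j f))"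
    by (simp only: divdiff_mult y)
  also have "\<dots> = (f - swap_vars i f) - (swap_vars j f - swap_vars j (swap_vars i f))"
    by (simp add: swap_vars_commute[OF assms])
  also have "\<dots> = ?x * divdiff i f - ?x * swap_vars j (divdiff i f)"
    by (simp only: divdiff_mult x)
  also have "\<dots> = ?x * (?y * divdiff j (divdiff i f))"
    by (simp only: divdiff_mult right_diff_distrib)
  finally have "?y * (?x * divdiff i (divdiff j f)) = ?y * (?x * divdiff j (divdiff i f))"
    by (simp only: mult.left_commute)
  then show ?thesis by simp
qed

text \<open>Multiplied by \<open>(x - y)(x - z)(y - z)\<close>, either side becomes the alternating sum of \<open>f\<close> over the six
  permutations of the three variables \<open>x\<close>, \<open>y\<close>, \<open>z\<close>; the two sums agree by the braid relation for the
  variable exchanges.\<close>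

lemma divdiff_braid:
  "divdiff i (divdiff (Suc i) (divdiff i f)) = divdiff (Suc i) (divdiff i (divdiff (Suc i) f))"
proof -
  define x y z where "x = Var i" and "y = Var (Suc i)" and "z = Var (Suc (Suc i))"
  define s t where "s = swap_vars i" and "t = swap_vars (Suc i)"
  have sv: "s x = y" "s y = x" "s z = z" "t x = x" "t y = z" "t z = y"
    by (simp_all add: x_def y_def z_def s_def t_def swap_vars_Var)
  have hom: "s (u - v) = s u - s v" "t (u - v) = t u - t v" "s (u * v) = s u * s v"
    "t (u * v) = t u * t v" "s (s u) = u" "t (t u) = u" for u v
    by (simp_all add: s_def t_def)
  have nz: "(x - y) * (x - z) * (y - z) \<noteq> 0"
    by (simp add: x_def y_def z_def)
  have d1: "(x - y) * divdiff i u = u - s u" for u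
    using divdiff_mult[of i u] by (simp add: x_def y_def s_def)
  have d2: "(y - z) * divdiff (Suc i) u = u - t u" for u
    using divdiff_mult[of "Suc i" u] by (simp add: y_def z_def t_def)
  have s1: "s (divdiff i u) = divdiff i u" and t2: "t (divdiff (Suc i) u) = divdiff (Suc i) u" for u
    by (simp_all add: s_def t_def swap_vars_divdiff)
  have t1: "(x - z) * t (divdiff i u) = t u - t (s u)" for u
    using arg_cong[OF d1[of u], of t] by (simp add: hom sv)
  have st1: "(y - z) * s (t (divdiff i u)) = s (t u) - s (t (s u))" for u
    using arg_cong[OF t1[of u], of s] by (simp add: hom sv)
  have s2: "(x - z) * s (divdiff (Suc i) u) = s u - s (t u)" for u
    using arg_cong[OF d2[of u], of s] by (simp add: hom sv)
  have ts2: "(x - y) * t (s (divdiff (Suc i) u)) = t (s u) - t (s (t u))" for u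
    using arg_cong[OF s2[of u], of t] by (simp add: hom sv)
  have 1: "(x - y) * (x - z) * (y - z) * divdiff i (divdiff (Suc i) (divdiff i f))
      = f - s f - t f + t (s f) + s (t f) - s (t (s f))"
  proof -
    let ?g = "divdiff i f" and ?h = "divdiff (Suc i) (divdiff i f)"
    have "(x - y) * (x - z) * (y - z) * divdiff i ?h
        = (x - z) * (y - z) * ((x - y) * divdiff i ?h)" by (simp add: algebra_simps)
    also have "\<dots> = (x - z) * ((y - z) * ?h) - (y - z) * ((x - z) * s ?h)"
      unfolding d1 by (simp add: algebra_simps)
    also have "\<dots> = (x - z) * (?g - t ?g) - (y - z) * (?g - s (t ?g))"
      unfolding d2 s2 s1 ..
    also have "\<dots> = (x - y) * ?g - (x - z) * t ?g + (y - z) * s (t ?g)"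
      by (simp add: algebra_simps)
    also have "\<dots> = f - s f - t f + t (s f) + s (t f) - s (t (s f))"
      unfolding d1 t1 st1 by simp
    finally show ?thesis .
  qed
  have 2: "(x - y) * (x - z) * (y - z) * divdiff (Suc i) (divdiff i (divdiff (Suc i) f))
      = f - s f - t f + t (s f) + s (t f) - t (s (t f))"
  proof -
    let ?g = "divdiff (Suc i) f" and ?h = "divdiff i (divdiff (Suc i) f)"
    have "(x - y) * (x - z) * (y - z) * divdiff (Suc i) ?h
        = (x - z) * (x - y) * ((y - z) * divdiff (Suc i) ?h)" by (simp add: algebra_simps)
    also have "\<dots> = (x - z) * ((x - y) * ?h) - (x - y) * ((x - z) * t ?h)"
      unfolding d2 by (simp add: algebra_simps)
    also have "\<dots> = (x - z) * (?g - s ?g) - (x - y) * (?g - t (s ?g))"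
      unfolding d1 t1 t2 ..
    also have "\<dots> = (y - z) * ?g - (x - z) * s ?g + (x - y) * t (s ?g)"
      by (simp add: algebra_simps)
    also have "\<dots> = f - s f - t f + t (s f) + s (t f) - t (s (t f))"
      unfolding d2 s2 ts2 by simp
    finally show ?thesis .
  qed
  have "s (t (s f)) = t (s (t f))"
    unfolding s_def t_def by (rule swap_vars_braid)
  with 1 2 have "(x - y) * (x - z) * (y - z) * divdiff i (divdiff (Suc i) (divdiff i f))
      = (x - y) * (x - z) * (y - z) * divdiff (Suc i) (divdiff i (divdiff (Suc i) f))"
    by simp
  with nz show ?thesis
    by (metis mult_left_cancel)
qed

section \<open>Homogeneous polynomials\<close>

text \<open>Homogeneity in the variables with positive index. Generating the polynomials by multiplication with
  variables lets statements about divided differences be proved by the Leibniz rule.\<close>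

inductive homogeneous :: "nat \<Rightarrow> int_mpoly \<Rightarrow> bool" where
  zero: "homogeneous d 0"
| one: "homogeneous 0 1"
| uminus: "homogeneous d f \<Longrightarrow> homogeneous d (- f)"
| add: "homogeneous d f \<Longrightarrow> homogeneous d g \<Longrightarrow> homogeneous d (f + g)"
| Var_mult: "homogeneous d f \<Longrightarrow> 1 \<le> i \<Longrightarrow> homogeneous (Suc d) (Var i * f)"

lemma homogeneous_diff: "homogeneous d f \<Longrightarrow> homogeneous d g \<Longrightarrow> homogeneous d (f - g)"
  using homogeneous.add[OF _ homogeneous.uminus, of d f g] by simp

lemma homogeneous_sum: "(\<And>x. x \<in> A \<Longrightarrow> homogeneous d (f x)) \<Longrightarrow> homogeneous d (sum f A)"
  by (induction A rule: infinite_finite_induct) (auto intro: homogeneous.intros)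

lemma homogeneous_mult: "homogeneous d f \<Longrightarrow> homogeneous e g \<Longrightarrow> homogeneous (d + e) (f * g)"
  by (induction rule: homogeneous.induct)
    (auto simp: distrib_right mult.assoc intro: homogeneous.intros)

lemma homogeneous_Var_power: "1 \<le> i \<Longrightarrow> homogeneous k (Var i ^ k)"
  by (induction k) (auto intro: homogeneous.intros)

lemma homogeneous_prod:
  "(\<And>x. x \<in> A \<Longrightarrow> homogeneous (d x) (f x)) \<Longrightarrow> homogeneous (sum d A) (prod f A)"
  by (induction A rule: infinite_finite_induct)
    (auto intro: homogeneous.intros homogeneous_mult)

lemma homogeneous_divdiff:
  assumes "homogeneous d f" and "1 \<le> i"
  shows "homogeneous (d - 1) (divdiff i f)"
proof -
  \<comment> \<open>In degree 0 the truncated degree \<open>d - 1\<close> is 0 again, so vanishing has to be carried along.\<close>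
  have "homogeneous (d - 1) (divdiff i f) \<and> (d = 0 \<longrightarrow> divdiff i f = 0)"
    using assms(1)
  proof (induction rule: homogeneous.induct)
    case one
    have "divdiff i 1 = 0" by (rule divdiff_symmetric) simp
    then show ?case by (simp add: homogeneous.zero)
  next
    case (Var_mult d f j)
    have "homogeneous d (divdiff i (Var j) * f)"
      using Var_mult.hyps(1) by (auto simp: divdiff_Var intro: homogeneous.intros)
    moreover have "homogeneous d (swap_vars i (Var j) * divdiff i f)"
    proof (cases "d = 0")
      case True
      then show ?thesis using Var_mult.IH by (simp add: homogeneous.zero)
    next
      case False
      then have "homogeneous (Suc (d - 1)) (swap_vars i (Var j) * divdiff i f)"
        unfolding swap_vars_Var
        using Var_mult.IH Var_mult.hyps(2) assms(2)
        by (intro homogeneous.Var_mult) (auto simp: transpose_def)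
      with False show ?thesis by simp
    qed
    ultimately show ?case
      by (simp add: divdiff_Leibniz homogeneous.add)
  qed (auto intro: homogeneous.intros)
  then show ?thesis by simp
qed

text \<open>The variable of index 0 has to be excluded because no exchange of variables in
  \<open>homogeneous_symmetric_eq_0\<close> moves it.\<close>

lemma homogeneous_keys:
  assumes "homogeneous d f" and "e \<in> Poly_Mapping.keys f"
  shows "Poly_Mapping.lookup e 0 = 0 \<and> (e = 0 \<longrightarrow> d = 0)"
  using assms
proof (induction arbitrary: e rule: homogeneous.induct)
  case (add d f g)
  then show ?case using keys_add[of f g] by blast
next
  case (Var_mult d f i)
  then have "e \<in> {a + b | a b. a \<in> Poly_Mapping.keys (Var i) \<and> b \<in> Poly_Mapping.keys f}"
    using keys_mult by blast
  then obtain b where b: "e = Poly_Mapping.single i 1 + b" "b \<in> Poly_Mapping.keys f"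
    by (auto simp: Var_def)
  have "Poly_Mapping.lookup e i \<noteq> 0" using b by (simp add: lookup_add)
  then have "e \<noteq> 0" by auto
  with b Var_mult show ?case by (simp add: lookup_add lookup_single)
qed auto

text \<open>Otherwise some exponent vector of \<open>f\<close> is nonzero at an index \<open>j\<close>, and by symmetry under the exchanges
  of neighbouring variables some exponent vector is nonzero at every index from \<open>j\<close> on. But only finitely
  many variables occur in \<open>f\<close>.\<close>

lemma homogeneous_symmetric_eq_0:
  assumes "homogeneous d f" and "0 < d" and "\<And>i. 1 \<le> i \<Longrightarrow> divdiff i f = 0"
  shows "f = 0"
proof (rule ccontr)
  assume "f \<noteq> 0"
  then obtain e where e: "e \<in> Poly_Mapping.keys f" by (metis keys_eq_empty ex_in_conv)
  have "e \<noteq> 0" "Poly_Mapping.lookup e 0 = 0"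
    using homogeneous_keys[OF assms(1) e] assms(2) by auto
  then obtain j where j: "Poly_Mapping.lookup e j \<noteq> 0" by (metis poly_mapping_eqI lookup_zero)
  have "1 \<le> j" using j \<open>Poly_Mapping.lookup e 0 = 0\<close> by (cases j) auto
  have "\<exists>e\<in>Poly_Mapping.keys f. Poly_Mapping.lookup e (j + k) \<noteq> 0" for k
  proof (induction k)
    case 0
    show ?case using e j by auto
  next
    case (Suc k)
    let ?i = "j + k"
    obtain e where e: "e \<in> Poly_Mapping.keys f" "Poly_Mapping.lookup e ?i \<noteq> 0" using Suc by blast
    let ?e = "Poly_Mapping.map_key (transpose ?i (?i + 1)) e"
    have "swap_vars ?i f = f"
      using assms(3)[of ?i] \<open>1 \<le> j\<close> by (simp add: divdiff_eq_0_iff)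
    then have "Poly_Mapping.lookup f ?e = Poly_Mapping.lookup f e"
      by (metis lookup_swap_vars)
    with e have "?e \<in> Poly_Mapping.keys f" by (simp add: in_keys_iff)
    moreover have "Poly_Mapping.lookup ?e (j + Suc k) \<noteq> 0"
      using e by (simp add: map_key.rep_eq inj_swap)
    ultimately show ?case by blast
  qed
  then have "{j..} \<subseteq> (\<Union>e\<in>Poly_Mapping.keys f. Poly_Mapping.keys e)"
    by (force simp: in_keys_iff le_iff_add)
  moreover have "finite (\<Union>e\<in>Poly_Mapping.keys f. Poly_Mapping.keys e)" by simp
  ultimately have "finite {j..}" by (rule finite_subset)
  then show False by (simp add: infinite_Ici)
qed

section \<open>Permutations with finite support\<close>

abbreviation simple_refl :: "nat \<Rightarrow> nat \<Rightarrow> nat"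
  where "simple_refl i \<equiv> transpose i (Suc i)"

lemma S_infinityI: "w \<in> S_n n \<Longrightarrow> w \<in> S_infinity"
  by (auto simp: S_infinity_def)

lemma S_infinityE:
  assumes "w \<in> S_infinity"
  obtains n where "w \<in> S_n n"
  using assms by (auto simp: S_infinity_def)

lemma S_n_mono: "w \<in> S_n n \<Longrightarrow> n \<le> n' \<Longrightarrow> w \<in> S_n n'"
  unfolding S_n_def by (auto intro: permutes_subset)

lemma id_in_S_n [simp]: "id \<in> S_n n"
  by (simp add: S_n_def permutes_id)

lemma S_n_compose: "u \<in> S_n n \<Longrightarrow> v \<in> S_n n \<Longrightarrow> u \<circ> v \<in> S_n n"
  by (simp add: S_n_def permutes_compose)

lemma S_n_inv: "u \<in> S_n n \<Longrightarrow> inv u \<in> S_n n"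
  by (simp add: S_n_def permutes_inv)

lemma transpose_in_S_n: "1 \<le> a \<Longrightarrow> a \<le> n \<Longrightarrow> 1 \<le> b \<Longrightarrow> b \<le> n \<Longrightarrow> transpose a b \<in> S_n n"
  by (simp add: S_n_def permutes_swap_id)

lemma id_in_S_infinity [simp]: "id \<in> S_infinity"
  using S_infinityI[OF id_in_S_n] .

lemma S_infinity_compose: "u \<in> S_infinity \<Longrightarrow> v \<in> S_infinity \<Longrightarrow> u \<circ> v \<in> S_infinity"
proof -
  assume "u \<in> S_infinity" "v \<in> S_infinity"
  then obtain k l where "u \<in> S_n k" "v \<in> S_n l" by (auto elim!: S_infinityE)
  then have "u \<circ> v \<in> S_n (max k l)"
    using S_n_compose S_n_mono by (meson max.cobounded1 max.cobounded2)
  then show ?thesis by (rule S_infinityI)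
qed

lemma S_infinity_inv: "u \<in> S_infinity \<Longrightarrow> inv u \<in> S_infinity"
  by (auto elim!: S_infinityE intro: S_infinityI S_n_inv)

lemma transpose_in_S_infinity [simp]: "1 \<le> a \<Longrightarrow> 1 \<le> b \<Longrightarrow> transpose a b \<in> S_infinity"
  by (rule S_infinityI[OF transpose_in_S_n[of a "max a b" b]]) auto

lemma S_infinity_bij: "w \<in> S_infinity \<Longrightarrow> bij w"
  by (auto elim!: S_infinityE simp: S_n_def permutes_bij)

lemma S_infinity_inj: "w \<in> S_infinity \<Longrightarrow> inj w"
  using S_infinity_bij bij_is_inj by blast

lemma S_infinity_eq_iff: "w \<in> S_infinity \<Longrightarrow> w x = w y \<longleftrightarrow> x = y"
  using S_infinity_inj by (metis injD)

lemma S_infinity_0: "w \<in> S_infinity \<Longrightarrow> w 0 = 0"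
  by (auto elim!: S_infinityE simp: S_n_def permutes_def)

lemma S_infinity_ge_1: "w \<in> S_infinity \<Longrightarrow> 1 \<le> w x \<longleftrightarrow> 1 \<le> x"
  using S_infinity_0[of w] S_infinity_eq_iff[of w x 0] by auto

lemma inv_simple_refl_comp: "bij w \<Longrightarrow> inv (simple_refl i \<circ> w) = inv w \<circ> simple_refl i"
  by (simp add: o_inv_distrib)

lemma inv_comp_simple_refl: "bij w \<Longrightarrow> inv (w \<circ> simple_refl i) = simple_refl i \<circ> inv w"
  by (simp add: o_inv_distrib)

text \<open>Strict increase gives \<open>w(i) \<ge> i\<close> from below, and \<open>w(i) \<le> i\<close> by comparison with a large fixed point.\<close>

lemma increasing_imp_id:
  assumes w: "w \<in> S_infinity" and "\<And>i. 1 \<le> i \<Longrightarrow> w i < w (Suc i)"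
  shows "w = id"
proof
  fix i
  obtain n where n: "w \<in> S_n n" using w by (rule S_infinityE)
  have up: "w i + k \<le> w (i + k)" if "1 \<le> i" for i k
  proof (induction k)
    case (Suc k)
    then show ?case using assms(2)[of "i + k"] that by simp
  qed simp
  have fixed: "w j = j" if "n < j" for j
    using n that by (simp add: S_n_def permutes_def)
  show "w i = id i"
  proof (cases "i = 0")
    case False
    have "w 1 + (i - 1) \<le> w i" "1 \<le> w 1"
      using up[of 1 "i - 1"] False S_infinity_ge_1[OF w, of 1] by auto
    moreover have "w i + Suc n \<le> w (i + Suc n)" using up[of i "Suc n"] False by simp
    moreover have "w (i + Suc n) = i + Suc n" by (rule fixed) simp
    ultimately show ?thesis using False by simp
  qed (simp add: S_infinity_0[OF w])
qed

section \<open>Length\<close>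

definition inversions :: "(nat \<Rightarrow> nat) \<Rightarrow> (nat \<times> nat) set"
  where "inversions w = {(i, j). 1 \<le> i \<and> i < j \<and> w j < w i}"

lemma len_eq: "len w = card (inversions w)"
  by (simp add: len_def inversions_def)

lemma inversions_subset:
  assumes "w \<in> S_n n"
  shows "inversions w \<subseteq> {..n} \<times> {..n}"
proof -
  have range: "w x \<le> n" if "x \<le> n" for x
    using assms that permutes_in_image[of w "{1..n}" x] S_infinity_0[OF S_infinityI[OF assms]]
    by (cases "x = 0") (auto simp: S_n_def)
  have fixed: "w x = x" if "n < x" for x
    using assms that by (simp add: S_n_def permutes_def)
  have "j \<le> n" if "i < j" "w j < w i" for i j
    using that range[of i] fixed[of j] fixed[of i] by (cases "i \<le> n"; cases "j \<le> n") auto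
  then show ?thesis unfolding inversions_def by fastforce
qed

lemma finite_inversions:
  assumes "w \<in> S_infinity"
  shows "finite (inversions w)"
proof -
  obtain n where "w \<in> S_n n" using assms by (rule S_infinityE)
  from inversions_subset[OF this] show ?thesis by (rule finite_subset) simp
qed

lemma len_id [simp]: "len id = 0"
proof -
  have "inversions id = {}" by (auto simp: inversions_def)
  then show ?thesis by (simp add: len_eq)
qed

lemma len_inv:
  assumes w: "w \<in> S_infinity"
  shows "len (inv w) = len w"
proof -
  have i: "inv w (w x) = x" "w (inv w x) = x" for x
    using S_infinity_bij[OF w] by (simp_all add: bij_is_inj bij_is_surj surj_f_inv_f)
  have "bij_betw (\<lambda>(i, j). (w j, w i)) (inversions w) (inversions (inv w))"
    by (rule bij_betw_byWitness[where f' = "\<lambda>(i, j). (inv w j, inv w i)"])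
      (auto simp: inversions_def i S_infinity_ge_1[OF w, unfolded One_nat_def]
        S_infinity_ge_1[OF S_infinity_inv[OF w], unfolded One_nat_def])
  then show ?thesis
    unfolding len_eq by (metis bij_betw_same_card)
qed

lemma simple_refl_less_iff:
  "x \<noteq> y \<Longrightarrow> simple_refl i x < simple_refl i y
    \<longleftrightarrow> (x < y \<and> \<not> (x = i \<and> y = Suc i)) \<or> (x = Suc i \<and> y = i)"
  by (auto simp: transpose_def)

text \<open>Exchanging the values \<open>i\<close> and \<open>i + 1\<close> alters only the relative order of the two positions that hold
  them.\<close>

lemma len_simple_refl_comp_ascent:
  assumes w: "w \<in> S_infinity" and i: "1 \<le> i" and asc: "inv w i < inv w (Suc i)"
  shows "len (simple_refl i \<circ> w) = Suc (len w)"
proof -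
  have v: "inv w (w x) = x" "w (inv w x) = x" for x
    using S_infinity_bij[OF w] by (simp_all add: bij_is_inj bij_is_surj surj_f_inv_f)
  have "inversions (simple_refl i \<circ> w) = insert (inv w i, inv w (Suc i)) (inversions w)"
  proof -
    have "(p, q) \<in> inversions (simple_refl i \<circ> w)
        \<longleftrightarrow> (p, q) \<in> insert (inv w i, inv w (Suc i)) (inversions w)" for p q
    proof (cases "1 \<le> p \<and> p < q")
      case True
      then have "w q \<noteq> w p" using S_infinity_eq_iff[OF w] by simp
      then have "simple_refl i (w q) < simple_refl i (w p)
          \<longleftrightarrow> (w q < w p \<and> \<not> (w q = i \<and> w p = Suc i)) \<or> (w q = Suc i \<and> w p = i)"
        by (rule simple_refl_less_iff)
      moreover have "\<not> (w q = i \<and> w p = Suc i)"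
        using asc True v by (metis not_less_iff_gr_or_eq)
      moreover have "w q = Suc i \<and> w p = i \<longleftrightarrow> (p, q) = (inv w i, inv w (Suc i))"
        using v by (metis prod.inject)
      ultimately show ?thesis using True by (auto simp: inversions_def)
    next
      case False
      moreover have "1 \<le> inv w i"
        using S_infinity_ge_1[OF S_infinity_inv[OF w]] i by simp
      ultimately show ?thesis using asc by (auto simp: inversions_def)
    qed
    then show ?thesis by auto
  qed
  moreover have "(inv w i, inv w (Suc i)) \<notin> inversions w"
    by (simp add: inversions_def v)
  ultimately show ?thesis
    unfolding len_eq using finite_inversions[OF w] by simp
qed

lemma len_simple_refl_comp_descent:
  assumes w: "w \<in> S_infinity" and i: "1 \<le> i" and desc: "inv w (Suc i) < inv w i"
  shows "len w = Suc (len (simple_refl i \<circ> w))"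
proof -
  let ?u = "simple_refl i \<circ> w"
  have u: "?u \<in> S_infinity" by (intro S_infinity_compose w) (use i in simp)
  have "inv ?u i < inv ?u (Suc i)"
    using desc by (simp add: inv_simple_refl_comp S_infinity_bij[OF w])
  from len_simple_refl_comp_ascent[OF u i this] show ?thesis
    by (simp flip: comp_assoc)
qed

lemma len_comp_simple_refl_ascent:
  assumes w: "w \<in> S_infinity" and i: "1 \<le> i" and asc: "w i < w (Suc i)"
  shows "len (w \<circ> simple_refl i) = Suc (len w)"
proof -
  have b: "bij w" by (rule S_infinity_bij[OF w])
  have "len (w \<circ> simple_refl i) = len (inv (w \<circ> simple_refl i))"
    by (intro len_inv[symmetric] S_infinity_compose w) (use i in simp)
  also have "\<dots> = len (simple_refl i \<circ> inv w)"
    by (simp add: inv_comp_simple_refl b)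
  also have "\<dots> = Suc (len (inv w))"
    using asc by (intro len_simple_refl_comp_ascent S_infinity_inv w i) (simp add: inv_inv_eq b)
  finally show ?thesis by (simp add: len_inv w)
qed

lemma len_comp_simple_refl_descent:
  assumes w: "w \<in> S_infinity" and i: "1 \<le> i" and desc: "w (Suc i) < w i"
  shows "len w = Suc (len (w \<circ> simple_refl i))"
proof -
  have "w \<circ> simple_refl i \<in> S_infinity"
    by (intro S_infinity_compose w) (use i in simp)
  from len_comp_simple_refl_ascent[OF this i] desc show ?thesis
    by (simp add: comp_assoc)
qed

text \<open>The increase is odd, and each value of \<open>w\<close> in the open box spanned by the points \<open>(a, w a)\<close> and
  \<open>(b, w b)\<close> contributes two. The proof moves \<open>b\<close> one step to the left at a time by
  \<open>t\<^sub>a\<^sub>b = s\<^sub>c t\<^sub>a\<^sub>c s\<^sub>c\<close> with \<open>c = b - 1\<close>; the two factors \<open>s\<^sub>c\<close> change the length by \<open>2\<close> together if \<open>w c\<close> lies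
  between \<open>w a\<close> and \<open>w b\<close>, and by \<open>0\<close> otherwise.\<close>

lemma len_comp_transpose:
  assumes "w \<in> S_infinity" and "1 \<le> a" and "a < b" and "w a < w b"
  shows "len (w \<circ> transpose a b)
    = len w + 1 + 2 * card {c. a < c \<and> c < b \<and> w a < w c \<and> w c < w b}"
proof -
  obtain d where "b = a + Suc d" using assms(3) less_iff_Suc_add by auto
  then show ?thesis
    using assms
  proof (induction d arbitrary: b w)
    case 0
    then have b: "b = Suc a" and empty: "{c. a < c \<and> c < b \<and> w a < w c \<and> w c < w b} = {}"
      by auto
    have "len (w \<circ> simple_refl a) = Suc (len w)"
      using 0 b by (intro len_comp_simple_refl_ascent) simp_all
    then show ?case unfolding empty unfolding b card.empty by linarith
  next
    case (Suc d)
    note w = \<open>w \<in> S_infinity\<close>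
    define c where "c = a + Suc d"
    have c: "b = Suc c" "a < c" "1 \<le> c" using Suc.prems by (auto simp: c_def)
    define u v where "u = w \<circ> simple_refl c" and "v = u \<circ> transpose a c"
    have u: "u \<in> S_infinity" unfolding u_def using c by (intro S_infinity_compose w) simp
    have v: "v \<in> S_infinity"
      unfolding v_def using c Suc.prems(3) by (intro S_infinity_compose u) simp
    have u_less: "u e = w e" if "e < c" for e
      using c that by (auto simp: u_def transpose_def)
    have u_simps: "u a = w a" "u c = w b" "u b = w c"
      using c by (auto simp: u_def transpose_def)
    have v_simps: "v c = w a" "v b = w c"
      using c by (auto simp: u_def v_def transpose_def)
    have eq: "w \<circ> transpose a b = v \<circ> simple_refl c"
      using c by (auto simp: u_def v_def transpose_def fun_eq_iff)
    have IH: "len v = len u + 1 + 2 * card {e. a < e \<and> e < c \<and> u a < u e \<and> u e < u c}"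
      unfolding v_def using Suc.prems c u_simps
      by (intro Suc.IH u) (auto simp: c_def)
    have "{e. a < e \<and> e < c \<and> u a < u e \<and> u e < u c}
        = {e. a < e \<and> e < c \<and> w a < w e \<and> w e < w b}"
      using u_simps u_less c by auto
    note IH = IH[unfolded this]
    have ne: "w c \<noteq> w a" "w c \<noteq> w b" using c by (auto simp: S_infinity_eq_iff[OF w])
    consider "w c < w a" | "w a < w c" "w c < w b" | "w b < w c" using ne by linarith
    then show ?case
    proof cases
      case 1
      then have "len u = Suc (len w)"
        unfolding u_def using Suc.prems c by (intro len_comp_simple_refl_ascent w) auto
      moreover have "len v = Suc (len (v \<circ> simple_refl c))"
        using 1 c v_simps by (intro len_comp_simple_refl_descent v) auto
      moreover have "{e. a < e \<and> e < b \<and> w a < w e \<and> w e < w b}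
          = {e. a < e \<and> e < c \<and> w a < w e \<and> w e < w b}"
        using 1 c by (auto simp: less_Suc_eq)
      ultimately show ?thesis unfolding eq using IH by (simp del: comp_apply)
    next
      case 2
      then have "len u = Suc (len w)"
        unfolding u_def using Suc.prems c by (intro len_comp_simple_refl_ascent w) auto
      moreover have "len (v \<circ> simple_refl c) = Suc (len v)"
        using 2 c v_simps by (intro len_comp_simple_refl_ascent v) auto
      moreover have "{e. a < e \<and> e < b \<and> w a < w e \<and> w e < w b}
          = insert c {e. a < e \<and> e < c \<and> w a < w e \<and> w e < w b}"
        using 2 c by (auto simp: less_Suc_eq)
      ultimately show ?thesis unfolding eq using IH by (simp del: comp_apply)
    next
      case 3
      then have "len w = Suc (len u)"
        unfolding u_def using Suc.prems c by (intro len_comp_simple_refl_descent w) auto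
      moreover have "len (v \<circ> simple_refl c) = Suc (len v)"
        using 3 c v_simps Suc.prems by (intro len_comp_simple_refl_ascent v) auto
      moreover have "{e. a < e \<and> e < b \<and> w a < w e \<and> w e < w b}
          = {e. a < e \<and> e < c \<and> w a < w e \<and> w e < w b}"
        using 3 c by (auto simp: less_Suc_eq)
      ultimately show ?thesis unfolding eq using IH by (simp del: comp_apply)
    qed
  qed
qed

section \<open>Covers in the Bruhat order\<close>

definition empty_box :: "(nat \<Rightarrow> nat) \<Rightarrow> nat \<Rightarrow> nat \<Rightarrow> nat \<Rightarrow> nat \<Rightarrow> bool"
  where "empty_box w a b l h \<longleftrightarrow> (\<forall>c. a < c \<and> c < b \<longrightarrow> \<not> (l < w c \<and> w c < h))"

text \<open>The cover relation of the Bruhat order, stated without lengths so that it can be analysed by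
  inspection of boxes. Injectivity is built in so that identities between operators defined from covers
  hold on all functions and not only on permutations.\<close>

definition covers :: "(nat \<Rightarrow> nat) \<Rightarrow> nat \<Rightarrow> nat \<Rightarrow> bool"
  where "covers w a b \<longleftrightarrow> inj w \<and> a < b \<and> w a < w b \<and> empty_box w a b (w a) (w b)"

lemma covers_iff_len:
  assumes w: "w \<in> S_infinity" and a: "1 \<le> a" "a < b"
  shows "covers w a b \<longleftrightarrow> len (w \<circ> transpose a b) = len w + 1"
proof (cases "w a < w b")
  case True
  have "finite {c. a < c \<and> c < b \<and> w a < w c \<and> w c < w b}" by simp
  then show ?thesis
    using len_comp_transpose[OF w a True] S_infinity_inj[OF w] a True
    by (auto simp: covers_def empty_box_def)
next
  case False
  then have "w b < w a" using S_infinity_eq_iff[OF w] a by (metis linorder_less_linear less_irrefl)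
  moreover have "w \<circ> transpose a b \<in> S_infinity"
    using a by (intro S_infinity_compose w) simp
  ultimately have "len w > len (w \<circ> transpose a b)"
    using len_comp_transpose[of "w \<circ> transpose a b" a b] a by (simp add: comp_assoc)
  with False show ?thesis by (simp add: covers_def)
qed

text \<open>Otherwise the fixed point \<open>n + 1\<close> would lie in the box. This is what makes the sums in Monk's rule
  finite.\<close>

lemma covers_bounded:
  assumes "w \<in> S_n n" and "covers w a b" and "a \<le> n"
  shows "b \<le> Suc n"
proof (rule ccontr)
  assume "\<not> b \<le> Suc n"
  have fixed: "w x = x" if "n < x" for x
    using assms(1) that by (simp add: S_n_def permutes_def)
  have "w a \<le> n"
    using assms(1,3) permutes_in_image[of w "{1..n}" a] S_infinity_0[OF S_infinityI[OF assms(1)]]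
    by (cases "a = 0") (auto simp: S_n_def)
  then have "w a < w (Suc n)" "w (Suc n) < w b" "a < Suc n" "Suc n < b"
    using \<open>\<not> b \<le> Suc n\<close> fixed[of "Suc n"] fixed[of b] assms(3) by auto
  with assms(2) show False unfolding covers_def empty_box_def by blast
qed

section \<open>Reduced words\<close>

lemma word_perm_Nil [simp]: "word_perm [] = id"
  by (simp add: word_perm_def)

lemma word_perm_Cons [simp]: "word_perm (i # c) = simple_refl i \<circ> word_perm c"
  by (simp add: word_perm_def)

lemma word_perm_in_S_infinity: "\<forall>i\<in>set c. 1 \<le> i \<Longrightarrow> word_perm c \<in> S_infinity"
  by (induction c) (auto intro: S_infinity_compose)

lemma inv_distinct: "w \<in> S_infinity \<Longrightarrow> inv w i < inv w (Suc i) \<or> inv w (Suc i) < inv w i"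
  using S_infinity_eq_iff[OF S_infinity_inv, of w i "Suc i"] by (metis n_not_Suc_n linorder_less_linear)

lemma len_word_perm_le: "\<forall>i\<in>set c. 1 \<le> i \<Longrightarrow> len (word_perm c) \<le> length c"
proof (induction c)
  case (Cons i c)
  then have u: "word_perm c \<in> S_infinity" and i: "1 \<le> i"
    by (auto intro: word_perm_in_S_infinity)
  have "len (simple_refl i \<circ> word_perm c) \<le> Suc (len (word_perm c))"
    using inv_distinct[OF u, of i] len_simple_refl_comp_ascent[OF u i]
      len_simple_refl_comp_descent[OF u i] by linarith
  also have "\<dots> \<le> length (i # c)" using Cons by simp
  finally show ?case by (simp only: word_perm_Cons)
qed simp

lemma ex_word_of_length_len:
  "w \<in> S_infinity \<Longrightarrow> \<exists>c. is_word_of c w \<and> length c = len w"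
proof (induction "len w" arbitrary: w rule: less_induct)
  case less
  note w = \<open>w \<in> S_infinity\<close>
  show ?case
  proof (cases "\<exists>i\<ge>1. inv w (Suc i) < inv w i")
    case True
    then obtain i where i: "1 \<le> i" "inv w (Suc i) < inv w i" by blast
    let ?u = "simple_refl i \<circ> w"
    have l: "len w = Suc (len ?u)" by (rule len_simple_refl_comp_descent[OF w i])
    have "?u \<in> S_infinity" using i by (intro S_infinity_compose w) simp
    then obtain c where "is_word_of c ?u" "length c = len ?u" using less.hyps[of ?u] l by auto
    then have "is_word_of (i # c) w" "length (i # c) = len w"
      using i l by (auto simp: is_word_of_def simp flip: comp_assoc)
    then show ?thesis by blast
  next
    case False
    then have "inv w = id"
      using inv_distinct[OF w] by (intro increasing_imp_id S_infinity_inv w) blast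
    then have "w = id" using S_infinity_bij[OF w] by (metis inv_id inv_inv_eq)
    then have "is_word_of [] w" "length [] = len w" by (auto simp: is_word_of_def)
    then show ?thesis by blast
  qed
qed

lemma reduced_word_iff:
  assumes "w \<in> S_infinity"
  shows "reduced_word c w \<longleftrightarrow> is_word_of c w \<and> length c = len w"
proof -
  obtain d where "is_word_of d w" "length d = len w"
    using ex_word_of_length_len[OF assms] by blast
  moreover have "len w \<le> length e" if "is_word_of e w" for e
    using that len_word_perm_le[of e] by (auto simp: is_word_of_def)
  ultimately show ?thesis unfolding reduced_word_def by (metis le_antisym)
qed

lemma ex_reduced_word: "w \<in> S_infinity \<Longrightarrow> \<exists>c. reduced_word c w"
  using ex_word_of_length_len reduced_word_iff by blast

lemma reduced_word_Cons:
  assumes "w \<in> S_infinity" and "1 \<le> i" and "inv w i < inv w (Suc i)" and "reduced_word c w"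
  shows "reduced_word (i # c) (simple_refl i \<circ> w)"
proof -
  have "simple_refl i \<circ> w \<in> S_infinity" using assms by (intro S_infinity_compose) simp_all
  then show ?thesis
    using assms by (auto simp: reduced_word_iff is_word_of_def len_simple_refl_comp_ascent)
qed

text \<open>Each letter changes the length by one, so in a word as short as the length every letter has to raise it.\<close>

lemma reduced_word_ConsD:
  assumes w: "w \<in> S_infinity" and c: "reduced_word (i # c) w"
  shows "1 \<le> i" and "inv w (Suc i) < inv w i" and "reduced_word c (simple_refl i \<circ> w)"
    and "simple_refl i \<circ> w \<in> S_infinity"
proof -
  let ?u = "word_perm c"
  have *: "w = simple_refl i \<circ> ?u" "\<forall>j\<in>set (i # c). 1 \<le> j" "Suc (length c) = len w"
    using c w by (auto simp: reduced_word_iff is_word_of_def)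
  then have u: "?u = simple_refl i \<circ> w" by (simp flip: comp_assoc)
  show i: "1 \<le> i" using *(2) by simp
  show uS: "simple_refl i \<circ> w \<in> S_infinity"
    using i by (intro S_infinity_compose w) simp
  have le: "len (simple_refl i \<circ> w) \<le> length c" using len_word_perm_le[of c] *(2,3) u by simp
  show desc: "inv w (Suc i) < inv w i"
    using inv_distinct[OF w, of i] len_simple_refl_comp_ascent[OF w i] le *(3) by auto
  have "len w = Suc (len (simple_refl i \<circ> w))"
    by (rule len_simple_refl_comp_descent[OF w i desc])
  with * u show "reduced_word c (simple_refl i \<circ> w)"
    by (auto simp: reduced_word_iff[OF uS] is_word_of_def)
qed

text \<open>If \<open>w\<close> has left descents at \<open>i\<close> and \<open>j\<close>, its length drops by the full amount on passing to the minimal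
  element \<open>x\<close> of its coset under left multiplication by the subgroup generated by \<open>s\<^sub>i\<close> and \<open>s\<^sub>j\<close>. A reduced word of \<open>x\<close> can therefore be
  extended to reduced words of \<open>w\<close> that start with \<open>i\<close> and with \<open>j\<close> and differ by one commutation or
  braid relation; the induction hypothesis compares them with the given words.\<close>

lemma foldr_divdiff_reduced_words_aux:
  assumes IH: "\<And>w c d. len w < k \<Longrightarrow> w \<in> S_infinity \<Longrightarrow> reduced_word c w \<Longrightarrow>
      reduced_word d w \<Longrightarrow> foldr divdiff c f = foldr divdiff d f"
    and w: "w \<in> S_infinity" "len w = k" and c: "reduced_word (i # c) w"
    and d: "reduced_word (j # d) w" and "i < j"
  shows "foldr divdiff (i # c) f = foldr divdiff (j # d) f"
proof -
  note ic = reduced_word_ConsD[OF w(1) c] and jd = reduced_word_ConsD[OF w(1) d]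
  have b: "bij w" by (rule S_infinity_bij[OF w(1)])
  have less: "len (simple_refl i \<circ> w) < k" "len (simple_refl j \<circ> w) < k"
    using len_simple_refl_comp_descent[OF w(1) ic(1,2)]
      len_simple_refl_comp_descent[OF w(1) jd(1,2)] w(2) by auto
  show ?thesis
  proof (cases "j = Suc i")
    case False
    with \<open>i < j\<close> have ij: "Suc i < j" by simp
    let ?x = "simple_refl i \<circ> (simple_refl j \<circ> w)"
    have comm: "simple_refl j \<circ> simple_refl i = simple_refl i \<circ> simple_refl j"
      using ij by (auto simp: fun_eq_iff transpose_def)
    have xS: "?x \<in> S_infinity" using ic(1) by (intro S_infinity_compose jd(4)) simp
    have invx: "inv ?x = inv w \<circ> simple_refl j \<circ> simple_refl i"
      using b by (simp add: o_inv_distrib bij_comp)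
    obtain e where e: "reduced_word e ?x" using ex_reduced_word[OF xS] by blast
    have "reduced_word (i # e) (simple_refl i \<circ> ?x)"
      using ij ic(2) e by (intro reduced_word_Cons xS ic(1)) (simp_all add: invx transpose_def)
    also have "simple_refl i \<circ> ?x = simple_refl j \<circ> w" by (simp flip: comp_assoc)
    finally have 1: "foldr divdiff d f = foldr divdiff (i # e) f"
      by (intro IH[OF less(2) jd(4,3)])
    have "reduced_word (j # e) (simple_refl j \<circ> ?x)"
      using ij jd(2) e by (intro reduced_word_Cons xS jd(1)) (simp_all add: invx transpose_def)
    also have "simple_refl j \<circ> ?x = simple_refl i \<circ> w"
      by (metis comm comp_assoc comp_id fun.map_id transpose_comp_involutory)
    finally have 2: "foldr divdiff c f = foldr divdiff (j # e) f"
      by (intro IH[OF less(1) ic(4,3)])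
    show ?thesis using 1 2 divdiff_commute[OF ij] by simp
  next
    case True
    let ?i = "simple_refl i" and ?j = "simple_refl (Suc i)"
    define x where "x = ?i \<circ> (?j \<circ> (?i \<circ> w))"
    have braid: "?i \<circ> (?j \<circ> (?i \<circ> u)) = ?j \<circ> (?i \<circ> (?j \<circ> u))" for u :: "nat \<Rightarrow> nat"
      by (auto simp: fun_eq_iff transpose_def)
    have x': "x = ?j \<circ> (?i \<circ> (?j \<circ> w))" unfolding x_def by (rule braid)
    have cancel: "?i \<circ> (?i \<circ> u) = u" "?j \<circ> (?j \<circ> u) = u" for u :: "nat \<Rightarrow> nat"
      by (simp_all flip: comp_assoc)
    have ix: "?i \<circ> x = ?j \<circ> (?i \<circ> w)" unfolding x_def cancel ..
    have jx: "?j \<circ> x = ?i \<circ> (?j \<circ> w)" unfolding x' cancel ..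
    have jix: "?j \<circ> (?i \<circ> x) = ?i \<circ> w" unfolding ix cancel ..
    have ijx: "?i \<circ> (?j \<circ> x) = ?j \<circ> w" unfolding jx cancel ..
    have iS: "?i \<in> S_infinity" "?j \<in> S_infinity" using ic(1) by simp_all
    have xS: "x \<in> S_infinity" "?i \<circ> x \<in> S_infinity" "?j \<circ> x \<in> S_infinity"
      unfolding ix jx unfolding x_def by (intro S_infinity_compose iS w(1))+
    have dec: "inv w (Suc i) < inv w i" "inv w (Suc (Suc i)) < inv w (Suc i)"
      using ic(2) jd(2) True by simp_all
    have invx: "inv x = inv w \<circ> ?i \<circ> ?j \<circ> ?i" 
      unfolding x_def using b by (simp add: o_inv_distrib bij_comp)
    have invix: "inv (?i \<circ> x) = inv w \<circ> ?i \<circ> ?j" 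
      unfolding ix using b by (simp add: o_inv_distrib bij_comp)
    have invjx: "inv (?j \<circ> x) = inv w \<circ> ?j \<circ> ?i" 
      unfolding jx using b by (simp add: o_inv_distrib bij_comp)
    obtain e where e: "reduced_word e x" using ex_reduced_word[OF xS(1)] by blast
    have "reduced_word (Suc i # i # e) (?j \<circ> (?i \<circ> x))"
      using dec ic(1) by (intro reduced_word_Cons xS e) (simp_all add: invx invix transpose_def)
    then have 1: "foldr divdiff c f = foldr divdiff (Suc i # i # e) f"
      unfolding jix by (rule IH[OF less(1) ic(4,3)])
    have "reduced_word (i # Suc i # e) (?i \<circ> (?j \<circ> x))"
      using dec ic(1) by (intro reduced_word_Cons xS e) (simp_all add: invx invjx transpose_def)
    then have 2: "foldr divdiff d f = foldr divdiff (i # Suc i # e) f"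
      unfolding ijx using True IH[OF less(2) jd(4,3)] by simp
    show ?thesis using 1 2 divdiff_braid True by simp
  qed
qed

text \<open>Matsumoto's theorem, in the form needed for operators that satisfy the commutation and braid relations.\<close>

lemma foldr_divdiff_reduced_words:
  "w \<in> S_infinity \<Longrightarrow> reduced_word c w \<Longrightarrow> reduced_word d w \<Longrightarrow> foldr divdiff c f = foldr divdiff d f"
proof (induction "len w" arbitrary: w c d rule: less_induct)
  case less
  note w = \<open>w \<in> S_infinity\<close>
  have len: "length c = len w" "length d = len w"
    using less.prems by (simp_all add: reduced_word_iff)
  show ?case
  proof (cases c)
    case Nil
    then show ?thesis using len by simp
  next
    case (Cons i c')
    then obtain j d' where d: "d = j # d'" using len by (cases d) auto
    note IH = less.hyps
    consider "i = j" | "i < j" | "j < i" by linarith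
    then show ?thesis
    proof cases
      case 1
      note ic = reduced_word_ConsD[OF w less.prems(2)[unfolded Cons]]
      note jd = reduced_word_ConsD[OF w less.prems(3)[unfolded d]]
      have "len (simple_refl i \<circ> w) < len w"
        using len_simple_refl_comp_descent[OF w ic(1,2)] by simp
      from IH[OF this ic(4,3)] jd(3) 1 show ?thesis by (simp add: Cons d)
    next
      case 2
      show ?thesis
        using foldr_divdiff_reduced_words_aux[OF _ w refl less.prems(2)[unfolded Cons]
            less.prems(3)[unfolded d] 2] IH unfolding Cons d by blast
    next
      case 3
      show ?thesis
        using foldr_divdiff_reduced_words_aux[OF _ w refl less.prems(3)[unfolded d]
            less.prems(2)[unfolded Cons] 3] IH unfolding Cons d by metis
    qed
  qed
qed

lemma divdiff_perm_reduced_word: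
  assumes "w \<in> S_infinity" and "reduced_word c w"
  shows "divdiff_perm w f = foldr divdiff c f"
proof -
  have "reduced_word (SOME c. reduced_word c w) w"
    using assms(2) by (rule someI)
  from foldr_divdiff_reduced_words[OF assms(1) this assms(2)] show ?thesis
    by (simp add: divdiff_perm_def)
qed

lemma divdiff_perm_id [simp]: "divdiff_perm id f = f"
proof -
  have "reduced_word [] id" by (simp add: reduced_word_iff is_word_of_def)
  from divdiff_perm_reduced_word[OF _ this] show ?thesis by simp
qed

lemma divdiff_perm_simple_refl_comp:
  assumes "w \<in> S_infinity" and "1 \<le> i" and "inv w i < inv w (Suc i)"
  shows "divdiff_perm (simple_refl i \<circ> w) f = divdiff i (divdiff_perm w f)"
proof -
  obtain c where c: "reduced_word c w" using ex_reduced_word[OF assms(1)] by blast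
  have "simple_refl i \<circ> w \<in> S_infinity" using assms by (intro S_infinity_compose) simp_all
  from divdiff_perm_reduced_word[OF this reduced_word_Cons[OF assms c]]
    divdiff_perm_reduced_word[OF assms(1) c]
  show ?thesis by simp
qed

section \<open>Recursion for Schubert polynomials\<close>

lemma longest_perm_involution [simp]: "longest_perm n (longest_perm n i) = i"
  by (auto simp: longest_perm_def)

lemma longest_perm_in_S_n [simp]: "longest_perm n \<in> S_n n"
  unfolding S_n_def mem_Collect_eq
proof (rule bij_imp_permutes)
  show "bij_betw (longest_perm n) {1..n} {1..n}"
    by (rule bij_betw_byWitness[where f' = "longest_perm n"]) (auto simp: longest_perm_def)
  show "longest_perm n x = x" if "x \<notin> {1..n}" for x
    using that by (auto simp: longest_perm_def)
qed

lemma longest_perm_comp_self: "longest_perm n \<circ> longest_perm n = id"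
  by (simp add: fun_eq_iff)

lemma inv_longest_perm: "inv (longest_perm n) = longest_perm n"
  by (rule inv_unique_comp) (rule longest_perm_comp_self)+

lemma S_n_in_range: "w \<in> S_n n \<Longrightarrow> 1 \<le> i \<Longrightarrow> i \<le> n \<Longrightarrow> 1 \<le> w i \<and> w i \<le> n"
  using permutes_in_image[of w "{1..n}" i] by (simp add: S_n_def)

lemma longest_perm_less_iff:
  "1 \<le> i \<Longrightarrow> i \<le> n \<Longrightarrow> 1 \<le> j \<Longrightarrow> j \<le> n \<Longrightarrow> longest_perm n i < longest_perm n j \<longleftrightarrow> j < i"
  by (auto simp: longest_perm_def)

lemma descending_imp_longest:
  assumes w: "w \<in> S_n n" and desc: "\<And>i. 1 \<le> i \<Longrightarrow> i < n \<Longrightarrow> w (Suc i) < w i"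
  shows "w = longest_perm n"
proof -
  let ?u = "longest_perm n \<circ> w"
  have u: "?u \<in> S_n n" by (rule S_n_compose[OF longest_perm_in_S_n w])
  have fixed: "?u x = x" if "n < x" for x
    using u that by (simp add: S_n_def permutes_def)
  have "?u = id"
  proof (rule increasing_imp_id[OF S_infinityI[OF u]])
    fix i :: nat assume i: "1 \<le> i"
    consider "i < n" | "i = n" | "n < i" by linarith
    then show "?u i < ?u (Suc i)"
    proof cases
      case 1
      then show ?thesis
        using desc[OF i 1] S_n_in_range[OF w, of i] S_n_in_range[OF w, of "Suc i"] i
        by (simp add: longest_perm_less_iff)
    next
      case 2
      then show ?thesis using fixed[of "Suc i"] S_n_in_range[OF u, of i] i by simp
    next
      case 3
      then show ?thesis using fixed[of i] fixed[of "Suc i"] by simp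
    qed
  qed
  then have "longest_perm n \<circ> (longest_perm n \<circ> w) = longest_perm n \<circ> id" by simp
  then show ?thesis by (simp add: longest_perm_comp_self flip: comp_assoc)
qed

lemma len_longest_perm: "len (longest_perm n) = (\<Sum>i\<in>{1..n}. n - i)"
proof -
  have "inversions (longest_perm n) = (SIGMA i:{1..n}. {i<..n})"
    by (auto simp: inversions_def longest_perm_def split: if_splits)
  then show ?thesis by (simp add: len_eq)
qed

lemma len_le:
  assumes "w \<in> S_n n"
  shows "len w \<le> Suc n * Suc n"
proof -
  have "card (inversions w) \<le> card ({..n} \<times> {..n})"
    by (intro card_mono inversions_subset assms) simp
  then show ?thesis by (simp add: len_eq)
qed

text \<open>Any permutation in \<open>S\<^sub>n\<close> is reached from the longest one by descending, because a permutation without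
  an ascent below \<open>n\<close> is the longest one.\<close>

lemma S_n_induct_from_longest [consumes 1, case_names longest ascent]:
  assumes "w \<in> S_n n" and "P (longest_perm n)"
    and "\<And>w i. w \<in> S_n n \<Longrightarrow> 1 \<le> i \<Longrightarrow> i < n \<Longrightarrow> w i < w (Suc i) \<Longrightarrow>
      P (w \<circ> simple_refl i) \<Longrightarrow> P w"
  shows "P w"
  using assms(1)
proof (induction "Suc n * Suc n - len w" arbitrary: w rule: less_induct)
  case less
  note w = \<open>w \<in> S_n n\<close>
  show ?case
  proof (cases "\<exists>i. 1 \<le> i \<and> i < n \<and> w i < w (Suc i)")
    case True
    then obtain i where i: "1 \<le> i" "i < n" "w i < w (Suc i)" by blast
    have wi: "w \<circ> simple_refl i \<in> S_n n"
      using i by (intro S_n_compose w transpose_in_S_n) auto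
    have "len (w \<circ> simple_refl i) = Suc (len w)"
      by (rule len_comp_simple_refl_ascent[OF S_infinityI[OF w] i(1,3)])
    then have "P (w \<circ> simple_refl i)"
      using len_le[OF wi] by (intro less.hyps wi) linarith
    then show ?thesis by (rule assms(3)[OF w i])
  next
    case False
    then have "w = longest_perm n"
      using S_infinity_eq_iff[OF S_infinityI[OF w]]
      by (intro descending_imp_longest w) (metis n_not_Suc_n linorder_less_linear)
    then show ?thesis using assms(2) by simp
  qed
qed

lemma schubert_in_longest: "schubert_in n (longest_perm n) = (\<Prod>i\<in>{1..n}. Var i ^ (n - i))"
  by (simp add: schubert_in_def inv_longest_perm longest_perm_comp_self)

text \<open>The two inverses turn a right descent of \<open>w\<close> at \<open>i\<close> into a left ascent of \<open>w\<^sup>-\<^sup>1 w\<^sub>0\<close> at \<open>i\<close>.\<close>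

lemma schubert_in_descent:
  assumes w: "w \<in> S_n n" and i: "1 \<le> i" "i < n" and desc: "w (Suc i) < w i"
  shows "schubert_in n (w \<circ> simple_refl i) = divdiff i (schubert_in n w)"
proof -
  let ?v = "inv w \<circ> longest_perm n"
  have b: "bij w" using S_infinity_bij[OF S_infinityI[OF w]] .
  have bl: "bij (longest_perm n)" using S_infinity_bij[OF S_infinityI[OF longest_perm_in_S_n]] .
  have v: "?v \<in> S_n n" by (intro S_n_compose S_n_inv w longest_perm_in_S_n)
  have inv: "inv ?v = longest_perm n \<circ> w"
    using b bl by (simp add: o_inv_distrib bij_imp_bij_inv inv_longest_perm inv_inv_eq)
  have "inv ?v i < inv ?v (Suc i)"
    unfolding inv using desc i S_n_in_range[OF w, of i] S_n_in_range[OF w, of "Suc i"]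
    by (simp add: longest_perm_less_iff)
  from divdiff_perm_simple_refl_comp[OF S_infinityI[OF v] i(1) this] show ?thesis
    by (simp add: schubert_in_def inv_comp_simple_refl b comp_assoc)
qed

lemma schubert_in_ascent:
  assumes w: "w \<in> S_n n" and i: "1 \<le> i" "i < n" and asc: "w i < w (Suc i)"
  shows "schubert_in n w = divdiff i (schubert_in n (w \<circ> simple_refl i))"
proof -
  have "w \<circ> simple_refl i \<in> S_n n"
    using i by (intro S_n_compose w transpose_in_S_n) auto
  from schubert_in_descent[OF this i] asc show ?thesis by (simp add: comp_assoc)
qed

lemma swap_vars_power [simp]: "swap_vars i (f ^ k) = swap_vars i f ^ k"
  by (induction k) simp_all

lemma swap_vars_prod: "swap_vars i (prod f A) = (\<Prod>x\<in>A. swap_vars i (f x))"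
  by (induction A rule: infinite_finite_induct) simp_all

lemma divdiff_monomial:
  assumes "i \<in> A" and "Suc i \<in> A" and "finite A" and "e i = e (Suc i)"
  shows "divdiff i (Var i * (\<Prod>j\<in>A. Var j ^ e j)) = (\<Prod>j\<in>A. Var j ^ e j)"
proof -
  have "swap_vars i (\<Prod>j\<in>A. Var j ^ e j) = (\<Prod>j\<in>A. Var (simple_refl i j) ^ e j)"
    by (simp add: swap_vars_prod swap_vars_Var)
  also have "\<dots> = (\<Prod>j\<in>A. Var j ^ e j)"
    by (rule prod.reindex_bij_witness[where i = "simple_refl i" and j = "simple_refl i"])
      (use assms in \<open>auto simp: transpose_def split: if_splits\<close>)
  finally have "divdiff i (\<Prod>j\<in>A. Var j ^ e j) = 0" by (rule divdiff_symmetric)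
  then show ?thesis by (simp add: divdiff_Leibniz divdiff_Var)
qed

text \<open>The longest permutation of \<open>S\<^sub>n\<close> arises from that of \<open>S\<^bsub>n+1\<^esub>\<close> by moving the value \<open>n + 1\<close> from the
  first to the last position along descents. The corresponding divided differences \<open>\<partial>\<^sub>1\<close>, \<open>\<dots>\<close>, \<open>\<partial>\<^sub>n\<close> lower
  the exponents of \<open>x\<^sub>1\<close>, \<open>\<dots>\<close>, \<open>x\<^sub>n\<close> by one in turn, each being applied to \<open>x\<^sub>i\<close> times a monomial that is
  symmetric in \<open>x\<^sub>i\<close> and \<open>x\<^bsub>i+1\<^esub>\<close>.\<close>

lemma schubert_in_Suc_longest: "schubert_in (Suc n) (longest_perm n) = schubert_in n (longest_perm n)"
proof -
  \<comment> \<open>\<open>u k\<close> has the value \<open>n + 1\<close> at position \<open>k + 1\<close> and is decreasing on the other positions.\<close>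
  define u where "u k i = (if 1 \<le> i \<and> i \<le> k then n + 1 - i else if i = Suc k then n + 1
    else if Suc k < i \<and> i \<le> n + 1 then n + 2 - i else i)" for k i
  define e where "e k i = (if i \<le> k then n - i else n + 1 - i)" for k i
  have "k \<le> n \<Longrightarrow> u k \<in> S_n (Suc n) \<and>
      schubert_in (Suc n) (u k) = (\<Prod>i\<in>{1..Suc n}. Var i ^ e k i)" for k
  proof (induction k)
    case 0
    have "u 0 = longest_perm (Suc n)"
      by (auto simp: u_def longest_perm_def fun_eq_iff)
    moreover have "(\<Prod>i\<in>{1..Suc n}. Var i ^ e 0 i) = (\<Prod>i\<in>{1..Suc n}. Var i ^ (Suc n - i))"
      by (intro prod.cong) (auto simp: e_def)
    ultimately show ?case using schubert_in_longest[of "Suc n"] by simp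
  next
    case (Suc k)
    let ?i = "Suc k"
    have uk: "u k \<in> S_n (Suc n)"
      and IH: "schubert_in (Suc n) (u k) = (\<Prod>i\<in>{1..Suc n}. Var i ^ e k i)"
      using Suc by auto
    have eq: "u (Suc k) = u k \<circ> simple_refl ?i"
      using Suc.prems by (auto simp: fun_eq_iff u_def transpose_def)
    have "Var j ^ e k j = (if j = ?i then Var j else 1) * Var j ^ e (Suc k) j" for j
    proof -
      have "j \<le> Suc k \<longleftrightarrow> j \<le> k \<or> j = ?i" by auto
      then have "e k j = (if j = ?i then Suc (e (Suc k) j) else e (Suc k) j)"
        using Suc.prems by (auto simp: e_def)
      then show ?thesis by simp
    qed
    then have "(\<Prod>j\<in>{1..Suc n}. Var j ^ e k j)
        = (\<Prod>j\<in>{1..Suc n}. if j = ?i then Var j else 1) * (\<Prod>j\<in>{1..Suc n}. Var j ^ e (Suc k) j)"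
      by (simp only: prod.distrib)
    also have "(\<Prod>j\<in>{1..Suc n}. if j = ?i then Var j else 1) = Var ?i"
      using Suc.prems by simp
    finally have "divdiff ?i (schubert_in (Suc n) (u k)) = (\<Prod>j\<in>{1..Suc n}. Var j ^ e (Suc k) j)"
      unfolding IH using Suc.prems by (simp only:, intro divdiff_monomial) (auto simp: e_def)
    moreover have "schubert_in (Suc n) (u (Suc k)) = divdiff ?i (schubert_in (Suc n) (u k))"
      unfolding eq using Suc.prems by (intro schubert_in_descent uk) (auto simp: u_def)
    moreover have "u (Suc k) \<in> S_n (Suc n)"
      unfolding eq using Suc.prems by (intro S_n_compose uk transpose_in_S_n) auto
    ultimately show ?case by simp
  qed
  from this[of n] have "schubert_in (Suc n) (u n) = (\<Prod>i\<in>{1..Suc n}. Var i ^ e n i)" by simp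
  also have "\<dots> = (\<Prod>i\<in>{1..n}. Var i ^ e n i)" by (simp add: e_def)
  also have "\<dots> = schubert_in n (longest_perm n)"
    unfolding schubert_in_longest by (intro prod.cong) (auto simp: e_def)
  also have "u n = longest_perm n"
    by (auto simp: u_def longest_perm_def fun_eq_iff)
  finally show ?thesis .
qed

lemma schubert_in_Suc: "w \<in> S_n n \<Longrightarrow> schubert_in (Suc n) w = schubert_in n w"
proof (induction rule: S_n_induct_from_longest)
  case longest
  show ?case by (rule schubert_in_Suc_longest)
next
  case (ascent w i)
  then show ?case
    using schubert_in_ascent[of w n i] schubert_in_ascent[of w "Suc n" i] S_n_mono[of w n "Suc n"]
    by (simp add: comp_def)
qed

lemma schubert_eq_schubert_in:
  assumes "w \<in> S_n n"
  shows "schubert w = schubert_in n w"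
proof -
  let ?l = "LEAST n. w \<in> S_n n"
  have l: "w \<in> S_n ?l" by (rule LeastI[of _ n]) (fact assms)
  have "?l \<le> n" by (rule Least_le) (fact assms)
  then have "schubert_in n w = schubert_in ?l w"
  proof (induction rule: dec_induct)
    case (step m)
    then show ?case using schubert_in_Suc[of w m] S_n_mono[OF l, of m] by simp
  qed simp
  then show ?thesis by (simp add: schubert_def)
qed

lemma schubert_id [simp]: "schubert id = 1"
proof -
  have "longest_perm 0 = id" by (auto simp: longest_perm_def)
  then show ?thesis
    using schubert_eq_schubert_in[of id 0] by (simp add: schubert_in_def)
qed

text \<open>Stability allows \<open>w\<close> to be regarded as an element of a symmetric group that contains \<open>s\<^sub>i\<close>. At an
  ascent, \<open>P\<^sub>w\<close> is itself in the image of \<open>\<partial>\<^sub>i\<close>, whose square is zero.\<close>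

lemma divdiff_schubert:
  assumes "w \<in> S_infinity" and i: "1 \<le> i"
  shows "divdiff i (schubert w) = (if w (Suc i) < w i then schubert (w \<circ> simple_refl i) else 0)"
proof -
  obtain m where m: "w \<in> S_n m" using assms(1) by (rule S_infinityE)
  define n where "n = max m (Suc i)"
  have w: "w \<in> S_n n" using m by (rule S_n_mono) (simp add: n_def)
  have wi: "w \<circ> simple_refl i \<in> S_n n"
    using i by (intro S_n_compose w transpose_in_S_n) (auto simp: n_def)
  have "i < n" by (simp add: n_def)
  show ?thesis
  proof (cases "w (Suc i) < w i")
    case True
    then show ?thesis
      using schubert_in_descent[OF w i \<open>i < n\<close>] w wi by (simp add: schubert_eq_schubert_in)
  next
    case False
    then have "w i < w (Suc i)"
      using S_infinity_eq_iff[OF assms(1), of i "Suc i"] by linarith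
    from schubert_in_ascent[OF w i \<open>i < n\<close> this] False show ?thesis
      by (simp add: schubert_eq_schubert_in[OF w] divdiff_divdiff)
  qed
qed

lemma homogeneous_schubert:
  assumes "w \<in> S_infinity"
  shows "homogeneous (len w) (schubert w)"
proof -
  obtain n where n: "w \<in> S_n n" using assms by (rule S_infinityE)
  then show ?thesis
  proof (induction rule: S_n_induct_from_longest)
    case longest
    show ?case
      unfolding len_longest_perm schubert_eq_schubert_in[OF longest_perm_in_S_n] schubert_in_longest
      by (intro homogeneous_prod homogeneous_Var_power) simp
  next
    case (ascent w i)
    have wi: "w \<circ> simple_refl i \<in> S_n n"
      using ascent by (intro S_n_compose transpose_in_S_n) auto
    have "len (w \<circ> simple_refl i) = Suc (len w)"
      using ascent S_infinityI by (intro len_comp_simple_refl_ascent) auto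
    then have "homogeneous (len w) (divdiff i (schubert (w \<circ> simple_refl i)))"
      using homogeneous_divdiff[OF ascent(5,2)] by (simp add: comp_def)
    also have "divdiff i (schubert (w \<circ> simple_refl i)) = schubert w"
      using divdiff_schubert[OF S_infinityI[OF wi] ascent(2)] ascent(4) by (simp add: comp_assoc)
    finally show ?case .
  qed
qed

section \<open>Monk's rule\<close>

text \<open>As \<open>bruhat_op a b (bruhat_op c d F)\<close> evaluates \<open>F\<close> at \<open>w t\<^sub>a\<^sub>b t\<^sub>c\<^sub>d\<close>, products of these operators are read
  from left to right along a path in the Bruhat order.\<close>

definition bruhat_op :: "nat \<Rightarrow> nat \<Rightarrow> ((nat \<Rightarrow> nat) \<Rightarrow> 'a::comm_ring_1) \<Rightarrow> (nat \<Rightarrow> nat) \<Rightarrow> 'a"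
  where "bruhat_op a b F w = (if covers w a b then F (w \<circ> transpose a b) else 0)"

text \<open>Both sides describe the permutation \<open>v = w t\<^sub>a\<^sub>b s\<^sub>i\<close> of the same length as \<open>w\<close>: on the left through the
  common upper neighbour \<open>w t\<^sub>a\<^sub>b\<close> of \<open>w\<close> and \<open>v\<close>, on the right through the common lower neighbour
  \<open>w s\<^sub>i\<close>. The transposition \<open>s\<^sub>i\<close> itself is excluded, as then \<open>v = w\<close>.\<close>

lemma covers_comp_simple_refl:
  assumes "inj w" and "a < b" and "\<not> (a = i \<and> b = Suc i)"
  shows "covers w a b \<and> (w \<circ> transpose a b) (Suc i) < (w \<circ> transpose a b) i
    \<longleftrightarrow> w (Suc i) < w i \<and> covers (w \<circ> simple_refl i) (simple_refl i a) (simple_refl i b)"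
proof -
  have left: "empty_box v i b l h \<longleftrightarrow> \<not> (l < v (Suc i) \<and> v (Suc i) < h) \<and> empty_box v (Suc i) b l h"
    if "Suc i < b" for v b l h
    using that unfolding empty_box_def by (metis Suc_lessD Suc_lessI lessI)
  have right: "empty_box v a (Suc i) l h \<longleftrightarrow> \<not> (l < v i \<and> v i < h) \<and> empty_box v a i l h"
    if "a < i" for v a l h
    using that unfolding empty_box_def by (metis less_Suc_eq)
  have same: "empty_box (w \<circ> simple_refl i) a b l h \<longleftrightarrow> empty_box w a b l h" if "a \<noteq> i" "b \<noteq> Suc i" for a b l h
  proof -
    have "empty_box w a b l h \<Longrightarrow> empty_box (w \<circ> simple_refl i) a b l h" for w
      unfolding empty_box_def
    proof (intro allI impI)
      fix c assume *: "\<forall>c. a < c \<and> c < b \<longrightarrow> \<not> (l < w c \<and> w c < h)" "a < c \<and> c < b"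
      then have "a < simple_refl i c \<and> simple_refl i c < b"
        using that by (auto simp: transpose_def)
      with *(1) show "\<not> (l < (w \<circ> simple_refl i) c \<and> (w \<circ> simple_refl i) c < h)" by simp
    qed
    from this[of w] this[of "w \<circ> simple_refl i"] show ?thesis
      by (auto simp: comp_assoc)
  qed
  have inj: "inj (w \<circ> simple_refl i)" "inj (w \<circ> transpose a b)"
    using assms(1) by (simp_all add: inj_compose)
  have ne: "x \<noteq> y \<Longrightarrow> w x \<noteq> w y" for x y using assms(1) by (metis injD)
  consider "a \<noteq> i" "a \<noteq> Suc i" "b \<noteq> i" "b \<noteq> Suc i" | "a = i" "Suc i < b" | "a = Suc i" "Suc i < b"
    | "b = i" "a < i" | "b = Suc i" "a < i"
    using assms(2,3) by linarith
  then show ?thesis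
  proof cases
    case 1
    then have "simple_refl i a = a" "simple_refl i b = b" by (auto simp: transpose_def)
    with 1 show ?thesis using assms inj by (auto simp: covers_def same)
  next
    case 2
    have "empty_box (w \<circ> simple_refl i) (Suc i) b (w i) (w b) \<longleftrightarrow> empty_box w (Suc i) b (w i) (w b)"
      using 2 by (intro same) auto
    with 2 show ?thesis using assms inj ne[of "Suc i" i] ne[of "Suc i" b]
      by (auto simp: covers_def left)
  next
    case 3
    have "empty_box (w \<circ> simple_refl i) (Suc i) b (w (Suc i)) (w b) \<longleftrightarrow> empty_box w (Suc i) b (w (Suc i)) (w b)"
      using 3 by (intro same) auto
    with 3 show ?thesis using assms inj ne[of b i] ne[of "Suc i" i]
      by (auto simp: covers_def left)
  next
    case 4
    have "empty_box (w \<circ> simple_refl i) a i (w a) (w i) \<longleftrightarrow> empty_box w a i (w a) (w i)"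
      using 4 by (intro same) auto
    with 4 show ?thesis using assms inj ne[of a "Suc i"] ne[of "Suc i" i]
      by (auto simp: covers_def right)
  next
    case 5
    have "empty_box (w \<circ> simple_refl i) a i (w a) (w (Suc i)) \<longleftrightarrow> empty_box w a i (w a) (w (Suc i))"
      using 5 by (intro same) auto
    with 5 show ?thesis using assms inj ne[of a i] ne[of "Suc i" i]
      by (auto simp: covers_def right)
  qed
qed

lemma divdiff_bruhat_op_schubert:
  assumes w: "w \<in> S_infinity" and "1 \<le> a" "a < b" "1 \<le> i" "\<not> (a = i \<and> b = Suc i)"
  shows "divdiff i (bruhat_op a b schubert w) = (if w (Suc i) < w i
    then bruhat_op (simple_refl i a) (simple_refl i b) schubert (w \<circ> simple_refl i) else 0)"
proof -
  let ?t = "transpose a b" and ?t' = "transpose (simple_refl i a) (simple_refl i b)"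
  have wt: "w \<circ> ?t \<in> S_infinity" using assms by (intro S_infinity_compose) auto
  have eq: "w \<circ> ?t \<circ> simple_refl i = w \<circ> simple_refl i \<circ> ?t'"
    using transpose_comp_eq[of "simple_refl i" a b] by (simp add: comp_assoc)
  show ?thesis
    using covers_comp_simple_refl[OF S_infinity_inj[OF w] assms(3,5)]
      divdiff_schubert[OF wt assms(4)]
    unfolding bruhat_op_def eq by auto
qed

lemma homogeneous_bruhat_op_schubert:
  assumes "w \<in> S_infinity" "1 \<le> a"
  shows "homogeneous (Suc (len w)) (bruhat_op a b schubert w)"
proof (cases "covers w a b")
  case True
  then have "a < b" by (simp add: covers_def)
  then have "w \<circ> transpose a b \<in> S_infinity" using assms by (intro S_infinity_compose) auto
  moreover have "len (w \<circ> transpose a b) = Suc (len w)"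
    using covers_iff_len[OF assms \<open>a < b\<close>] True by simp
  ultimately show ?thesis
    using homogeneous_schubert[of "w \<circ> transpose a b"] True by (simp add: bruhat_op_def)
next
  case False
  then show ?thesis by (simp add: bruhat_op_def homogeneous.zero)
qed

text \<open>Collecting both kinds of summands of Monk's rule in one sum over \<open>c \<noteq> k\<close> lets \<open>s\<^sub>i\<close> permute the index set.\<close>

definition signed_op :: "nat \<Rightarrow> nat \<Rightarrow> ((nat \<Rightarrow> nat) \<Rightarrow> 'a::comm_ring_1) \<Rightarrow> (nat \<Rightarrow> nat) \<Rightarrow> 'a"
  where "signed_op k c F w = (if k < c then bruhat_op k c F w else - bruhat_op c k F w)"

lemma divdiff_signed_op_schubert:
  assumes "w \<in> S_infinity" "1 \<le> k" "1 \<le> c" "k \<noteq> c" "1 \<le> i" "{k, c} \<noteq> {i, Suc i}"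
  shows "divdiff i (signed_op k c schubert w) = (if w (Suc i) < w i
    then signed_op (simple_refl i k) (simple_refl i c) schubert (w \<circ> simple_refl i) else 0)"
proof -
  have "simple_refl i k < simple_refl i c \<longleftrightarrow> k < c"
    using simple_refl_less_iff[of k c i] assms by auto
  then show ?thesis
    using assms divdiff_bruhat_op_schubert[of w k c i] divdiff_bruhat_op_schubert[of w c k i]
    by (auto simp: signed_op_def)
qed

lemma signed_op_sum_extend:
  assumes w: "w \<in> S_n n" "k \<le> n" and "n < N"
  shows "(\<Sum>c\<in>{1..N} - {k}. signed_op k c F w) = (\<Sum>c\<in>{1..Suc n} - {k}. signed_op k c F w)"
proof (rule sum.mono_neutral_right)
  show "\<forall>c\<in>{1..N} - {k} - ({1..Suc n} - {k}). signed_op k c F w = 0"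
    using covers_bounded[OF w(1) _ w(2)] w(2)
    by (force simp: signed_op_def bruhat_op_def)
qed (use assms in auto)

text \<open>Both sides have the same divided differences. On the summands with \<open>{k, c} \<noteq> {i, i + 1}\<close>, \<open>\<partial>\<^sub>i\<close> acts by
  moving \<open>k\<close>, \<open>c\<close> and \<open>w\<close> along \<open>s\<^sub>i\<close>, which gives the sum for \<open>w s\<^sub>i\<close> and \<open>s\<^sub>i k\<close>, known by induction. The
  remaining summand yields the term \<open>(\<partial>\<^sub>i x\<^sub>k) P\<^sub>w\<close> of the Leibniz rule: directly if \<open>w\<close> ascends at \<open>i\<close>, and
  because it is missing in comparison with the sum for \<open>w s\<^sub>i\<close> if \<open>w\<close> descends.\<close>

lemma schubert_Monk_signed:
  assumes "w \<in> S_n n" and "1 \<le> k" and "k \<le> n"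
  shows "Var k * schubert w = (\<Sum>c\<in>{1..Suc n} - {k}. signed_op k c schubert w)"
  using assms
proof (induction "len w" arbitrary: w n k rule: less_induct)
  case less
  note w = S_infinityI[OF less.prems(1)]
  let ?S = "\<Sum>c\<in>{1..Suc n} - {k}. signed_op k c schubert w"
  have "homogeneous (Suc (len w)) (signed_op k c schubert w)" if "1 \<le> c" for c
    using homogeneous_bruhat_op_schubert[OF w] less.prems(2) that
    by (auto simp: signed_op_def intro: homogeneous.uminus)
  then have hom: "homogeneous (Suc (len w)) (Var k * schubert w - ?S)"
    using less.prems(2)
    by (intro homogeneous_diff homogeneous_sum homogeneous.Var_mult homogeneous_schubert w) auto
  have "divdiff i (Var k * schubert w - ?S) = 0" if i: "1 \<le> i" for i
  proof -
    let ?s = "simple_refl i" and ?u = "w \<circ> simple_refl i"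
    \<comment> \<open>The range of \<open>c\<close> is enlarged until \<open>s\<^sub>i\<close> maps it to itself.\<close>
    define m where "m = max n (Suc i)"
    let ?A = "{1..Suc m}"
    have wm: "w \<in> S_n m" using less.prems(1) by (rule S_n_mono) (simp add: m_def)
    have sm: "?s \<in> S_n m" using i by (intro transpose_in_S_n) (auto simp: m_def)
    have um: "?u \<in> S_n m" by (rule S_n_compose[OF wm sm])
    have S: "?S = (\<Sum>c\<in>?A - {k}. signed_op k c schubert w)"
      using less.prems by (intro signed_op_sum_extend[symmetric]) (auto simp: m_def)
    have sA: "?s c \<in> ?A \<longleftrightarrow> c \<in> ?A" for c
      using i by (auto simp: transpose_def m_def)
    have k: "1 \<le> k" "k \<in> ?A" "1 \<le> ?s k" "?s k \<le> m"
      using less.prems i by (auto simp: transpose_def m_def)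
    have lhs: "divdiff i (Var k * schubert w)
        = divdiff i (Var k) * schubert w + Var (?s k) * divdiff i (schubert w)"
      by (simp add: divdiff_Leibniz swap_vars_Var)
    have IH: "Var (?s k) * schubert ?u = (\<Sum>c\<in>?A - {?s k}. signed_op (?s k) c schubert ?u)"
      if "w (Suc i) < w i"
      using len_comp_simple_refl_descent[OF w i that] k um by (intro less.hyps) auto
    have regular: "divdiff i (signed_op k c schubert w)
        = (if w (Suc i) < w i then signed_op (?s k) (?s c) schubert ?u else 0)"
      if "c \<in> ?A - {k}" "{k, c} \<noteq> {i, Suc i}" for c
      using that k by (intro divdiff_signed_op_schubert w i) auto
    have asc: "w i < w (Suc i)" if "\<not> w (Suc i) < w i"
      using that S_infinity_eq_iff[OF w, of i "Suc i"] by linarith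
    show ?thesis
    proof (cases "k = i \<or> k = Suc i")
      case False
      then have sk: "?s k = k" by auto
      have "{k, c} \<noteq> {i, Suc i}" for c using False by (auto simp: doubleton_eq_iff)
      then have "divdiff i ?S = (\<Sum>c\<in>?A - {k}.
          if w (Suc i) < w i then signed_op k (?s c) schubert ?u else 0)"
        unfolding S divdiff_sum by (intro sum.cong refl) (simp add: regular sk)
      also have "\<dots> = (\<Sum>c\<in>?A - {k}. if w (Suc i) < w i then signed_op k c schubert ?u else 0)"
      proof (rule sum.reindex_bij_witness[where i = ?s and j = ?s])
        fix c assume "c \<in> ?A - {k}"
        then show "?s c \<in> ?A - {k}"
          using sA[of c] sk by (metis Diff_iff singletonD singletonI transpose_involutory)
        then show "?s c \<in> ?A - {k}" .
      qed auto
      also have "\<dots> = Var k * divdiff i (schubert w)"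
        using IH sk by (simp add: divdiff_schubert[OF w i])
      also have "\<dots> = divdiff i (Var k * schubert w)"
        unfolding lhs using False by (simp add: divdiff_Var sk)
      finally show ?thesis by simp
    next
      case True
      define k' where "k' = ?s k"
      define B where "B = ?A - {k, k'}"
      define \<epsilon> :: int_mpoly where "\<epsilon> = (if k = i then 1 else - 1)"
      have k': "{k, k'} = {i, Suc i}" "k \<noteq> k'" "?s k' = k" "k' \<in> ?A"
        using True sA[of k] k by (auto simp: k'_def)
      have A: "?A - {k} = insert k' B" "?A - {k'} = insert k B" "k \<notin> B" "k' \<notin> B" "finite B"
        using k k' by (auto simp: B_def)
      have "{k, c} \<noteq> {i, Suc i}" if "c \<in> B" for c
        using that k' by (auto simp: B_def doubleton_eq_iff)
      then have rest: "(\<Sum>c\<in>B. divdiff i (signed_op k c schubert w))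
          = (\<Sum>c\<in>B. if w (Suc i) < w i then signed_op k' c schubert ?u else 0)"
      proof -
        assume *: "\<And>c. c \<in> B \<Longrightarrow> {k, c} \<noteq> {i, Suc i}"
        have "?s c = c" if "c \<in> B" for c
          using that True by (auto simp: B_def k'_def)
        note sc = this
        show ?thesis
        proof (rule sum.cong[OF refl])
          fix c assume c: "c \<in> B"
          then have "c \<in> ?A - {k}" using A(1) by blast
          from regular[OF this *[OF c]] show "divdiff i (signed_op k c schubert w)
              = (if w (Suc i) < w i then signed_op k' c schubert ?u else 0)"
            by (simp only: sc[OF c] k'_def)
        qed
      qed
      have dk: "divdiff i (Var k) = \<epsilon>"
        using True by (auto simp: divdiff_Var \<epsilon>_def)
      have special: "signed_op k k' F v = \<epsilon> * bruhat_op i (Suc i) F v" 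
        "signed_op k' k F v = - \<epsilon> * bruhat_op i (Suc i) F v" for F v
        using True by (auto simp: signed_op_def k'_def \<epsilon>_def)
      have d\<epsilon>: "divdiff i (\<epsilon> * f) = \<epsilon> * divdiff i f" for f
        by (simp add: \<epsilon>_def)
      show ?thesis
      proof (cases "w (Suc i) < w i")
        case True
        have cov: "\<not> covers w i (Suc i)" "covers ?u i (Suc i)"
          using True um[THEN S_infinityI, THEN S_infinity_inj] by (auto simp: covers_def empty_box_def)
        have "divdiff i ?S = (\<Sum>c\<in>B. signed_op k' c schubert ?u)"
          unfolding S A(1) divdiff_sum using A True rest cov
          by (simp add: special d\<epsilon> bruhat_op_def)
        moreover have "Var k' * schubert ?u = - \<epsilon> * schubert w + (\<Sum>c\<in>B. signed_op k' c schubert ?u)"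
          using IH[OF True] A cov
          by (simp add: special bruhat_op_def comp_assoc flip: k'_def)
        moreover have "divdiff i (Var k * schubert w) = \<epsilon> * schubert w + Var k' * schubert ?u"
          unfolding lhs dk using True by (simp add: divdiff_schubert[OF w i] flip: k'_def)
        ultimately show ?thesis by simp
      next
        case False
        have cov: "covers w i (Suc i)"
          using asc[OF False] S_infinity_inj[OF w] by (auto simp: covers_def empty_box_def)
        have "divdiff i (schubert ?u) = schubert w"
          using divdiff_schubert[OF S_infinityI[OF um] i] asc[OF False] by (simp add: comp_assoc)
        then have "divdiff i ?S = \<epsilon> * schubert w"
          unfolding S A(1) divdiff_sum using A False rest cov
          by (simp add: special d\<epsilon> bruhat_op_def)
        moreover have "divdiff i (Var k * schubert w) = \<epsilon> * schubert w"
          unfolding lhs dk using False by (simp add: divdiff_schubert[OF w i])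
        ultimately show ?thesis by simp
      qed
    qed
  qed
  then have "Var k * schubert w - ?S = 0"
    by (intro homogeneous_symmetric_eq_0[OF hom]) auto
  then show ?case by simp
qed

theorem schubert_Monk:
  assumes w: "w \<in> S_n n" and k: "1 \<le> k" "k \<le> n" and N: "n < N"
  shows "Var k * schubert w
    = (\<Sum>b\<in>{k<..N}. bruhat_op k b schubert w) - (\<Sum>a\<in>{1..<k}. bruhat_op a k schubert w)"
proof -
  have "Var k * schubert w = (\<Sum>c\<in>{1..N} - {k}. signed_op k c schubert w)"
    unfolding signed_op_sum_extend[OF w k(2) N] by (rule schubert_Monk_signed[OF w k])
  also have "{1..N} - {k} = {k<..N} \<union> {1..<k}" using k N by auto
  also have "(\<Sum>c\<in>{k<..N} \<union> {1..<k}. signed_op k c schubert w)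
      = (\<Sum>c\<in>{k<..N}. signed_op k c schubert w) + (\<Sum>c\<in>{1..<k}. signed_op k c schubert w)"
    by (intro sum.union_disjoint) auto
  also have "\<dots> = (\<Sum>b\<in>{k<..N}. bruhat_op k b schubert w) - (\<Sum>a\<in>{1..<k}. bruhat_op a k schubert w)"
    by (simp add: signed_op_def sum_negf)
  finally show ?thesis .
qed

section \<open>Relations between the operators\<close>

text \<open>If one transposition moved a point into the box of the other, a comparison of the positions and values of
  the four points \<open>a\<close>, \<open>b\<close>, \<open>c\<close>, \<open>d\<close> would place one of them in a box that is empty by assumption.\<close>

lemma covers_commute:
  assumes "covers w a b" and "covers (w \<circ> transpose a b) c d"
    and "a \<noteq> c" "a \<noteq> d" "b \<noteq> c" "b \<noteq> d"
  shows "covers w c d \<and> covers (w \<circ> transpose c d) a b"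
proof -
  have inj: "inj w" "a < b" "w a < w b" and nab: "\<And>e. a < e \<Longrightarrow> e < b \<Longrightarrow> \<not> (w a < w e \<and> w e < w b)"
    using assms(1) by (auto simp: covers_def empty_box_def)
  have wc: "(w \<circ> transpose a b) c = w c" "(w \<circ> transpose a b) d = w d"
    using assms(3-6) by (auto simp: transpose_def)
  then have cd: "c < d" "w c < w d"
    and ncd: "\<And>e. c < e \<Longrightarrow> e < d \<Longrightarrow> \<not> (w c < (w \<circ> transpose a b) e \<and> (w \<circ> transpose a b) e < w d)"
    using assms(2) by (auto simp: covers_def empty_box_def)
  have ncd_a: "c < a \<Longrightarrow> a < d \<Longrightarrow> \<not> (w c < w b \<and> w b < w d)"
    and ncd_b: "c < b \<Longrightarrow> b < d \<Longrightarrow> \<not> (w c < w a \<and> w a < w d)"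
    using ncd[of a] ncd[of b] by auto
  have ncd_e: "\<not> (w c < w e \<and> w e < w d)" if "c < e" "e < d" "e \<noteq> a" "e \<noteq> b" for e
    using ncd[of e] that by (auto simp: transpose_def)
  have ne: "w x \<noteq> w y" if "x \<noteq> y" for x y using inj(1) that by (metis injD)
  have ne': "w a \<noteq> w c" "w a \<noteq> w d" "w b \<noteq> w c" "w b \<noteq> w d"
    using ne assms(3-6) by auto
  have 1: "\<not> (w c < w e \<and> w e < w d)" if e: "c < e" "e < d" for e
  proof -
    consider "e = a" | "e = b" | "e \<noteq> a" "e \<noteq> b" by blast
    then show ?thesis
    proof cases
      case 1
      have "\<not> (w c < w a \<and> w a < w d)"
      proof
        assume h: "w c < w a \<and> w a < w d"
        then have "w d < w b" using ncd_a e 1 inj(3) ne'(4) by force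
        moreover have "d < b" using ncd_b e 1 inj(2) h assms(6) by force
        ultimately show False using nab[of d] e 1 h by blast
      qed
      with 1 show ?thesis by simp
    next
      case 2
      have "\<not> (w c < w b \<and> w b < w d)"
      proof
        assume h: "w c < w b \<and> w b < w d"
        then have "w a < w c" using ncd_b e 2 inj(3) ne'(1) by force
        moreover have "a < c" using ncd_a e 2 inj(2) h assms(3) by force
        ultimately show False using nab[of c] e 2 h by blast
      qed
      with 2 show ?thesis by simp
    qed (use e ncd_e in auto)
  qed
  let ?v = "w \<circ> transpose c d"
  have v: "?v a = w a" "?v b = w b" using assms(3-6) by (auto simp: transpose_def)
  have 2: "\<not> (?v a < ?v e \<and> ?v e < ?v b)" if e: "a < e" "e < b" for e
  proof -
    consider "e = c" | "e = d" | "e \<noteq> c" "e \<noteq> d" by blast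
    then show ?thesis
    proof cases
      case 1
      then have "?v e = w d" by simp
      moreover have "\<not> (w a < w d \<and> w d < w b)"
      proof
        assume h: "w a < w d \<and> w d < w b"
        then have "w c < w a" using nab[of c] e 1 cd ne'(1) by force
        moreover have "b < d" using nab[of d] e 1 cd(1) h assms(6) by force
        ultimately show False using ncd_b e 1 h by blast
      qed
      ultimately show ?thesis unfolding v by simp
    next
      case 2
      then have "?v e = w c" by simp
      moreover have "\<not> (w a < w c \<and> w c < w b)"
      proof
        assume h: "w a < w c \<and> w c < w b"
        then have "w b < w d" using nab[of d] e 2 cd ne'(4) by force
        moreover have "c < a" using nab[of c] e 2 cd(1) h assms(3) by force
        ultimately show False using ncd_a e 2 h by blast
      qed
      ultimately show ?thesis unfolding v by simp
    next
      case 3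
      then have "?v e = w e" by simp
      then show ?thesis unfolding v using nab[OF e] by simp
    qed
  qed
  have "inj ?v" using inj by (simp add: inj_compose)
  then show ?thesis
    unfolding covers_def empty_box_def using 1 2 cd inj v by auto
qed

lemma transpose_comp_commute:
  "a \<noteq> c \<Longrightarrow> a \<noteq> d \<Longrightarrow> b \<noteq> c \<Longrightarrow> b \<noteq> d \<Longrightarrow>
    transpose a b \<circ> transpose c d = transpose c d \<circ> transpose a b"
  by (auto simp: fun_eq_iff transpose_def)

lemma bruhat_op_commute:
  assumes "a \<noteq> c" "a \<noteq> d" "b \<noteq> c" "b \<noteq> d"
  shows "bruhat_op a b (bruhat_op c d F) = bruhat_op c d (bruhat_op a b F)"
proof
  fix w
  have "covers w a b \<and> covers (w \<circ> transpose a b) c d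
      \<longleftrightarrow> covers w c d \<and> covers (w \<circ> transpose c d) a b"
    using covers_commute[of w a b c d] covers_commute[of w c d a b] assms by metis
  moreover have "w \<circ> transpose a b \<circ> transpose c d = w \<circ> transpose c d \<circ> transpose a b"
    using transpose_comp_commute[OF assms] by (simp add: comp_assoc)
  ultimately show "bruhat_op a b (bruhat_op c d F) w = bruhat_op c d (bruhat_op a b F) w"
    unfolding bruhat_op_def by (auto simp del: comp_apply)
qed

lemma empty_box_cong:
  "(\<And>c. a < c \<Longrightarrow> c < b \<Longrightarrow> v c = w c) \<Longrightarrow> empty_box v a b l h \<longleftrightarrow> empty_box w a b l h"
  by (auto simp: empty_box_def)

lemma empty_box_split_position:
  "a < r \<Longrightarrow> r < b \<Longrightarrow>
    empty_box w a b l h \<longleftrightarrow> empty_box w a r l h \<and> \<not> (l < w r \<and> w r < h) \<and> empty_box w r b l h"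
proof -
  assume "a < r" "r < b"
  then have "a < c \<and> c < b \<longleftrightarrow> a < c \<and> c < r \<or> c = r \<or> r < c \<and> c < b" for c
    by linarith
  then show ?thesis unfolding empty_box_def by blast
qed

lemma empty_box_split_value:
  assumes "l < k" "k < h" and "\<And>c. a < c \<Longrightarrow> c < b \<Longrightarrow> w c \<noteq> k"
  shows "empty_box w a b l h \<longleftrightarrow> empty_box w a b l k \<and> empty_box w a b k h"
proof -
  have "\<not> (l < w c \<and> w c < h) \<longleftrightarrow> \<not> (l < w c \<and> w c < k) \<and> \<not> (k < w c \<and> w c < h)"
    if "a < c" "c < b" for c
    using assms(1,2) assms(3)[OF that] by linarith
  then show ?thesis unfolding empty_box_def by blast
qed

lemma covers_three_term_lower:
  assumes w: "inj w" and ord: "a < r" "r < b" and "w a < w r"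
  shows "covers w r b \<and> covers (w \<circ> transpose r b) a r
    \<longleftrightarrow> covers w a r \<and> covers (w \<circ> transpose a r) a b"
proof -
  let ?u = "w \<circ> transpose r b" and ?v = "w \<circ> transpose a r"
  have inj: "inj ?u" "inj ?v" using w by (simp_all add: inj_compose)
  have u: "?u a = w a" "?u r = w b" and v: "?v a = w r" "?v r = w a" "?v b = w b"
    using ord by auto
  have "empty_box ?u a r l h \<longleftrightarrow> empty_box w a r l h" for l h
    using ord by (intro empty_box_cong) auto
  moreover have "empty_box ?v a b l h \<longleftrightarrow>
      empty_box w a r l h \<and> \<not> (l < w a \<and> w a < h) \<and> empty_box w r b l h" for l h
  proof -
    have "empty_box ?v a r l h \<longleftrightarrow> empty_box w a r l h" "empty_box ?v r b l h \<longleftrightarrow> empty_box w r b l h"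
      using ord by (auto intro!: empty_box_cong)
    then show ?thesis using empty_box_split_position[OF ord, of ?v l h] by simp
  qed
  moreover have "empty_box w a r (w a) (w b) \<longleftrightarrow> empty_box w a r (w a) (w r) \<and> empty_box w a r (w r) (w b)"
    if "w r < w b"
    using w assms(4) that by (intro empty_box_split_value) (auto simp: inj_eq)
  ultimately show ?thesis
    using w inj ord assms(4) unfolding covers_def u v by auto
qed

lemma covers_three_term_upper:
  assumes w: "inj w" and ord: "a < r" "r < b" and "w r < w a"
  shows "covers w r b \<and> covers (w \<circ> transpose r b) a r
    \<longleftrightarrow> covers w a b \<and> covers (w \<circ> transpose a b) r b"
proof -
  let ?u = "w \<circ> transpose r b" and ?v = "w \<circ> transpose a b"
  have inj: "inj ?u" "inj ?v" using w by (simp_all add: inj_compose)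
  have u: "?u a = w a" "?u r = w b" and v: "?v r = w r" "?v b = w a"
    using ord by auto
  have "empty_box ?u a r l h \<longleftrightarrow> empty_box w a r l h" for l h
    using ord by (intro empty_box_cong) auto
  moreover have "empty_box ?v r b l h \<longleftrightarrow> empty_box w r b l h" for l h
    using ord by (intro empty_box_cong) auto
  moreover have "empty_box w r b (w r) (w b) \<longleftrightarrow> empty_box w r b (w r) (w a) \<and> empty_box w r b (w a) (w b)"
    if "w a < w b"
    using w ord assms(4) that by (intro empty_box_split_value) (auto simp: inj_eq)
  ultimately show ?thesis
    using w inj ord assms(4) empty_box_split_position[OF ord, of w "w a" "w b"]
    unfolding covers_def u v by auto
qed

text \<open>All three products lead to \<open>w t\<^sub>r\<^sub>b t\<^sub>a\<^sub>r\<close>, so only the cover conditions matter. If \<open>w a < w r\<close>, those of the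
  first product on the right are equivalent to those on the left, and the second product vanishes; if
  \<open>w r < w a\<close>, the roles are exchanged.\<close>

lemma bruhat_op_three_term:
  assumes "a < r" "r < b"
  shows "bruhat_op r b (bruhat_op a r F) w
    = bruhat_op a r (bruhat_op a b F) w + bruhat_op a b (bruhat_op r b F) w"
proof (cases "inj w")
  case False
  then show ?thesis by (simp add: bruhat_op_def covers_def)
next
  case inj: True
  have eq: "w \<circ> transpose a r \<circ> transpose a b = w \<circ> transpose r b \<circ> transpose a r"
    "w \<circ> transpose a b \<circ> transpose r b = w \<circ> transpose r b \<circ> transpose a r"
    using assms by (auto simp: fun_eq_iff transpose_def)
  have op2: "bruhat_op p q (bruhat_op p' q' F) w = (if covers w p q \<and> covers (w \<circ> transpose p q) p' q'
      then F (w \<circ> transpose p q \<circ> transpose p' q') else 0)" for p q p' q'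
    by (simp add: bruhat_op_def del: comp_apply)
  consider "w a < w r" | "w r < w a"
    using inj assms(1) by (metis injD linorder_less_linear less_irrefl)
  then show ?thesis
  proof cases
    case 1
    have "(w \<circ> transpose a b) r = w r" "(w \<circ> transpose a b) b = w a" using assms by auto
    then have "\<not> (covers w a b \<and> covers (w \<circ> transpose a b) r b)"
      using 1 unfolding covers_def by linarith
    then show ?thesis
      using covers_three_term_lower[OF inj assms 1] unfolding op2 eq by auto
  next
    case 2
    then have "\<not> covers w a r" by (simp add: covers_def)
    then show ?thesis
      using covers_three_term_upper[OF inj assms 2] unfolding op2 eq by auto
  qed
qed

definition path_op :: "(nat \<times> nat) list \<Rightarrow> ((nat \<Rightarrow> nat) \<Rightarrow> 'a::comm_ring_1) \<Rightarrow> (nat \<Rightarrow> nat) \<Rightarrow> 'a"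
  where "path_op ps F = foldr (\<lambda>(a, b). bruhat_op a b) ps F"

lemma path_op_Nil [simp]: "path_op [] F = F"
  by (simp add: path_op_def)

lemma path_op_Cons [simp]: "path_op ((a, b) # ps) F = bruhat_op a b (path_op ps F)"
  by (simp add: path_op_def)

lemma path_op_append: "path_op (ps @ qs) F = path_op ps (path_op qs F)"
  by (simp add: path_op_def)

lemma bruhat_op_sum: "bruhat_op a b (\<lambda>u. \<Sum>x\<in>A. F x u) w = (\<Sum>x\<in>A. bruhat_op a b (F x) w)"
  by (simp add: bruhat_op_def)

lemma bruhat_op_covers: "covers w a b \<Longrightarrow> bruhat_op a b F w = F (w \<circ> transpose a b)"
  by (simp add: bruhat_op_def)

lemma bruhat_op_not_covers: "\<not> covers w a b \<Longrightarrow> bruhat_op a b F w = 0"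
  by (simp add: bruhat_op_def)

lemma path_op_sum: "path_op ps (\<lambda>u. \<Sum>x\<in>A. F x u) w = (\<Sum>x\<in>A. path_op ps (F x) w)"
proof (induction ps arbitrary: w)
  case (Cons p ps)
  obtain a b where p: "p = (a, b)" by force
  have "path_op ps (\<lambda>u. \<Sum>x\<in>A. F x u) = (\<lambda>w. \<Sum>x\<in>A. path_op ps (F x) w)"
    using Cons by auto
  then show ?case by (simp add: p bruhat_op_sum)
qed simp

lemma path_op_add: "path_op ps (\<lambda>u. F u + G u) w = path_op ps F w + path_op ps G w"
  by (induction ps arbitrary: w) (auto simp: bruhat_op_def)

lemma path_op_diff: "path_op ps (\<lambda>u. F u - G u) w = path_op ps F w - path_op ps G w"
  by (induction ps arbitrary: w) (auto simp: bruhat_op_def)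

lemma path_op_bruhat_op_commute:
  assumes "a \<noteq> r" "b \<noteq> r" "a \<notin> set xs" "b \<notin> set xs"
  shows "path_op (map (Pair r) xs) (bruhat_op a b F) = bruhat_op a b (path_op (map (Pair r) xs) F)"
  using assms(3,4)
proof (induction xs)
  case (Cons x xs)
  then show ?case using assms(1,2) bruhat_op_commute[of r a b x] by auto
qed simp

lemma path_op_commute:
  assumes "a \<noteq> r" "a \<notin> set xs" "r \<notin> set ys" "set xs \<inter> set ys = {}"
  shows "path_op (map (Pair r) xs) (path_op (map (Pair a) ys) F)
    = path_op (map (Pair a) ys) (path_op (map (Pair r) xs) F)"
  using assms(3,4)
proof (induction ys)
  case (Cons y ys)
  then show ?case
    using assms(1,2) path_op_bruhat_op_commute[of a r y xs "path_op (map (Pair a) ys) F"] by auto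
qed simp

text \<open>The value at \<open>r\<close> only grows along such a path, so it stays above a value at \<open>b\<close> that was once below
  it.\<close>

lemma path_op_repeat_eq_0_aux:
  "w b < w r \<Longrightarrow> path_op (map (Pair r) bs) (bruhat_op r b F) w = 0"
proof (induction bs arbitrary: w)
  case Nil
  then show ?case by (simp add: bruhat_op_def covers_def)
next
  case (Cons c bs)
  show ?case
  proof (cases "covers w r c")
    case True
    then have "w r < w c" "r \<noteq> c" by (auto simp: covers_def)
    then have "(w \<circ> transpose r c) b < (w \<circ> transpose r c) r"
      using Cons.prems by (cases "b = r"; cases "b = c") auto
    then have "path_op (map (Pair r) bs) (bruhat_op r b F) (w \<circ> transpose r c) = 0"
      by (rule Cons.IH)
    with True show ?thesis by (simp add: bruhat_op_covers del: comp_apply)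
  qed (simp add: bruhat_op_not_covers)
qed

text \<open>After the first use of \<open>b\<close>, the value at \<open>b\<close> is below the value at \<open>r\<close>.\<close>

lemma path_op_repeat_eq_0:
  "b \<in> set bs \<Longrightarrow> path_op (map (Pair r) bs) (bruhat_op r b F) w = 0"
proof (induction bs arbitrary: w)
  case (Cons c bs)
  show ?case
  proof (cases "covers w r c \<and> c = b")
    case True
    then have "(w \<circ> transpose r c) b < (w \<circ> transpose r c) r"
      by (auto simp: covers_def)
    then have "path_op (map (Pair r) bs) (bruhat_op r b F) (w \<circ> transpose r c) = 0"
      by (rule path_op_repeat_eq_0_aux)
    with True show ?thesis by (auto simp: bruhat_op_covers simp del: comp_apply)
  next
    case False
    show ?thesis
    proof (cases "covers w r c")
      case True
      with False Cons.prems have "b \<in> set bs" by auto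
      then have "path_op (map (Pair r) bs) (bruhat_op r b F) (w \<circ> transpose r c) = 0"
        by (rule Cons.IH)
      with True show ?thesis by (simp add: bruhat_op_covers del: comp_apply)
    qed (simp add: bruhat_op_not_covers)
  qed
qed simp

text \<open>Iteration of the three-term relation, from the last operator \<open>[r b]\<close> to the first. Each time the second
  term of the relation is chosen, \<open>[a b]\<close> commutes with the operators \<open>[r c]\<close> to its left and
  \<open>[a r]\<close> is used up.\<close>

lemma path_op_move_left:
  assumes "a < r" "\<forall>b\<in>set bs. r < b" "distinct bs"
  shows "path_op (map (Pair r) bs) (bruhat_op a r F) w = path_op (map (Pair a) (r # bs)) F w
    + (\<Sum>j<length bs. path_op (map (Pair a) (drop j bs)) (path_op (map (Pair r) (take (Suc j) bs)) F) w)"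
  using assms(2,3)
proof (induction bs arbitrary: F rule: rev_induct)
  case Nil
  show ?case by simp
next
  case (snoc b bs)
  let ?R = "\<lambda>xs. path_op (map (Pair r) xs)" and ?A = "\<lambda>xs. path_op (map (Pair a) xs)"
  have b: "r < b" "b \<notin> set bs" "a \<notin> set bs" "b \<noteq> a"
    using snoc.prems assms(1) by auto
  have comm: "?R xs (bruhat_op a b G) = bruhat_op a b (?R xs G)" if "set xs \<subseteq> set bs" for xs and G :: "(nat \<Rightarrow> nat) \<Rightarrow> 'a"
    using b assms(1) that by (intro path_op_bruhat_op_commute) auto
  have three: "bruhat_op r b (bruhat_op a r F)
      = (\<lambda>u. bruhat_op a r (bruhat_op a b F) u + bruhat_op a b (bruhat_op r b F) u)"
    by (rule ext) (rule bruhat_op_three_term[OF assms(1) b(1)])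
  have "?R (bs @ [b]) (bruhat_op a r F) w
      = ?R bs (\<lambda>u. bruhat_op a r (bruhat_op a b F) u + bruhat_op a b (bruhat_op r b F) u) w"
    by (simp add: path_op_append three)
  also have "\<dots> = ?R bs (bruhat_op a r (bruhat_op a b F)) w + ?R bs (bruhat_op a b (bruhat_op r b F)) w"
    by (rule path_op_add)
  also have "?R bs (bruhat_op a b (bruhat_op r b F)) = ?A [b] (?R (bs @ [b]) F)"
    by (simp add: comm path_op_append)
  also have "?R bs (bruhat_op a r (bruhat_op a b F)) w = ?A (r # bs) (bruhat_op a b F) w
      + (\<Sum>j<length bs. ?A (drop j bs) (?R (take (Suc j) bs) (bruhat_op a b F)) w)"
    using snoc by auto
  also have "(\<Sum>j<length bs. ?A (drop j bs) (?R (take (Suc j) bs) (bruhat_op a b F)) w)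
      = (\<Sum>j<length bs. ?A (drop j (bs @ [b])) (?R (take (Suc j) (bs @ [b])) F) w)"
    by (intro sum.cong refl) (simp add: comm set_take_subset path_op_append)
  also have "?A (r # bs) (bruhat_op a b F) = ?A (r # bs @ [b]) F"
    by (simp add: path_op_append)
  finally show ?case by simp
qed

section \<open>Sets of sorted paths as fillings\<close>

text \<open>The path that belongs to a filling \<open>f\<close> of rows: row \<open>a\<close> lists in order the \<open>b\<close> with \<open>(a, b)\<close> in the path.
  In this form a path can be altered in the middle without breaking the order of the \<open>a\<close>.\<close>

definition pairs :: "nat \<Rightarrow> (nat \<Rightarrow> nat list) \<Rightarrow> (nat \<times> nat) list"
  where "pairs r f = concat (map (\<lambda>a. map (Pair a) (f a)) [1..<Suc r])"

lemma pairs_0 [simp]: "pairs 0 f = []"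
  by (simp add: pairs_def)

lemma pairs_Suc: "pairs (Suc r) f = pairs r f @ map (Pair (Suc r)) (f (Suc r))"
  by (simp add: pairs_def)

lemma pairs_cong: "(\<And>a. 1 \<le> a \<Longrightarrow> a \<le> r \<Longrightarrow> f a = g a) \<Longrightarrow> pairs r f = pairs r g"
  unfolding pairs_def by (intro arg_cong[of _ _ concat] map_cong refl) auto

text \<open>Operators \<open>[a b]\<close> at the end of the path move to the end of row \<open>a\<close>, since they commute with the operators
  of all later rows.\<close>

lemma path_op_pairs_append:
  assumes "1 \<le> a" "a \<le> q" and "\<And>c. c \<in> {1..q} \<Longrightarrow> c \<noteq> a \<Longrightarrow> set (f c) \<inter> set ys = {}"
    and "\<And>c. c \<in> {1..q} \<Longrightarrow> set (f c) \<inter> {1..q} = {}" and "set ys \<inter> {1..q} = {}"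
  shows "path_op (pairs q f) (path_op (map (Pair a) ys) F) = path_op (pairs q (f(a := f a @ ys))) F"
  using assms
proof (induction q arbitrary: F)
  case (Suc q)
  let ?g = "f(a := f a @ ys)"
  show ?case
  proof (cases "a = Suc q")
    case True
    have "pairs q ?g = pairs q f" using True by (intro pairs_cong) auto
    then show ?thesis
      using True by (simp add: pairs_Suc path_op_append del: fun_upd_apply add: fun_upd_same)
  next
    case False
    then have a: "a \<le> q" using Suc.prems by simp
    let ?G = "path_op (map (Pair (Suc q)) (f (Suc q))) F"
    have "a \<notin> set (f (Suc q))" using Suc.prems(4)[of "Suc q"] Suc.prems(1) a by auto
    moreover have "Suc q \<notin> set ys" using Suc.prems(5) by auto
    ultimately have "path_op (pairs (Suc q) f) (path_op (map (Pair a) ys) F)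
        = path_op (pairs q f) (path_op (map (Pair a) ys) ?G)"
      using path_op_commute[of a "Suc q" "f (Suc q)" ys F] False Suc.prems(3)[of "Suc q"]
      by (simp add: pairs_Suc path_op_append)
    also have "\<dots> = path_op (pairs q ?g) ?G"
    proof (rule Suc.IH[OF Suc.prems(1) a])
      show "set (f c) \<inter> set ys = {}" if "c \<in> {1..q}" "c \<noteq> a" for c
        using Suc.prems(3)[of c] that by simp
      show "set (f c) \<inter> {1..q} = {}" if "c \<in> {1..q}" for c
        using Suc.prems(4)[of c] that by auto
    qed (use Suc.prems(5) in auto)
    also have "\<dots> = path_op (pairs (Suc q) ?g) F"
      using False by (simp add: pairs_Suc path_op_append del: fun_upd_apply add: fun_upd_other)
    finally show ?thesis .
  qed
qed simp

text \<open>For \<open>B = {r<..N}\<close> these parametrise the products in \<open>R(r,m)\<close> with all \<open>b\<^sub>i \<le> N\<close>. Rows outside the range are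
  empty so that a filling is determined by its path.\<close>

definition fillings :: "nat \<Rightarrow> nat \<Rightarrow> nat set \<Rightarrow> (nat \<Rightarrow> nat list) set"
  where "fillings r m B = {f. (\<forall>a. a \<notin> {1..r} \<longrightarrow> f a = []) \<and>
    (\<forall>a. distinct (f a) \<and> set (f a) \<subseteq> B) \<and>
    (\<forall>a c x. x \<in> set (f a) \<and> x \<in> set (f c) \<longrightarrow> a = c) \<and>
    (\<Sum>a\<in>{1..r}. length (f a)) = m}"

lemma fillingsI:
  assumes "\<forall>a. a \<notin> {1..r} \<longrightarrow> f a = []" and "\<forall>a. distinct (f a) \<and> set (f a) \<subseteq> B"
    and "\<forall>a c x. x \<in> set (f a) \<and> x \<in> set (f c) \<longrightarrow> a = c"
    and "(\<Sum>a\<in>{1..r}. length (f a)) = m"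
  shows "f \<in> fillings r m B"
  unfolding fillings_def mem_Collect_eq by (intro conjI assms)

lemma fillingsD:
  assumes "f \<in> fillings r m B"
  shows "\<forall>a. a \<notin> {1..r} \<longrightarrow> f a = []" "\<forall>a. distinct (f a) \<and> set (f a) \<subseteq> B"
    "\<forall>a c x. x \<in> set (f a) \<and> x \<in> set (f c) \<longrightarrow> a = c"
    "(\<Sum>a\<in>{1..r}. length (f a)) = m"
proof -
  note * = assms[unfolded fillings_def mem_Collect_eq]
  show "\<forall>a. a \<notin> {1..r} \<longrightarrow> f a = []" by (rule *[THEN conjunct1])
  show "\<forall>a. distinct (f a) \<and> set (f a) \<subseteq> B" by (rule *[THEN conjunct2, THEN conjunct1])
  show "\<forall>a c x. x \<in> set (f a) \<and> x \<in> set (f c) \<longrightarrow> a = c"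
    by (rule *[THEN conjunct2, THEN conjunct2, THEN conjunct1])
  show "(\<Sum>a\<in>{1..r}. length (f a)) = m"
    by (rule *[THEN conjunct2, THEN conjunct2, THEN conjunct2])
qed

lemma fillings_row_distinct: "f \<in> fillings r m B \<Longrightarrow> distinct (f a)"
  and fillings_row_subset: "f \<in> fillings r m B \<Longrightarrow> set (f a) \<subseteq> B"
  using fillingsD(2)[of f r m B] by simp_all

lemma fillings_outside: "f \<in> fillings r m B \<Longrightarrow> a \<notin> {1..r} \<Longrightarrow> f a = []"
  using fillingsD(1)[of f r m B] by simp

lemma fillings_unique_row:
  "f \<in> fillings r m B \<Longrightarrow> x \<in> set (f a) \<Longrightarrow> x \<in> set (f c) \<Longrightarrow> a = c"
  by (rule fillingsD(3)[rule_format, OF _ conjI])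

lemma fillings_disjoint:
  "f \<in> fillings r m B \<Longrightarrow> a \<noteq> c \<Longrightarrow> set (f a) \<inter> set (f c) = {}"
proof (rule equals0I)
  assume f: "f \<in> fillings r m B" and "a \<noteq> c"
  fix x assume "x \<in> set (f a) \<inter> set (f c)"
  then show False using fillings_unique_row[OF f, of x a c] \<open>a \<noteq> c\<close> by simp
qed

lemma fillings_change_set:
  assumes "f \<in> fillings r m B" and "\<And>a. set (f a) \<subseteq> C"
  shows "f \<in> fillings r m C"
  using fillingsD(2)[OF assms(1)] assms(2) by (intro fillingsI fillingsD(1,3,4)[OF assms(1)]) simp

lemma fillings_mono: "B \<subseteq> C \<Longrightarrow> f \<in> fillings r m B \<Longrightarrow> f \<in> fillings r m C"
  by (rule fillings_change_set) (auto dest: fillings_row_subset)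

lemma finite_fillings: 
  assumes "finite B"
  shows "finite (fillings r m B)"
proof (rule finite_subset)
  let ?L = "{xs. set xs \<subseteq> B \<and> length xs \<le> m}"
  show "fillings r m B \<subseteq> {f. \<forall>a. (a \<in> {1..r} \<longrightarrow> f a \<in> ?L) \<and> (a \<notin> {1..r} \<longrightarrow> f a = [])}"
  proof
    fix f assume f: "f \<in> fillings r m B"
    have "length (f a) \<le> m" if "a \<in> {1..r}" for a
    proof -
      have "length (f a) \<le> (\<Sum>a\<in>{1..r}. length (f a))"
        using that by (intro member_le_sum) auto
      with f show ?thesis by (simp add: fillings_def)
    qed
    with f show "f \<in> {f. \<forall>a. (a \<in> {1..r} \<longrightarrow> f a \<in> ?L) \<and> (a \<notin> {1..r} \<longrightarrow> f a = [])}"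
      by (auto simp: fillings_def)
  qed
  show "finite {f. \<forall>a. (a \<in> {1..r} \<longrightarrow> f a \<in> ?L) \<and> (a \<notin> {1..r} \<longrightarrow> f a = [])}"
    by (intro finite_set_of_finite_funs finite_lists_length_le assms) auto
qed

lemma all_fun_upd: "(\<forall>c. Q c ((f(a := x)) c)) \<longleftrightarrow> Q a x \<and> (\<forall>c. c \<noteq> a \<longrightarrow> Q c (f c))"
proof (intro iffI conjI allI impI)
  assume all: "\<forall>c. Q c ((f(a := x)) c)"
  show "Q a x" using all[rule_format, of a] by simp
  show "Q c (f c)" if "c \<noteq> a" for c using all[rule_format, of c] that by simp
next
  show "Q c ((f(a := x)) c)" if "Q a x \<and> (\<forall>c. c \<noteq> a \<longrightarrow> Q c (f c))" for c
    using that by (cases "c = a") simp_all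
qed

lemma fillings_upd_iff:
  assumes a: "a \<in> {1..r}"
  shows "f(a := xs) \<in> fillings r m B \<longleftrightarrow>
    (\<exists>k. f(a := []) \<in> fillings r k B \<and> m = k + length xs) \<and>
    distinct xs \<and> set xs \<subseteq> B \<and> (\<forall>c. c \<noteq> a \<longrightarrow> set (f c) \<inter> set xs = {})"
proof -
  define outside where "outside \<longleftrightarrow> (\<forall>c. c \<noteq> a \<longrightarrow> c \<notin> {1..r} \<longrightarrow> f c = [])
    \<and> (\<forall>c. c \<noteq> a \<longrightarrow> distinct (f c) \<and> set (f c) \<subseteq> B)
    \<and> (\<forall>c d x. c \<noteq> a \<and> d \<noteq> a \<and> x \<in> set (f c) \<and> x \<in> set (f d) \<longrightarrow> c = d)"
  define fresh where "fresh ys \<longleftrightarrow> (\<forall>c. c \<noteq> a \<longrightarrow> set (f c) \<inter> set ys = {})" for ys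
  define s where "s = (\<Sum>c\<in>{1..r} - {a}. length (f c))"
  have sum: "(\<Sum>c\<in>{1..r}. length ((f(a := ys)) c)) = length ys + s" for ys
    unfolding s_def using a by (subst sum.remove[of _ a]) auto
  have rows: "(\<forall>c. c \<notin> {1..r} \<longrightarrow> (f(a := ys)) c = []) \<longleftrightarrow> (\<forall>c. c \<noteq> a \<longrightarrow> c \<notin> {1..r} \<longrightarrow> f c = [])" for ys
    using a by (subst all_fun_upd) simp
  have entries: "(\<forall>c. distinct ((f(a := ys)) c) \<and> set ((f(a := ys)) c) \<subseteq> B) \<longleftrightarrow>
      (distinct ys \<and> set ys \<subseteq> B) \<and> (\<forall>c. c \<noteq> a \<longrightarrow> distinct (f c) \<and> set (f c) \<subseteq> B)" for ys
    by (rule all_fun_upd[of "\<lambda>_ zs. distinct zs \<and> set zs \<subseteq> B"])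
  have disj: "(\<forall>c d x. x \<in> set ((f(a := ys)) c) \<and> x \<in> set ((f(a := ys)) d) \<longrightarrow> c = d) \<longleftrightarrow> fresh ys \<and>
      (\<forall>c d x. c \<noteq> a \<and> d \<noteq> a \<and> x \<in> set (f c) \<and> x \<in> set (f d) \<longrightarrow> c = d)" (is "?L \<longleftrightarrow> _ \<and> ?R") for ys
  proof (intro iffI conjI)
    assume L: ?L
    show "fresh ys"
      unfolding fresh_def
    proof (intro allI impI equals0I)
      fix c x assume "c \<noteq> a" "x \<in> set (f c) \<inter> set ys"
      with L[rule_format, of x c a] show False by simp
    qed
    show ?R
    proof (intro allI impI)
      fix c d x assume "c \<noteq> a \<and> d \<noteq> a \<and> x \<in> set (f c) \<and> x \<in> set (f d)"
      with L[rule_format, of x c d] show "c = d" by simp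
    qed
  next
    assume R: "fresh ys \<and> ?R"
    show ?L
    proof (intro allI impI)
      fix c d x assume *: "x \<in> set ((f(a := ys)) c) \<and> x \<in> set ((f(a := ys)) d)"
      have "x \<notin> set ys" if "x \<in> set (f e)" "e \<noteq> a" for e
        using R that unfolding fresh_def by blast
      with * have "c = a \<longleftrightarrow> d = a" by (auto split: if_splits)
      with * R[THEN conjunct2, rule_format, of c d x] show "c = d" by (cases "c = a") simp_all
    qed
  qed
  have expand: "f(a := ys) \<in> fillings r k B \<longleftrightarrow>
      outside \<and> distinct ys \<and> set ys \<subseteq> B \<and> fresh ys \<and> length ys + s = k" for ys k
    unfolding fillings_def mem_Collect_eq sum rows entries disj outside_def
    by (rule iffI; elim conjE; intro conjI; assumption)
  have "fresh []" by (simp add: fresh_def)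
  then show ?thesis
    unfolding expand fresh_def[symmetric] by (cases outside) auto
qed

lemma fillings_upd2_iff:
  assumes "a \<in> {1..r}" "b \<in> {1..r}" "a \<noteq> b"
  shows "f(a := xs, b := ys) \<in> fillings r m B \<longleftrightarrow>
    (\<exists>k. f(a := [], b := []) \<in> fillings r k B \<and> m = k + length (xs @ ys)) \<and>
    distinct (xs @ ys) \<and> set (xs @ ys) \<subseteq> B \<and>
    (\<forall>c. c \<noteq> a \<and> c \<noteq> b \<longrightarrow> set (f c) \<inter> set (xs @ ys) = {})"
proof -
  let ?D = "\<lambda>zs. \<forall>c. c \<noteq> a \<and> c \<noteq> b \<longrightarrow> set (f c) \<inter> set zs = {}"
  have "(\<forall>c. c \<noteq> a \<longrightarrow> set ((f(b := [])) c) \<inter> set xs = {}) \<longleftrightarrow> ?D xs"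
    by (auto simp: fun_upd_def)
  then have 1: "f(a := xs, b := []) \<in> fillings r k B \<longleftrightarrow>
    (\<exists>k'. f(a := [], b := []) \<in> fillings r k' B \<and> k = k' + length xs) \<and>
    distinct xs \<and> set xs \<subseteq> B \<and> ?D xs" for k
    using fillings_upd_iff[OF assms(1), of "f(b := [])" xs k B]
    by (simp only: fun_upd_twist[OF assms(3)])
  have 2: "(\<forall>c. c \<noteq> b \<longrightarrow> set ((f(a := xs)) c) \<inter> set ys = {}) \<longleftrightarrow> set xs \<inter> set ys = {} \<and> ?D ys"
    using assms(3) by (simp add: fun_upd_def) metis
  have 3: "(\<forall>c. c \<noteq> a \<and> c \<noteq> b \<longrightarrow> set (f c) \<inter> (set xs \<union> set ys) = {}) \<longleftrightarrow> ?D xs \<and> ?D ys"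
    by (simp add: Int_Un_distrib) blast
  show ?thesis
    unfolding fillings_upd_iff[OF assms(2), of "f(a := xs)" ys m B] 1 2 distinct_append set_append
      length_append 3 by (auto simp: add.assoc)
qed

text \<open>The bijections between sets of fillings below are composed of moves of entries between two rows and of the
  insertion or removal of one entry.\<close>

lemma fillings_rearrange:
  assumes f: "f \<in> fillings r m B" and ab: "a \<in> {1..r}" "b \<in> {1..r}" "a \<noteq> b"
    and mset: "mset (xs @ ys) = mset (f a @ f b)"
  shows "f(a := xs, b := ys) \<in> fillings r m B"
proof -
  have eq: "set (xs @ ys) = set (f a @ f b)" "length (xs @ ys) = length (f a @ f b)"
    "distinct (xs @ ys) = distinct (f a @ f b)"
    using mset mset_eq_setD mset_eq_length mset_eq_imp_distinct_iff by blast+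
  show ?thesis
    unfolding fillings_upd2_iff[OF ab, of f xs ys m B] eq
    by (rule fillings_upd2_iff[OF ab, of f "f a" "f b" m B, THEN iffD1, unfolded fun_upd_triv, OF f])
qed

lemma fillings_insert:
  assumes f: "f \<in> fillings r m B" and a: "a \<in> {1..r}" and x: "x \<in> B" "\<And>c. x \<notin> set (f c)"
    and mset: "mset ys = add_mset x (mset (f a))"
  shows "f(a := ys) \<in> fillings r (Suc m) B"
proof -
  have "mset ys = mset (x # f a)" using mset by simp
  then have eq: "set ys = set (x # f a)" "length ys = length (x # f a)" "distinct ys = distinct (x # f a)"
    using mset_eq_setD mset_eq_length mset_eq_imp_distinct_iff by blast+
  have "(\<exists>k. f(a := []) \<in> fillings r k B \<and> m = k + length (f a)) \<and> distinct (f a) \<and> set (f a) \<subseteq> B \<and>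
      (\<forall>c. c \<noteq> a \<longrightarrow> set (f c) \<inter> set (f a) = {})"
    by (rule fillings_upd_iff[OF a, of f "f a" m B, THEN iffD1, unfolded fun_upd_triv, OF f])
  then show ?thesis
    unfolding fillings_upd_iff[OF a, of f ys "Suc m" B] eq using x by simp
qed

lemma fillings_remove:
  assumes f: "f \<in> fillings r (Suc m) B" and a: "a \<in> {1..r}"
    and mset: "mset (f a) = add_mset x (mset ys)"
  shows "f(a := ys) \<in> fillings r m (B - {x})"
proof -
  have "mset (f a) = mset (x # ys)" using mset by simp
  then have eq: "set (f a) = set (x # ys)" "length (f a) = length (x # ys)"
    "distinct (f a) = distinct (x # ys)"
    using mset_eq_setD mset_eq_length mset_eq_imp_distinct_iff by blast+
  have "(\<exists>k. f(a := []) \<in> fillings r k B \<and> Suc m = k + length (f a)) \<and> distinct (f a) \<and> set (f a) \<subseteq> B \<and>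
      (\<forall>c. c \<noteq> a \<longrightarrow> set (f c) \<inter> set (f a) = {})"
    by (rule fillings_upd_iff[OF a, of f "f a" "Suc m" B, THEN iffD1, unfolded fun_upd_triv, OF f])
  then have *: "f(a := ys) \<in> fillings r m B" "x \<notin> set ys" "\<And>c. c \<noteq> a \<Longrightarrow> x \<notin> set (f c)"
    unfolding fillings_upd_iff[OF a, of f ys m B] eq by simp_all
  then have "x \<notin> set ((f(a := ys)) c)" for c by simp
  then show ?thesis
    using fillings_row_subset[OF *(1)] by (intro fillings_change_set[OF *(1)]) blast
qed

lemma fillings_Suc_empty: "fillings q m B = {f \<in> fillings (Suc q) m B. f (Suc q) = []}"
proof (intro set_eqI iffI)
  fix f assume f: "f \<in> fillings q m B"
  then have "f (Suc q) = []" by (rule fillings_outside) simp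
  moreover have "f a = []" if "a \<notin> {1..Suc q}" for a
    using that by (intro fillings_outside[OF f]) auto
  moreover have "(\<Sum>a\<in>{1..Suc q}. length (f a)) = m"
    using fillingsD(4)[OF f] \<open>f (Suc q) = []\<close> by simp
  ultimately have "f \<in> fillings (Suc q) m B"
    by (intro fillingsI fillingsD(2,3)[OF f]) blast
  then show "f \<in> {f \<in> fillings (Suc q) m B. f (Suc q) = []}"
    using \<open>f (Suc q) = []\<close> by simp
next
  fix f assume "f \<in> {f \<in> fillings (Suc q) m B. f (Suc q) = []}"
  then have f: "f \<in> fillings (Suc q) m B" and e: "f (Suc q) = []" by simp_all
  have "\<forall>a. a \<notin> {1..q} \<longrightarrow> f a = []"
  proof (intro allI impI)
    fix a assume "a \<notin> {1..q}"
    then show "f a = []" using fillings_outside[OF f, of a] e by (cases "a = Suc q") (auto simp: le_Suc_eq)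
  qed
  moreover have "(\<Sum>a\<in>{1..q}. length (f a)) = m" using fillingsD(4)[OF f] e by simp
  ultimately show "f \<in> fillings q m B" by (intro fillingsI fillingsD(2,3)[OF f])
qed

lemma fillings_0: "fillings r 0 B = {\<lambda>_. []}"
proof (intro set_eqI iffI)
  fix f assume f: "f \<in> fillings r 0 B"
  have "f a = []" for a
    using fillingsD(4)[OF f] fillings_outside[OF f, of a] by (cases "a \<in> {1..r}") simp_all
  then show "f \<in> {\<lambda>_. []}" by (simp add: fun_eq_iff)
next
  fix f :: "nat \<Rightarrow> nat list" assume "f \<in> {\<lambda>_. []}"
  then show "f \<in> fillings r 0 B" by (intro fillingsI) simp_all
qed

lemma fillings_no_rows: "fillings 0 (Suc m) B = {}"
proof -
  have "f \<notin> fillings 0 (Suc m) B" for f using fillingsD(4)[of f 0 "Suc m" B] by fastforce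
  then show ?thesis by blast
qed

lemma pairs_empty [simp]: "pairs r (\<lambda>_. []) = []"
  by (induction r) (simp_all add: pairs_Suc)

lemma sum_over_extended_fillings:
  fixes P :: "(nat \<Rightarrow> nat list) \<Rightarrow> 'a::comm_monoid_add"
  assumes r: "r \<in> {1..n}"
  shows "(\<Sum>(f, b)\<in>(SIGMA f:fillings n m J. J - (\<Union>c. set (f c))). P (f(r := f r @ [b])))
    = sum P {g \<in> fillings n (Suc m) J. g r \<noteq> []}"
proof (rule sum.reindex_bij_witness[where i = "\<lambda>g. (g(r := butlast (g r)), last (g r))"
      and j = "\<lambda>(f, b). f(r := f r @ [b])"])
  fix x assume "x \<in> (SIGMA f:fillings n m J. J - (\<Union>c. set (f c)))"
  then obtain f b where x: "x = (f, b)" and f: "f \<in> fillings n m J" "b \<in> J" "\<And>c. b \<notin> set (f c)"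
    by auto
  have "f(r := f r @ [b]) \<in> fillings n (Suc m) J"
    by (rule fillings_insert[OF f(1) r f(2,3)]) simp
  then show "(case x of (f, b) \<Rightarrow> f(r := f r @ [b])) \<in> {g \<in> fillings n (Suc m) J. g r \<noteq> []}"
    by (simp add: x)
  show "(\<lambda>g. (g(r := butlast (g r)), last (g r))) (case x of (f, b) \<Rightarrow> f(r := f r @ [b])) = x"
    by (simp add: x)
next
  fix g assume "g \<in> {g \<in> fillings n (Suc m) J. g r \<noteq> []}"
  then have g: "g \<in> fillings n (Suc m) J" "g r \<noteq> []" by auto
  then obtain xs b where xs: "g r = xs @ [b]" by (metis rev_exhaust)
  have f: "g(r := xs) \<in> fillings n m (J - {b})"
    by (rule fillings_remove[OF g(1) r]) (simp add: xs)
  have "b \<in> J" using fillings_row_subset[OF g(1), of r] xs by simp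
  moreover have "b \<notin> set ((g(r := xs)) c)" for c
    using fillings_row_subset[OF f, of c] by blast
  moreover have "g(r := xs) \<in> fillings n m J" by (rule fillings_mono[OF _ f]) blast
  ultimately show "(g(r := butlast (g r)), last (g r)) \<in> (SIGMA f:fillings n m J. J - (\<Union>c. set (f c)))"
    by (simp add: xs del: fun_upd_apply)
  show "(case (g(r := butlast (g r)), last (g r)) of (f, b) \<Rightarrow> f(r := f r @ [b])) = g"
    using xs by (metis (no_types, lifting) butlast_snoc case_prod_conv fun_upd_same fun_upd_triv
        fun_upd_upd last_snoc)
qed auto

text \<open>Cutting row \<open>r\<close> before its entry \<open>j\<close> and moving the tail to the end of row \<open>a\<close> is undone by cutting row
  \<open>a\<close> at its old length. Under this bijection the last operator \<open>[r b]\<close> of a term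
  \<open>[a b\<^sub>j]\<dots>[a b\<^sub>k] [r b\<^sub>1]\<dots>[r b\<^sub>j]\<close> has \<open>b\<close> equal to an entry of row \<open>a\<close>. This is the cancellation in the Pieri
  recursion.\<close>

lemma sum_over_transferred_tails:
  fixes P :: "(nat \<Rightarrow> nat list) \<Rightarrow> nat \<Rightarrow> 'a::comm_monoid_add"
  assumes r: "r = Suc q"
  shows "(\<Sum>(f, a, j)\<in>(SIGMA f:fillings r m J. SIGMA a:{1..q}. {..<length (f r)}).
      P (f(a := f a @ drop j (f r), r := take j (f r))) (f r ! j))
    = (\<Sum>(g, a, i)\<in>(SIGMA g:fillings r m J. SIGMA a:{1..q}. {..<length (g a)}). P g (g a ! i))"
proof -
  define push where "push = (\<lambda>(f :: nat \<Rightarrow> nat list, a, j).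
    (f(a := f a @ drop j (f r), r := take j (f r)), a, length (f a)))"
  define pull where "pull = (\<lambda>(g :: nat \<Rightarrow> nat list, a, i).
    (g(a := take i (g a), r := g r @ drop i (g a)), a, length (g r)))"
  let ?D = "SIGMA f:fillings r m J. SIGMA a:{1..q}. {..<length (f r)}"
  let ?E = "SIGMA g:fillings r m J. SIGMA a:{1..q}. {..<length (g a)}"
  have push: "push x \<in> ?E" "pull (push x) = x"
    "(\<lambda>(g, a, i). P g (g a ! i)) (push x)
      = (\<lambda>(f, a, j). P (f(a := f a @ drop j (f r), r := take j (f r))) (f r ! j)) x"
    if "x \<in> ?D" for x
  proof -
    obtain f a j where x: "x = (f, a, j)" and f: "f \<in> fillings r m J" "a \<in> {1..q}" "j < length (f r)"
      using \<open>x \<in> ?D\<close> by auto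
    then have ar: "a \<in> {1..r}" "r \<in> {1..r}" "a \<noteq> r" using r by auto
    have "mset (drop j (f r)) + mset (take j (f r)) = mset (f r)"
      by (metis append_take_drop_id mset_append union_commute)
    then have "mset ((f a @ drop j (f r)) @ take j (f r)) = mset (f a @ f r)"
      by (simp add: add.assoc)
    from fillings_rearrange[OF f(1) ar this] show "push x \<in> ?E"
      using f ar by (simp add: x push_def)
    show "pull (push x) = x"
      using f ar by (simp add: x push_def pull_def fun_eq_iff)
    show "(\<lambda>(g, a, i). P g (g a ! i)) (push x)
      = (\<lambda>(f, a, j). P (f(a := f a @ drop j (f r), r := take j (f r))) (f r ! j)) x"
      using f ar by (simp add: x push_def nth_append del: fun_upd_apply) (simp add: fun_upd_apply nth_append)
  qed
  have pull: "pull x \<in> ?D" "push (pull x) = x" if "x \<in> ?E" for x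
  proof -
    obtain g a i where x: "x = (g, a, i)" and g: "g \<in> fillings r m J" "a \<in> {1..q}" "i < length (g a)"
      using \<open>x \<in> ?E\<close> by auto
    then have ar: "a \<in> {1..r}" "r \<in> {1..r}" "a \<noteq> r" using r by auto
    have "mset (take i (g a)) + mset (drop i (g a)) = mset (g a)"
      by (metis append_take_drop_id mset_append)
    then have "mset (take i (g a) @ (g r @ drop i (g a))) = mset (g a @ g r)"
      by (simp add: ac_simps)
    from fillings_rearrange[OF g(1) ar this] show "pull x \<in> ?D"
      using g ar by (simp add: x pull_def)
    show "push (pull x) = x"
      using g ar by (simp add: x push_def pull_def fun_eq_iff)
  qed
  show ?thesis
    by (rule sum.reindex_bij_witness[where i = pull and j = push]) (fact push pull)+
qed

text \<open>Row \<open>r\<close> is appended to row \<open>a\<close> behind the new entry \<open>r\<close>. As \<open>r\<close> is not an entry of the original filling, it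
  marks the place where row \<open>a\<close> has to be cut for the inverse.\<close>

lemma sum_over_inserted_rows:
  fixes P :: "(nat \<Rightarrow> nat list) \<Rightarrow> 'a::comm_monoid_add"
  assumes r: "r = Suc q" and J: "r \<notin> J"
  shows "(\<Sum>(f, a)\<in>fillings r m J \<times> {1..q}. P (f(a := f a @ r # f r, r := [])))
    = sum P {g \<in> fillings q (Suc m) (insert r J). \<exists>a. r \<in> set (g a)}"
proof -
  define T where "T = (\<lambda>(f :: nat \<Rightarrow> nat list, a). f(a := f a @ r # f r, r := []))"
  let ?D = "fillings r m J \<times> {1..q}"
  have mem: "T (f, a) \<in> fillings q (Suc m) (insert r J)"
    if f: "f \<in> fillings r m J" "a \<in> {1..q}" for f a
  proof -
    have ar: "a \<in> {1..r}" "r \<in> {1..r}" "a \<noteq> r" using r f by auto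
    have notin: "r \<notin> set (f c)" for c using fillings_row_subset[OF f(1), of c] J by blast
    have "f \<in> fillings r m (insert r J)" by (rule fillings_mono[OF _ f(1)]) blast
    then have "f(a := f a @ [r]) \<in> fillings r (Suc m) (insert r J)"
      by (rule fillings_insert[OF _ ar(1) _ notin]) simp_all
    then have "f(a := f a @ [r], a := f a @ r # f r, r := []) \<in> fillings r (Suc m) (insert r J)"
      using ar by (rule fillings_rearrange) (use ar in simp)
    then show ?thesis unfolding fillings_Suc_empty[of q] r[symmetric] T_def by simp
  qed
  have inj: "inj_on T ?D"
  proof (rule inj_onI)
    fix x y assume "x \<in> ?D" "y \<in> ?D" and Txy: "T x = T y"
    then obtain f a g c where xy: "x = (f, a)" "y = (g, c)" and fg: "f \<in> fillings r m J" "g \<in> fillings r m J"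
      "a \<in> {1..q}" "c \<in> {1..q}" by blast
    have notin: "r \<notin> set (f d)" "r \<notin> set (g d)" for d
      using fillings_row_subset[OF fg(1), of d] fillings_row_subset[OF fg(2), of d] J by blast+
    have ar: "a \<noteq> r" "c \<noteq> r" using fg r by auto
    have eq: "(f(a := f a @ r # f r, r := [])) d = (g(c := g c @ r # g r, r := [])) d" for d
      using Txy by (simp add: xy T_def)
    have ac: "a = c"
    proof (rule ccontr)
      assume "a \<noteq> c"
      then have "f a @ r # f r = g a" using eq[of a] ar by simp
      then show False using notin(2)[of a] by (metis in_set_conv_decomp)
    qed
    have "f a @ r # f r = g a @ r # g r" using eq[of a] ar ac by simp
    then have rows: "f a = g a" "f r = g r"
      using notin(1)[of a] notin(2)[of a] notin(1)[of r] notin(2)[of r]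
      by (simp_all add: append_Cons_eq_iff)
    have "f d = g d" for d
      using eq[of d] rows ac by (cases "d = a"; cases "d = r") simp_all
    then show "x = y" using ac by (simp add: xy fun_eq_iff)
  qed
  have "T ` ?D = {g \<in> fillings q (Suc m) (insert r J). \<exists>a. r \<in> set (g a)}"
  proof (intro equalityI subsetI)
    fix g assume "g \<in> T ` ?D"
    then obtain f a where g: "g = T (f, a)" "f \<in> fillings r m J" "a \<in> {1..q}" by blast
    moreover have "a \<noteq> r" using g r by auto
    then have "r \<in> set (g a)" by (simp add: g(1) T_def)
    ultimately show "g \<in> {g \<in> fillings q (Suc m) (insert r J). \<exists>a. r \<in> set (g a)}"
      using mem by blast
  next
    fix g assume "g \<in> {g \<in> fillings q (Suc m) (insert r J). \<exists>a. r \<in> set (g a)}"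
    then obtain a where g: "g \<in> fillings q (Suc m) (insert r J)" "r \<in> set (g a)" by blast
    then obtain xs ys where xs: "g a = xs @ r # ys" by (meson split_list)
    have a: "a \<in> {1..q}" using fillings_outside[OF g(1), of a] xs by (cases "a \<in> {1..q}") simp_all
    then have ar: "a \<in> {1..r}" "r \<in> {1..r}" "a \<noteq> r" using r by auto
    have gr: "g r = []" using fillings_outside[OF g(1), of r] r by simp
    have "g \<in> fillings r (Suc m) (insert r J)" using g(1) fillings_Suc_empty[of q] r by blast
    then have "g(a := xs @ ys) \<in> fillings r m (insert r J - {r})"
      using ar(1) by (rule fillings_remove) (simp add: xs)
    then have "g(a := xs @ ys) \<in> fillings r m J" using J by simp
    then have "g(a := xs @ ys, a := xs, r := ys) \<in> fillings r m J"
      using ar by (rule fillings_rearrange) (use ar gr in simp)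
    then have "g(a := xs, r := ys) \<in> fillings r m J" by simp
    moreover have "g = T (g(a := xs, r := ys), a)"
      using xs gr ar by (simp add: T_def fun_eq_iff)
    ultimately show "g \<in> T ` ?D" using a by blast
  qed
  then have "sum P {g \<in> fillings q (Suc m) (insert r J). \<exists>a. r \<in> set (g a)} = sum (P \<circ> T) ?D"
    using sum.reindex[OF inj, of P] by simp
  then show ?thesis by (simp add: T_def case_prod_unfold)
qed

section \<open>The Pieri recursion\<close>

definition pieri_sum :: "nat \<Rightarrow> nat \<Rightarrow> nat set \<Rightarrow> ((nat \<Rightarrow> nat) \<Rightarrow> 'a::comm_ring_1) \<Rightarrow> (nat \<Rightarrow> nat) \<Rightarrow> 'a"
  where "pieri_sum r m J F w = (\<Sum>f\<in>fillings r m J. path_op (pairs r f) F w)"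

lemma path_op_pairs_Suc:
  "path_op (pairs (Suc q) f) F = path_op (pairs q f) (path_op (map (Pair (Suc q)) (f (Suc q))) F)"
  by (simp add: pairs_Suc path_op_append)

lemma path_op_pairs_extend:
  assumes "r = Suc q"
  shows "path_op (pairs r f) (bruhat_op r b F) = path_op (pairs r (f(r := f r @ [b]))) F"
proof -
  have "pairs q (f(r := f r @ [b])) = pairs q f" using assms by (intro pairs_cong) simp
  then show ?thesis
    by (simp only: assms path_op_pairs_Suc fun_upd_same map_append path_op_append) simp
qed

lemma path_op_pairs_move:
  assumes r: "r = Suc q" and J: "J \<subseteq> {r<..}" and f: "f \<in> fillings r m J" and a: "a \<in> {1..q}"
  shows "path_op (pairs r f) (bruhat_op a r F) w
    = path_op (pairs r (f(a := f a @ r # f r, r := []))) F w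
      + (\<Sum>j<length (f r). path_op (pairs r (f(a := f a @ drop j (f r), r := take j (f r))))
          (bruhat_op r (f r ! j) F) w)"
proof -
  have rows: "\<forall>b\<in>set (f c). r < b" for c using fillings_row_subset[OF f, of c] J by auto
  have ar: "a < r" "a \<noteq> r" using a r by auto
  let ?G = "\<lambda>j. path_op (map (Pair r) (take (Suc j) (f r))) F"
  have append: "path_op (pairs q f) (path_op (map (Pair a) ys) G) = path_op (pairs q (f(a := f a @ ys))) G"
    if "set ys \<subseteq> insert r (set (f r))" for ys and G :: "(nat \<Rightarrow> nat) \<Rightarrow> 'a"
  proof (rule path_op_pairs_append)
    fix c assume c: "c \<in> {1..q}"
    then have "r \<notin> set (f c)" "c \<noteq> r" using rows[of c] r by auto
    then show "set (f c) \<inter> set ys = {}" using fillings_disjoint[OF f, of c r] that by blast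
    show "set (f c) \<inter> {1..q} = {}" using rows[of c] r by fastforce
  next
    show "set ys \<inter> {1..q} = {}" using that rows[of r] r by fastforce
  qed (use a in auto)
  have first: "path_op (pairs q f) (path_op (map (Pair a) (r # f r)) F)
      = path_op (pairs r (f(a := f a @ r # f r, r := []))) F"
  proof -
    have "pairs q (f(a := f a @ r # f r, r := [])) = pairs q (f(a := f a @ r # f r))"
      using r by (intro pairs_cong) simp
    then have "pairs r (f(a := f a @ r # f r, r := [])) = pairs q (f(a := f a @ r # f r))"
      by (simp only: r pairs_Suc fun_upd_same list.map append_Nil2)
    moreover have "path_op (pairs q f) (path_op (map (Pair a) (r # f r)) F)
        = path_op (pairs q (f(a := f a @ r # f r))) F"
      by (rule append) auto
    ultimately show ?thesis by simp
  qed
  have rest: "path_op (pairs q f) (path_op (map (Pair a) (drop j (f r))) (?G j))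
      = path_op (pairs r (f(a := f a @ drop j (f r), r := take j (f r)))) (bruhat_op r (f r ! j) F)"
    if j: "j < length (f r)" for j
  proof -
    let ?g = "f(a := f a @ drop j (f r), r := take j (f r))"
    have "path_op (pairs q f) (path_op (map (Pair a) (drop j (f r))) (?G j))
        = path_op (pairs q (f(a := f a @ drop j (f r)))) (?G j)"
      by (rule append) (auto dest: in_set_dropD)
    moreover have "pairs q (f(a := f a @ drop j (f r))) = pairs q ?g"
      using r by (intro pairs_cong) simp
    moreover have "?G j = path_op (map (Pair r) (?g r)) (bruhat_op r (f r ! j) F)"
      using j by (simp add: take_Suc_conv_app_nth path_op_append)
    moreover have "path_op (pairs q ?g) (path_op (map (Pair r) (?g r)) (bruhat_op r (f r ! j) F))
        = path_op (pairs r ?g) (bruhat_op r (f r ! j) F)"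
      by (simp only: r path_op_pairs_Suc)
    ultimately show ?thesis by (simp only:)
  qed
  have "path_op (map (Pair r) (f r)) (bruhat_op a r F) = (\<lambda>u. path_op (map (Pair a) (r # f r)) F u
      + (\<Sum>j<length (f r). path_op (map (Pair a) (drop j (f r))) (?G j) u))"
    by (rule ext, rule path_op_move_left[OF ar(1) rows fillings_row_distinct[OF f]])
  then have "path_op (pairs r f) (bruhat_op a r F) w
      = path_op (pairs q f) (\<lambda>u. path_op (map (Pair a) (r # f r)) F u
        + (\<Sum>j<length (f r). path_op (map (Pair a) (drop j (f r))) (?G j) u)) w"
    by (simp only: r path_op_pairs_Suc)
  also have "\<dots> = path_op (pairs q f) (path_op (map (Pair a) (r # f r)) F) w
      + (\<Sum>j<length (f r). path_op (pairs q f) (path_op (map (Pair a) (drop j (f r))) (?G j)) w)"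
    by (simp only: path_op_add path_op_sum)
  also have "\<dots> = path_op (pairs r (f(a := f a @ r # f r, r := []))) F w
      + (\<Sum>j<length (f r). path_op (pairs r (f(a := f a @ drop j (f r), r := take j (f r))))
          (bruhat_op r (f r ! j) F) w)"
    unfolding first by (intro arg_cong2[of _ _ _ _ "(+)"] refl sum.cong) (simp add: rest)
  finally show ?thesis .
qed

lemma sum_set_distinct_list: "distinct xs \<Longrightarrow> sum h (set xs) = (\<Sum>i<length xs. h (xs ! i))"
  by (rule sum.reindex_bij_betw[symmetric]) (rule bij_betw_nth, auto)

lemma path_op_zero: "path_op ps (\<lambda>u. 0) w = 0"
  by (induction ps arbitrary: w) (auto simp: bruhat_op_def)

text \<open>The entries of row \<open>r\<close> do not appear on the right because a repeated entry in that row gives zero.\<close>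

lemma sum_new_and_old_entries:
  assumes r: "r = Suc q" and "finite J" and f: "f \<in> fillings r m J"
  shows "(\<Sum>b\<in>J. path_op (pairs r f) (bruhat_op r b F) w)
    = (\<Sum>b\<in>J - (\<Union>c. set (f c)). path_op (pairs r (f(r := f r @ [b]))) F w)
      + (\<Sum>a\<in>{1..q}. \<Sum>i<length (f a). path_op (pairs r f) (bruhat_op r (f a ! i) F) w)"
proof -
  let ?E = "\<lambda>b. path_op (pairs r f) (bruhat_op r b F) w"
  let ?U = "\<Union>c. set (f c)" and ?V = "\<Union>a\<in>{1..q}. set (f a)"
  have UJ: "?U \<subseteq> J" using fillings_row_subset[OF f] by blast
  have U: "?U = set (f r) \<union> ?V"
  proof (intro equalityI subsetI)
    fix x assume "x \<in> ?U"
    then obtain c where c: "x \<in> set (f c)" by blast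
    then have "c \<in> {1..r}" using fillings_outside[OF f, of c] by (cases "c \<in> {1..r}") auto
    then show "x \<in> set (f r) \<union> ?V" using c r by (cases "c = r") auto
  qed auto
  have "set (f r) \<inter> set (f a) = {}" if "a \<in> {1..q}" for a
    using fillings_disjoint[OF f, of r a] that r by auto
  then have disj: "set (f r) \<inter> ?V = {}" by blast
  have zero: "?E b = 0" if "b \<in> set (f r)" for b
  proof -
    have "path_op (map (Pair r) (f r)) (bruhat_op r b F) = (\<lambda>u. 0)"
      using path_op_repeat_eq_0[OF that] by (rule ext)
    then show ?thesis by (simp only: r path_op_pairs_Suc path_op_zero)
  qed
  have "sum ?E J = sum ?E (J - ?U) + sum ?E ?U"
    using \<open>finite J\<close> UJ by (rule sum.subset_diff[rotated])
  also have "sum ?E ?U = sum ?E (set (f r)) + sum ?E ?V"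
    unfolding U by (rule sum.union_disjoint) (use disj in auto)
  also have "sum ?E (set (f r)) = 0" using zero by simp
  also have "sum ?E ?V = (\<Sum>a\<in>{1..q}. sum ?E (set (f a)))"
    using fillings_disjoint[OF f] by (intro sum.UNION_disjoint) auto
  also have "\<dots> = (\<Sum>a\<in>{1..q}. \<Sum>i<length (f a). ?E (f a ! i))"
    by (intro sum.cong refl sum_set_distinct_list fillings_row_distinct[OF f])
  also have "sum ?E (J - ?U) = (\<Sum>b\<in>J - ?U. path_op (pairs r (f(r := f r @ [b]))) F w)"
    by (simp only: path_op_pairs_extend[OF r])
  finally show ?thesis by simp
qed

text \<open>With \<open>\<theta>\<^sub>r\<close> split into its terms, the new entries extend row \<open>r\<close> and give the fillings with nonempty row
  \<open>r\<close>. The entries repeated from rows below \<open>r\<close> cancel against the transferred tails from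
  \<open>path_op_pairs_move\<close>. The inserted rows give, with a minus sign, the fillings of the rows below \<open>r\<close> that use
  the entry \<open>r\<close>.\<close>

theorem pieri_sum_recursion:
  assumes r: "r = Suc q" and J: "J \<subseteq> {r<..}" "finite J"
  shows "pieri_sum r (Suc m) J F w = pieri_sum q (Suc m) (insert r J) F w
    + pieri_sum r m J (\<lambda>u. (\<Sum>b\<in>J. bruhat_op r b F u) - (\<Sum>a\<in>{1..q}. bruhat_op a r F u)) w"
proof -
  define P where "P g = path_op (pairs r g) F w" for g
  define E where "E g b = path_op (pairs r g) (bruhat_op r b F) w" for g b
  let ?Phi = "fillings r m J"
  have fin: "finite ?Phi" "finite (fillings r (Suc m) J)" "finite (fillings q (Suc m) (insert r J))"
    using J(2) by (simp_all add: finite_fillings)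
  have rJ: "r \<notin> J" using J(1) by auto
  have "pieri_sum r m J (\<lambda>u. (\<Sum>b\<in>J. bruhat_op r b F u) - (\<Sum>a\<in>{1..q}. bruhat_op a r F u)) w
      = (\<Sum>f\<in>?Phi. \<Sum>b\<in>J. E f b)
        - (\<Sum>f\<in>?Phi. \<Sum>a\<in>{1..q}. path_op (pairs r f) (bruhat_op a r F) w)"
    by (simp only: pieri_sum_def path_op_diff path_op_sum sum_subtractf E_def)
  also have "(\<Sum>f\<in>?Phi. \<Sum>b\<in>J. E f b)
      = (\<Sum>f\<in>?Phi. \<Sum>b\<in>J - (\<Union>c. set (f c)). P (f(r := f r @ [b])))
        + (\<Sum>f\<in>?Phi. \<Sum>a\<in>{1..q}. \<Sum>i<length (f a). E f (f a ! i))"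
    unfolding sum.distrib[symmetric]
    by (intro sum.cong refl) (simp only: sum_new_and_old_entries[OF r J(2)] E_def P_def)
  also have "(\<Sum>f\<in>?Phi. \<Sum>b\<in>J - (\<Union>c. set (f c)). P (f(r := f r @ [b])))
      = sum P {g \<in> fillings r (Suc m) J. g r \<noteq> []}"
    using fin J(2) r
    by (subst sum.Sigma) (auto intro!: sum_over_extended_fillings simp del: fun_upd_apply)
  also have "(\<Sum>f\<in>?Phi. \<Sum>a\<in>{1..q}. path_op (pairs r f) (bruhat_op a r F) w)
      = (\<Sum>f\<in>?Phi. \<Sum>a\<in>{1..q}. P (f(a := f a @ r # f r, r := [])))
        + (\<Sum>f\<in>?Phi. \<Sum>a\<in>{1..q}. \<Sum>j<length (f r).
            E (f(a := f a @ drop j (f r), r := take j (f r))) (f r ! j))"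
    unfolding sum.distrib[symmetric]
    by (intro sum.cong refl) (simp only: path_op_pairs_move[OF r J(1)] E_def P_def)
  also have "(\<Sum>f\<in>?Phi. \<Sum>a\<in>{1..q}. P (f(a := f a @ r # f r, r := [])))
      = sum P {g \<in> fillings q (Suc m) (insert r J). \<exists>a. r \<in> set (g a)}"
    unfolding sum.cartesian_product by (rule sum_over_inserted_rows[OF r rJ])
  also have "(\<Sum>f\<in>?Phi. \<Sum>a\<in>{1..q}. \<Sum>j<length (f r).
            E (f(a := f a @ drop j (f r), r := take j (f r))) (f r ! j))
      = (\<Sum>f\<in>?Phi. \<Sum>a\<in>{1..q}. \<Sum>i<length (f a). E f (f a ! i))"
  proof -
    have triple: "(\<Sum>f\<in>?Phi. \<Sum>a\<in>{1..q}. \<Sum>j<n f a. h f a j)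
        = (\<Sum>(f, a, j)\<in>(SIGMA f:?Phi. SIGMA a:{1..q}. {..<n f a}). h f a j)"
      for n :: "(nat \<Rightarrow> nat list) \<Rightarrow> nat \<Rightarrow> nat" and h :: "_ \<Rightarrow> _ \<Rightarrow> _ \<Rightarrow> 'a"
      using fin by (simp add: sum.Sigma)
    show ?thesis unfolding triple by (rule sum_over_transferred_tails[OF r])
  qed
  finally have "pieri_sum r m J (\<lambda>u. (\<Sum>b\<in>J. bruhat_op r b F u) - (\<Sum>a\<in>{1..q}. bruhat_op a r F u)) w
      = sum P {g \<in> fillings r (Suc m) J. g r \<noteq> []}
        - sum P {g \<in> fillings q (Suc m) (insert r J). \<exists>a. r \<in> set (g a)}"
    by simp
  moreover have "pieri_sum r (Suc m) J F w
      = sum P {g \<in> fillings r (Suc m) J. g r \<noteq> []} + sum P (fillings q (Suc m) J)"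
  proof -
    have "fillings r (Suc m) J
        = {g \<in> fillings r (Suc m) J. g r \<noteq> []} \<union> {g \<in> fillings r (Suc m) J. g r = []}" by blast
    moreover have "sum P ({g \<in> fillings r (Suc m) J. g r \<noteq> []} \<union> {g \<in> fillings r (Suc m) J. g r = []})
        = sum P {g \<in> fillings r (Suc m) J. g r \<noteq> []} + sum P {g \<in> fillings r (Suc m) J. g r = []}"
      using fin by (intro sum.union_disjoint) auto
    ultimately show ?thesis
      by (simp add: pieri_sum_def P_def fillings_Suc_empty[of q, folded r])
  qed
  moreover have "pieri_sum q (Suc m) (insert r J) F w
      = sum P {g \<in> fillings q (Suc m) (insert r J). \<exists>a. r \<in> set (g a)} + sum P (fillings q (Suc m) J)"
  proof -
    let ?A = "{g \<in> fillings q (Suc m) (insert r J). \<exists>a. r \<in> set (g a)}"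
    let ?B = "fillings q (Suc m) J"
    have P: "P g = path_op (pairs q g) F w" if "g \<in> fillings q (Suc m) (insert r J)" for g
      using fillings_outside[OF that, of r] r by (simp add: P_def pairs_Suc)
    have "g \<in> ?B" if g: "g \<in> fillings q (Suc m) (insert r J)" "\<And>a. r \<notin> set (g a)" for g
    proof (rule fillings_change_set[OF g(1)])
      show "set (g a) \<subseteq> J" for a using fillings_row_subset[OF g(1), of a] g(2)[of a] by blast
    qed
    moreover have "r \<notin> set (g a)" if "g \<in> ?B" for g a
      using fillings_row_subset[OF that, of a] rJ by blast
    moreover have "g \<in> fillings q (Suc m) (insert r J)" if "g \<in> ?B" for g
      by (rule fillings_mono[OF _ that]) blast
    ultimately have eq: "fillings q (Suc m) (insert r J) = ?A \<union> ?B" and "?A \<inter> ?B = {}" by blast+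
    have "pieri_sum q (Suc m) (insert r J) F w = sum P (fillings q (Suc m) (insert r J))"
      unfolding pieri_sum_def by (intro sum.cong refl) (simp add: P)
    also have "\<dots> = sum P ?A + sum P ?B"
      unfolding eq[THEN arg_cong[of _ _ "sum P"]]
      by (intro sum.union_disjoint \<open>?A \<inter> ?B = {}\<close> finite_fillings J(2)) (use fin in simp)
    finally show ?thesis .
  qed
  ultimately show ?thesis by simp
qed

section \<open>Complete homogeneous polynomials\<close>

text \<open>\<open>complete_homogeneous m r\<close> is \<open>h\<^sub>m(x\<^sub>1,\<dots>,x\<^sub>r)\<close>; the last equation sorts its monomials by whether \<open>x\<^sub>r\<close> occurs.\<close>

fun complete_homogeneous :: "nat \<Rightarrow> nat \<Rightarrow> int_mpoly" where
  "complete_homogeneous 0 r = 1"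
| "complete_homogeneous (Suc m) 0 = 0"
| "complete_homogeneous (Suc m) (Suc r)
    = complete_homogeneous (Suc m) r + Var (Suc r) * complete_homogeneous m (Suc r)"

lemma path_op_scale: "path_op ps (\<lambda>u. c * F u) w = c * path_op ps F w"
  by (induction ps arbitrary: w) (auto simp: bruhat_op_def)

lemma S_n_comp_covers:
  assumes "w \<in> S_n n" "covers w a b" "1 \<le> a" "a \<le> n"
  shows "w \<circ> transpose a b \<in> S_n (Suc n)"
proof -
  have "a < b" "b \<le> Suc n" using assms covers_bounded by (auto simp: covers_def)
  then show ?thesis
    using assms by (intro S_n_compose S_n_mono[OF assms(1)] transpose_in_S_n) auto
qed

lemma path_op_cong:
  assumes "w \<in> S_n n" and "\<And>p. p \<in> set ps \<Longrightarrow> 1 \<le> fst p \<and> fst p \<le> n"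
    and "\<And>u. u \<in> S_n (n + length ps) \<Longrightarrow> F u = G u"
  shows "path_op ps F w = path_op ps G w"
  using assms
proof (induction ps arbitrary: w n)
  case (Cons p ps)
  obtain a b where p: "p = (a, b)" by force
  show ?case
  proof (cases "covers w a b")
    case True
    have a: "1 \<le> a" "a \<le> n" using Cons.prems(2)[of p] p by auto
    have "path_op ps F (w \<circ> transpose a b) = path_op ps G (w \<circ> transpose a b)"
    proof (rule Cons.IH[of _ "Suc n"])
      show "w \<circ> transpose a b \<in> S_n (Suc n)" by (rule S_n_comp_covers[OF Cons.prems(1) True a])
      show "1 \<le> fst q \<and> fst q \<le> Suc n" if "q \<in> set ps" for q
        using Cons.prems(2)[of q] that by simp
      show "F u = G u" if "u \<in> S_n (Suc n + length ps)" for u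
        using Cons.prems(3)[of u] that by simp
    qed
    then show ?thesis by (simp add: p bruhat_op_covers[OF True] del: comp_apply)
  qed (simp add: p bruhat_op_not_covers)
qed simp

lemma set_pairs: "p \<in> set (pairs r f) \<longleftrightarrow> 1 \<le> fst p \<and> fst p \<le> r \<and> snd p \<in> set (f (fst p))"
  unfolding pairs_def by (cases p) auto

lemma length_pairs: "length (pairs r f) = (\<Sum>a\<in>{1..r}. length (f a))"
  by (induction r) (simp_all add: pairs_Suc)

text \<open>Induction along the recursion for \<open>h\<^sub>m(x\<^sub>1,\<dots>,x\<^sub>r)\<close>. The bound \<open>N\<close> leaves room for all covers: each step of
  a path enlarges the symmetric group by at most one.\<close>

theorem pieri_sum_schubert:
  assumes "w \<in> S_n n" and "r \<le> n" and "n + m \<le> N"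
  shows "pieri_sum r m {r<..N} schubert w = schubert w * complete_homogeneous m r"
  using assms
proof (induction m r rule: complete_homogeneous.induct)
  case (1 r)
  then show ?case by (simp add: pieri_sum_def fillings_0)
next
  case (2 m)
  then show ?case by (simp add: pieri_sum_def fillings_no_rows)
next
  case (3 m q)
  let ?r = "Suc q" let ?J = "{?r<..N}"
  let ?\<theta> = "\<lambda>u. (\<Sum>b\<in>?J. bruhat_op ?r b schubert u) - (\<Sum>a\<in>{1..q}. bruhat_op a ?r schubert u)"
  have J: "insert ?r ?J = {q<..N}" using 3 by auto
  have Monk: "?\<theta> u = Var ?r * schubert u" if "u \<in> S_n (n + m)" for u
    using schubert_Monk[OF that, of ?r N] 3 by (simp add: atLeastLessThanSuc_atLeastAtMost)
  have "pieri_sum ?r m ?J ?\<theta> w = pieri_sum ?r m ?J (\<lambda>u. Var ?r * schubert u) w"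
    unfolding pieri_sum_def
  proof (intro sum.cong refl path_op_cong[OF 3(3)])
    fix f assume f: "f \<in> fillings ?r m ?J"
    show "1 \<le> fst p \<and> fst p \<le> n" if "p \<in> set (pairs ?r f)" for p
      using that 3 by (simp add: set_pairs)
    show "?\<theta> u = Var ?r * schubert u" if "u \<in> S_n (n + length (pairs ?r f))" for u
      using that fillingsD(4)[OF f] by (intro Monk) (simp only: length_pairs)
  qed
  also have "\<dots> = Var ?r * pieri_sum ?r m ?J schubert w"
    by (simp only: pieri_sum_def path_op_scale sum_distrib_left)
  finally have "pieri_sum ?r m ?J ?\<theta> w = Var ?r * (schubert w * complete_homogeneous m ?r)"
    using 3 by simp
  moreover have "pieri_sum ?r (Suc m) ?J schubert w
      = pieri_sum q (Suc m) (insert ?r ?J) schubert w + pieri_sum ?r m ?J ?\<theta> w"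
    by (rule pieri_sum_recursion) auto
  moreover have "pieri_sum q (Suc m) {q<..N} schubert w = schubert w * complete_homogeneous (Suc m) q"
    using 3 by simp
  ultimately show ?case unfolding J by (simp add: algebra_simps)
qed

section \<open>Paths and their end points\<close>

definition path_perm :: "(nat \<times> nat) list \<Rightarrow> nat \<Rightarrow> nat"
  where "path_perm ps = foldr (\<lambda>(a, b) v. transpose a b \<circ> v) ps id"

lemma path_perm_Nil [simp]: "path_perm [] = id"
  by (simp add: path_perm_def)

lemma path_perm_Cons [simp]: "path_perm ((a, b) # ps) = transpose a b \<circ> path_perm ps"
  by (simp add: path_perm_def)

lemma path_perm_append: "path_perm (ps @ qs) = path_perm ps \<circ> path_perm qs"
proof (induction ps)
  case (Cons p ps)
  then show ?case by (cases p) (simp add: comp_assoc)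
qed simp

fun bruhat_path :: "(nat \<Rightarrow> nat) \<Rightarrow> (nat \<times> nat) list \<Rightarrow> bool" where
  "bruhat_path w [] \<longleftrightarrow> True"
| "bruhat_path w ((a, b) # ps) \<longleftrightarrow> covers w a b \<and> bruhat_path (w \<circ> transpose a b) ps"

lemma path_op_eq: "path_op ps F w = (if bruhat_path w ps then F (w \<circ> path_perm ps) else 0)"
proof (induction ps arbitrary: w)
  case (Cons p ps)
  then show ?case by (cases p) (simp add: bruhat_op_def comp_assoc del: comp_apply)
qed simp

lemma path_perm_other: "c \<notin> fst ` set ps \<Longrightarrow> c \<notin> snd ` set ps \<Longrightarrow> path_perm ps c = c"
proof (induction ps)
  case (Cons p ps)
  then show ?case by (cases p) (auto simp: transpose_def)
qed simp

lemma bruhat_path_iff_len: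
  assumes "w \<in> S_infinity" and "\<And>p. p \<in> set ps \<Longrightarrow> 1 \<le> fst p \<and> fst p < snd p"
  shows "bruhat_path w ps \<longleftrightarrow> (\<forall>k \<le> length ps. len (w \<circ> path_perm (take k ps)) = len w + k)"
  using assms
proof (induction ps arbitrary: w)
  case (Cons p ps)
  obtain a b where p: "p = (a, b)" by force
  have ab: "1 \<le> a" "a < b" using Cons.prems(2)[of p] p by auto
  let ?u = "w \<circ> transpose a b"
  have u: "?u \<in> S_infinity" using ab by (intro S_infinity_compose Cons.prems(1)) simp
  have IH: "bruhat_path ?u ps \<longleftrightarrow> (\<forall>k \<le> length ps. len (?u \<circ> path_perm (take k ps)) = len ?u + k)"
    using Cons.prems(2) by (intro Cons.IH u) simp
  have split: "(\<forall>k \<le> length (p # ps). Q k) \<longleftrightarrow> Q 0 \<and> (\<forall>k \<le> length ps. Q (Suc k))" for Q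
  proof (intro iffI conjI allI impI)
    fix k assume "Q 0 \<and> (\<forall>k \<le> length ps. Q (Suc k))" "k \<le> length (p # ps)"
    then show "Q k" by (cases k) auto
  qed auto
  have Suc: "len (w \<circ> path_perm (take (Suc k) (p # ps))) = len (?u \<circ> path_perm (take k ps))" for k
    by (simp add: p comp_assoc)
  have cov: "covers w a b \<longleftrightarrow> len ?u = len w + 1" by (rule covers_iff_len[OF Cons.prems(1) ab])
  show ?case
  proof
    assume "bruhat_path w (p # ps)"
    then have "len ?u = len w + 1" "\<forall>k \<le> length ps. len (?u \<circ> path_perm (take k ps)) = len ?u + k"
      using IH cov by (auto simp: p)
    then show "\<forall>k \<le> length (p # ps). len (w \<circ> path_perm (take k (p # ps))) = len w + k"
      unfolding split Suc by simp
  next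
    assume "\<forall>k \<le> length (p # ps). len (w \<circ> path_perm (take k (p # ps))) = len w + k"
    then have *: "\<forall>k \<le> length ps. len (?u \<circ> path_perm (take k ps)) = len w + Suc k"
      unfolding split Suc by simp
    from this[rule_format, of 0] have 1: "len ?u = len w + 1" by simp
    with * have "bruhat_path ?u ps" unfolding IH by simp
    with 1 cov show "bruhat_path w (p # ps)" by (simp add: p)
  qed
qed simp

text \<open>Since no \<open>b\<close> is used twice or occurs as an \<open>a\<close>, the final value at \<open>b\<close> is the value at \<open>a\<close> just before the
  step \<open>(a, b)\<close>, and the values at \<open>a\<close> increase along the path.\<close>

lemma bruhat_path_values:
  assumes "bruhat_path w ps" and "distinct (map snd ps)" and "fst ` set ps \<inter> snd ` set ps = {}"
  defines "v \<equiv> w \<circ> path_perm ps"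
  shows "c \<notin> snd ` set ps \<Longrightarrow> w c \<le> v c"
    and "(a, b) \<in> set ps \<Longrightarrow> w a \<le> v b \<and> v b < v a"
    and "i < j \<Longrightarrow> j < length ps \<Longrightarrow> fst (ps ! i) = fst (ps ! j) \<Longrightarrow> v (snd (ps ! i)) < v (snd (ps ! j))"
proof -
  have "(\<forall>c. c \<notin> snd ` set ps \<longrightarrow> w c \<le> (w \<circ> path_perm ps) c) \<and>
    (\<forall>(a, b)\<in>set ps. w a \<le> (w \<circ> path_perm ps) b \<and> (w \<circ> path_perm ps) b < (w \<circ> path_perm ps) a) \<and>
    (\<forall>j i. i < j \<and> j < length ps \<and> fst (ps ! i) = fst (ps ! j) \<longrightarrow>
      (w \<circ> path_perm ps) (snd (ps ! i)) < (w \<circ> path_perm ps) (snd (ps ! j)))"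
    using assms(1-3)
  proof (induction ps arbitrary: w)
    case (Cons p ps)
    obtain a b where p: "p = (a, b)" by force
    define u where "u = w \<circ> transpose a b"
    define v where "v = w \<circ> path_perm (p # ps)"
    have v: "v = u \<circ> path_perm ps" by (simp add: v_def u_def p comp_assoc)
    have ab: "a \<noteq> b" "w a < w b" using Cons.prems(1) by (auto simp: p covers_def)
    have b: "b \<notin> snd ` set ps" "b \<notin> fst ` set ps" and a: "a \<notin> snd ` set ps"
      using Cons.prems(2,3) by (auto simp: p)
    have path: "bruhat_path u ps" using Cons.prems(1) by (simp add: p u_def)
    have IH: "(\<forall>c. c \<notin> snd ` set ps \<longrightarrow> u c \<le> v c) \<and>
      (\<forall>(a, b)\<in>set ps. u a \<le> v b \<and> v b < v a) \<and>
      (\<forall>j i. i < j \<and> j < length ps \<and> fst (ps ! i) = fst (ps ! j) \<longrightarrow> v (snd (ps ! i)) < v (snd (ps ! j)))"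
      unfolding v using Cons.prems(2,3) by (intro Cons.IH path) (auto simp: p)
    have u: "u a = w b" "u b = w a" "c \<noteq> a \<Longrightarrow> c \<noteq> b \<Longrightarrow> u c = w c" for c
      using ab by (simp_all add: u_def)
    have vb: "v b = w a" using path_perm_other[OF b(2,1)] u by (simp add: v)
    have va: "w b \<le> v a" using IH a u(1) by auto
    have wu: "w c \<le> u c" if "c \<noteq> b" for c
      using u ab that by (cases "c = a") auto
    have 1: "w c \<le> v c" if "c \<notin> snd ` set (p # ps)" for c
    proof -
      have "u c \<le> v c" "c \<noteq> b" using IH that by (auto simp: p)
      then show ?thesis using wu[of c] by simp
    qed
    have 2: "w a' \<le> v b' \<and> v b' < v a'" if "(a', b') \<in> set (p # ps)" for a' b'
    proof (cases "(a', b') = p")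
      case True
      then show ?thesis using ab vb va by (simp add: p)
    next
      case False
      then have mem: "(a', b') \<in> set ps" using that by simp
      then have "a' \<noteq> b" using b(2) by force
      then show ?thesis using IH mem wu[of a'] by fastforce
    qed
    have 3: "v (snd ((p # ps) ! i)) < v (snd ((p # ps) ! j))"
      if ij: "i < j" "j < length (p # ps)" "fst ((p # ps) ! i) = fst ((p # ps) ! j)" for i j
    proof -
      obtain j' where j: "j = Suc j'" using ij(1) by (cases j) auto
      then have j': "j' < length ps" using ij(2) by simp
      show ?thesis
      proof (cases i)
        case 0
        have "fst (ps ! j') = a" using ij(3) 0 j by (simp add: p)
        then have "(a, snd (ps ! j')) \<in> set ps" using nth_mem[OF j'] by (metis prod.collapse)
        then have "u a \<le> v (snd (ps ! j'))" using IH by blast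
        then show ?thesis using 0 j vb ab u(1) by (simp add: p)
      next
        case (Suc i')
        then show ?thesis using IH ij j j' by auto
      qed
    qed
    show ?case unfolding v_def[symmetric] using 1 2 3 by blast
  qed simp
  then show "c \<notin> snd ` set ps \<Longrightarrow> w c \<le> v c"
    and "(a, b) \<in> set ps \<Longrightarrow> w a \<le> v b \<and> v b < v a"
    and "i < j \<Longrightarrow> j < length ps \<Longrightarrow> fst (ps ! i) = fst (ps ! j) \<Longrightarrow> v (snd (ps ! i)) < v (snd (ps ! j))"
    unfolding v_def by blast+
qed

lemma bruhat_path_bounded:
  assumes "w \<in> S_n n" "bruhat_path w ps" and "\<And>p. p \<in> set ps \<Longrightarrow> 1 \<le> fst p \<and> fst p \<le> n"
  shows "\<forall>p\<in>set ps. snd p \<le> n + length ps"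
  using assms
proof (induction ps arbitrary: w n)
  case (Cons p ps)
  obtain a b where p: "p = (a, b)" by force
  have a: "1 \<le> a" "a \<le> n" and cov: "covers w a b"
    using Cons.prems(3)[of p] Cons.prems(2) by (simp_all add: p)
  have "\<forall>p\<in>set ps. snd p \<le> Suc n + length ps"
  proof (rule Cons.IH[OF S_n_comp_covers[OF Cons.prems(1) cov a]])
    show "bruhat_path (w \<circ> transpose a b) ps" using Cons.prems(2) by (simp add: p)
    show "1 \<le> fst q \<and> fst q \<le> Suc n" if "q \<in> set ps" for q using Cons.prems(3)[of q] that by simp
  qed
  moreover have "b \<le> Suc n" by (rule covers_bounded[OF Cons.prems(1) cov a(2)])
  ultimately show ?case by (auto simp: p)
qed simp

text \<open>The last step \<open>(a, b)\<close> can be read off from the permutation: \<open>a\<close> is its largest moved element up to \<open>r\<close>, and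
  \<open>b\<close> is the image of \<open>a\<close>.\<close>

lemma path_perm_snoc_inject_aux:
  assumes "sorted (map fst ps)" "distinct (map snd ps)" "\<And>p. p \<in> set ps \<Longrightarrow> fst p \<le> r \<and> r < snd p"
    and "ps = ps' @ [(a, b)]"
  shows "path_perm ps a = b" "c \<le> r \<Longrightarrow> a < c \<Longrightarrow> path_perm ps c = c"
proof -
  have b: "r < b" "a \<le> r" using assms(3)[of "(a, b)"] assms(4) by auto
  have "b \<notin> snd ` set ps'" using assms(2,4) by simp
  moreover have "fst q \<noteq> b" if "q \<in> set ps'" for q
    using assms(3)[of q] assms(4) that b by auto
  then have "b \<notin> fst ` set ps'" by blast
  ultimately show "path_perm ps a = b" by (simp add: assms(4) path_perm_append path_perm_other)
  assume c: "c \<le> r" "a < c"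
  have "c \<notin> fst ` set ps" using assms(1) c by (auto simp: assms(4) sorted_append)
  moreover have "snd q \<noteq> c" if "q \<in> set ps" for q using assms(3)[OF that] c by auto
  then have "c \<notin> snd ` set ps" by blast
  ultimately show "path_perm ps c = c" by (rule path_perm_other)
qed

lemma path_perm_inject:
  assumes "sorted (map fst ps)" "distinct (map snd ps)" "\<And>p. p \<in> set ps \<Longrightarrow> fst p \<le> r \<and> r < snd p"
    and "sorted (map fst qs)" "distinct (map snd qs)" "\<And>q. q \<in> set qs \<Longrightarrow> fst q \<le> r \<and> r < snd q"
    and "path_perm ps = path_perm qs"
  shows "ps = qs"
  using assms
proof (induction ps arbitrary: qs rule: rev_induct)
  case Nil
  show ?case
  proof (cases qs rule: rev_cases)
    case (snoc qs' q)
    obtain a b where q: "q = (a, b)" by force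
    have "path_perm qs a = b"
      by (rule path_perm_snoc_inject_aux(1)[OF Nil(4-6)]) (simp_all add: snoc q)
    moreover have "a < b" using Nil(6)[of q] snoc q by simp
    ultimately show ?thesis using Nil(7) by (metis id_apply less_irrefl path_perm_Nil)
  qed simp
next
  case (snoc p ps)
  obtain a b where p: "p = (a, b)" by force
  have ab: "a \<le> r" "r < b" using snoc.prems(3)[of p] p by auto
  have ps: "path_perm (ps @ [p]) a = b" "\<And>c. c \<le> r \<Longrightarrow> a < c \<Longrightarrow> path_perm (ps @ [p]) c = c"
    using path_perm_snoc_inject_aux[OF snoc.prems(1-3)] p by blast+
  show ?case
  proof (cases qs rule: rev_cases)
    case Nil
    then have "b = a" using ps(1) snoc.prems(7) by simp
    then show ?thesis using ab by simp
  next
    case (snoc qs' q)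
    obtain a' b' where q: "q = (a', b')" by force
    have ab': "a' \<le> r" "r < b'" using snoc.prems(6)[of q] snoc q by auto
    have qs: "path_perm qs a' = b'" "\<And>c. c \<le> r \<Longrightarrow> a' < c \<Longrightarrow> path_perm qs c = c"
      using path_perm_snoc_inject_aux[OF snoc.prems(4-6)] snoc q by blast+
    have "a = a'"
    proof (rule ccontr)
      assume "a \<noteq> a'"
      then consider "a < a'" | "a' < a" by linarith
      then show False
        using ps qs ab ab' snoc.prems(7) by cases (metis less_le_not_le less_le_trans)+
    qed
    moreover from this have "b = b'" using ps(1) qs(1) snoc.prems(7) by simp
    ultimately have pq: "p = q" by (simp add: p q)
    have "path_perm (us @ [p]) = path_perm us \<circ> transpose a b" for us
      by (simp add: p path_perm_append)
    then have "path_perm ps \<circ> transpose a b \<circ> transpose a b = path_perm qs' \<circ> transpose a b \<circ> transpose a b"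
      using snoc.prems(7) by (simp only: snoc pq[symmetric])
    then have "path_perm ps = path_perm qs'" by (simp add: comp_assoc)
    then have "ps = qs'"
      using snoc.prems(1-6) by (intro snoc.IH) (simp_all add: snoc sorted_append)
    then show ?thesis by (simp add: snoc pq)
  qed
qed

section \<open>Sorted paths and fillings\<close>

definition pieri_paths :: "(nat \<Rightarrow> nat) \<Rightarrow> nat \<Rightarrow> nat \<Rightarrow> (nat \<times> nat) list set"
  where "pieri_paths w r m = {ps. length ps = m \<and> sorted (map fst ps) \<and> distinct (map snd ps) \<and>
    (\<forall>p\<in>set ps. 1 \<le> fst p \<and> fst p \<le> r \<and> r < snd p) \<and> bruhat_path w ps}"

lemma filter_sorted_append:
  "sorted (map fst ps) \<Longrightarrow>
    filter (\<lambda>p. fst p \<le> r) ps @ filter (\<lambda>p. fst p = Suc r) ps = filter (\<lambda>p. fst p \<le> Suc r) ps"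
  for ps :: "(nat \<times> 'a) list"
proof (induction ps)
  case (Cons p ps)
  have "filter (\<lambda>p. fst p \<le> r) ps = []" if "r < fst p"
    using that Cons.prems by (auto simp: filter_empty_conv)
  with Cons show ?case by auto
qed simp

lemma pairs_filter:
  assumes "sorted (map fst ps)" "\<forall>p\<in>set ps. 1 \<le> fst p"
  shows "pairs r (\<lambda>a. map snd (filter (\<lambda>p. fst p = a) ps)) = filter (\<lambda>p. fst p \<le> r) ps"
proof (induction r)
  case 0
  have "filter (\<lambda>p. fst p \<le> 0) ps = []" using assms(2) by (auto simp: filter_empty_conv)
  then show ?case by simp
next
  case (Suc r)
  have "map (Pair a) (map snd (filter (\<lambda>p. fst p = a) ps)) = filter (\<lambda>p. fst p = a) ps" for a
    unfolding map_map by (rule map_idI) auto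
  then show ?case
    by (simp only: pairs_Suc Suc filter_sorted_append[OF assms(1)])
qed

lemma sorted_pairs: "sorted (map fst (pairs r f))"
  by (induction r) (auto simp: pairs_Suc sorted_append set_pairs comp_def map_replicate_const)

lemma distinct_snd_pairs:
  assumes f: "f \<in> fillings n m B"
  shows "distinct (map snd (pairs r f))"
proof (induction r)
  case (Suc r)
  have "set (map snd (pairs r f)) \<inter> set (f (Suc r)) = {}"
    using fillings_unique_row[OF f] by (fastforce simp: set_pairs)
  then show ?case
    using Suc fillings_row_distinct[OF f] by (simp add: pairs_Suc comp_def)
qed simp

lemma filter_pairs:
  "1 \<le> a \<Longrightarrow> a \<le> r \<Longrightarrow> map snd (filter (\<lambda>p. fst p = a) (pairs r f)) = f a"
proof (induction r)
  case (Suc r)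
  have "filter (\<lambda>p. fst p = a) (pairs r f) = []" if "a = Suc r"
    using that by (auto simp: filter_empty_conv set_pairs)
  with Suc show ?case by (cases "a = Suc r") (auto simp: pairs_Suc filter_map comp_def)
qed simp

lemma pairs_inj_on_fillings: "inj_on (pairs r) (fillings r m B)"
proof (rule inj_onI)
  fix f g assume f: "f \<in> fillings r m B" and g: "g \<in> fillings r m B" and eq: "pairs r f = pairs r g"
  show "f = g"
  proof
    fix a show "f a = g a"
    proof (cases "a \<in> {1..r}")
      case True
      then show ?thesis using filter_pairs[of a r f] filter_pairs[of a r g] eq by simp
    next
      case False
      then show ?thesis using fillings_outside[OF f] fillings_outside[OF g] by simp
    qed
  qed
qed

text \<open>A sorted path is recovered from the filling that collects the steps with equal \<open>a\<close> in one row. The bound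
  \<open>N\<close> on the entries of the filling is satisfied by every path in the Bruhat order.\<close>

lemma pairs_fillings_eq_pieri_paths:
  assumes w: "w \<in> S_n n" and n: "r \<le> n" "n + m \<le> N"
  shows "pairs r ` {f \<in> fillings r m {r<..N}. bruhat_path w (pairs r f)} = pieri_paths w r m"
proof (intro equalityI subsetI)
  fix ps assume "ps \<in> pairs r ` {f \<in> fillings r m {r<..N}. bruhat_path w (pairs r f)}"
  then obtain f where ps: "ps = pairs r f" and f: "f \<in> fillings r m {r<..N}" and path: "bruhat_path w ps"
    by auto
  have "r < b" if "b \<in> set (f a)" for a b using fillings_row_subset[OF f, of a] that by auto
  then show "ps \<in> pieri_paths w r m"
    using path fillingsD(4)[OF f]
    by (auto simp: pieri_paths_def ps sorted_pairs distinct_snd_pairs[OF f] set_pairs length_pairs)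
next
  fix ps assume "ps \<in> pieri_paths w r m"
  then have len: "length ps = m" and sorted: "sorted (map fst ps)" and dist: "distinct (map snd ps)"
    and range: "\<forall>p\<in>set ps. 1 \<le> fst p \<and> fst p \<le> r \<and> r < snd p" and path: "bruhat_path w ps"
    by (auto simp: pieri_paths_def)
  define f where "f a = map snd (filter (\<lambda>p. fst p = a) ps)" for a
  have "pairs r f = filter (\<lambda>p. fst p \<le> r) ps"
    unfolding f_def using pairs_filter[OF sorted] range by simp
  also have "\<dots> = ps" using range by (auto simp: filter_id_conv)
  finally have pairs: "pairs r f = ps" .
  have "\<forall>p\<in>set ps. snd p \<le> n + length ps"
    using range n by (intro bruhat_path_bounded[OF w path]) auto
  then have bound: "\<forall>p\<in>set ps. snd p \<le> N" using n len by auto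
  have "f \<in> fillings r m {r<..N}"
  proof (rule fillingsI)
    show "\<forall>a. a \<notin> {1..r} \<longrightarrow> f a = []" using range by (auto simp: f_def filter_empty_conv)
    have "set (f a) \<subseteq> {r<..N}" for a using range bound by (fastforce simp: f_def)
    then show "\<forall>a. distinct (f a) \<and> set (f a) \<subseteq> {r<..N}"
      using dist by (simp add: f_def distinct_map_filter)
    show "\<forall>a c x. x \<in> set (f a) \<and> x \<in> set (f c) \<longrightarrow> a = c"
    proof (intro allI impI)
      fix a c x assume "x \<in> set (f a) \<and> x \<in> set (f c)"
      then have "(a, x) \<in> set ps" "(c, x) \<in> set ps" by (auto simp: f_def)
      then show "a = c"
        using dist inj_onD[of snd "set ps" "(a, x)" "(c, x)"] by (auto simp: distinct_map)
    qed
    show "(\<Sum>a\<in>{1..r}. length (f a)) = m" using len pairs length_pairs[of r f] by simp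
  qed
  then show "ps \<in> pairs r ` {f \<in> fillings r m {r<..N}. bruhat_path w (pairs r f)}"
    using pairs path by blast
qed

lemma transp_prod_eq:
  "transp_prod a b k = path_perm (map (\<lambda>i. (a i, b i)) [1..<Suc k])"
  by (simp add: transp_prod_def path_perm_def foldr_map comp_def)

text \<open>That every initial product raises the length by its number of factors means that each step is a cover;
  along a path of covers, \<open>bruhat_path_values\<close> gives the inequalities between the values of \<open>w'\<close>.\<close>

lemma pieri_perms_eq:
  assumes w: "w \<in> S_infinity"
  shows "pieri_perms w r m = (\<lambda>ps. w \<circ> path_perm ps) ` pieri_paths w r m"
proof (intro equalityI subsetI)
  fix v assume "v \<in> pieri_perms w r m"
  then obtain a b where v: "v = w \<circ> transp_prod a b m"
    and pos: "\<forall>i\<in>{1..m}. 1 \<le> a i \<and> 1 \<le> b i"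
    and inj: "inj_on b {1..m}" and r: "\<forall>i\<in>{1..m}. r < b i"
    and mono: "mono_on {1..m} a" and ar: "\<forall>i\<in>{1..m}. a i \<le> r"
    and lens: "\<forall>k\<in>{1..m}. len (w \<circ> transp_prod a b k) = len w + k"
    unfolding pieri_perms_def by blast
  define ps where "ps = map (\<lambda>i. (a i, b i)) [1..<Suc m]"
  have take: "path_perm (take k ps) = transp_prod a b k" if "k \<le> m" for k
    using that by (simp add: ps_def transp_prod_eq take_map take_upt del: upt_Suc)
  have set: "set ps = (\<lambda>i. (a i, b i)) ` {1..m}" by (auto simp: ps_def)
  have range: "\<forall>p\<in>set ps. 1 \<le> fst p \<and> fst p \<le> r \<and> r < snd p" using pos ar r by (auto simp: set)
  have "sorted (map a [1..<Suc m])"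
    unfolding sorted_iff_nth_mono by (auto intro!: mono_onD[OF mono] simp del: upt_Suc)
  then have "sorted (map fst ps)" by (simp add: ps_def comp_def)
  moreover have "distinct (map snd ps)"
    using inj
    by (simp add: ps_def comp_def distinct_map atLeastLessThanSuc_atLeastAtMost del: upt_Suc)
  moreover have "bruhat_path w ps"
  proof (rule bruhat_path_iff_len[OF w, THEN iffD2])
    show "1 \<le> fst p \<and> fst p < snd p" if "p \<in> set ps" for p using range that by fastforce
    show "\<forall>k\<le>length ps. len (w \<circ> path_perm (take k ps)) = len w + k"
    proof (intro allI impI)
      fix k assume "k \<le> length ps"
      then have "k \<le> m" by (simp add: ps_def del: upt_Suc)
      then show "len (w \<circ> path_perm (take k ps)) = len w + k"
        using lens take[of k] by (cases "k = 0") auto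
    qed
  qed
  ultimately have "ps \<in> pieri_paths w r m" using range
    by (simp add: pieri_paths_def) (simp add: ps_def del: upt_Suc)
  moreover have "v = w \<circ> path_perm ps" unfolding v ps_def transp_prod_eq ..
  ultimately show "v \<in> (\<lambda>ps. w \<circ> path_perm ps) ` pieri_paths w r m" by blast
next
  fix v assume "v \<in> (\<lambda>ps. w \<circ> path_perm ps) ` pieri_paths w r m"
  then obtain ps where v: "v = w \<circ> path_perm ps" and len: "length ps = m"
    and sorted: "sorted (map fst ps)" and dist: "distinct (map snd ps)"
    and range: "\<forall>p\<in>set ps. 1 \<le> fst p \<and> fst p \<le> r \<and> r < snd p" and path: "bruhat_path w ps"
    by (auto simp: pieri_paths_def)
  define a b where "a i = fst (ps ! (i - 1))" and "b i = snd (ps ! (i - 1))" for i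
  have mem: "ps ! (i - 1) \<in> set ps" if "i \<in> {1..m}" for i
    using that len by (intro nth_mem) auto
  have take: "transp_prod a b k = path_perm (take k ps)" if "k \<le> m" for k
  proof -
    have "map (\<lambda>i. (a i, b i)) [1..<Suc k] = take k ps"
      using that len by (intro nth_equalityI) (auto simp: a_def b_def simp del: upt_Suc)
    then show ?thesis by (simp only: transp_prod_eq)
  qed
  have "v = w \<circ> transp_prod a b m" using take[of m] len v by simp
  moreover have "\<forall>i\<in>{1..m}. 1 \<le> a i \<and> 1 \<le> b i"
    and "\<forall>i\<in>{1..m}. r < b i" and "\<forall>i\<in>{1..m}. a i \<le> r"
    using range mem by (fastforce simp: a_def b_def)+
  moreover have "inj_on b {1..m}"
  proof (rule inj_onI)
    fix i j assume ij: "i \<in> {1..m}" "j \<in> {1..m}" "b i = b j"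
    then have less: "i - 1 < length (map snd ps)" "j - 1 < length (map snd ps)" using len by auto
    then have "map snd ps ! (i - 1) = map snd ps ! (j - 1)" using ij(3) by (simp add: b_def)
    then have "i - 1 = j - 1" using nth_eq_iff_index_eq[OF dist less] by simp
    then show "i = j" using ij(1,2) by auto
  qed
  moreover have "mono_on {1..m} a"
  proof (rule mono_onI)
    fix i j assume ij: "i \<in> {1..m}" "j \<in> {1..m}" "i \<le> j"
    have "map fst ps ! (i - 1) \<le> map fst ps ! (j - 1)"
      using sorted by (rule sorted_nth_mono) (use ij len in auto)
    then show "a i \<le> a j" using ij len by (simp add: a_def)
  qed
  moreover have "\<forall>k\<in>{1..m}. len (w \<circ> transp_prod a b k) = len w + k"
  proof
    fix k assume "k \<in> {1..m}"
    then have k: "k \<le> m" by simp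
    have "\<forall>k\<le>length ps. len (w \<circ> path_perm (take k ps)) = len w + k"
    proof (rule bruhat_path_iff_len[OF w, THEN iffD1, OF _ path])
      show "1 \<le> fst p \<and> fst p < snd p" if "p \<in> set ps" for p using range that by fastforce
    qed
    then show "len (w \<circ> transp_prod a b k) = len w + k"
      using k len by (simp only: take[OF k])
  qed
  moreover have "v (b i) < v (b j) \<and> v (b j) < v (a i)"
    if ij: "i \<in> {1..m}" "j \<in> {1..m}" "i < j" "a i = a j" for i j
  proof -
    have "fst p \<noteq> snd q" if "p \<in> set ps" "q \<in> set ps" for p q
      using range[rule_format, OF that(1)] range[rule_format, OF that(2)] by linarith
    then have disj: "fst ` set ps \<inter> snd ` set ps = {}" by blast
    note vals = bruhat_path_values[OF path dist disj, folded v]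
    have "v (b i) < v (b j)"
      unfolding b_def by (rule vals(3)) (use ij len in \<open>auto simp: a_def\<close>)
    moreover have "(a j, b j) \<in> set ps" using mem[OF ij(2)] by (simp add: a_def b_def)
    then have "v (b j) < v (a j)" using vals(2) by blast
    ultimately show ?thesis using ij(4) by simp
  qed
  ultimately show "v \<in> pieri_perms w r m"
    unfolding pieri_perms_def by blast
qed

lemma inj_on_path_perm_pieri_paths:
  assumes "inj w"
  shows "inj_on (\<lambda>ps. w \<circ> path_perm ps) (pieri_paths w r m)"
proof (rule inj_onI)
  fix ps qs assume ps: "ps \<in> pieri_paths w r m" and qs: "qs \<in> pieri_paths w r m"
    and eq: "w \<circ> path_perm ps = w \<circ> path_perm qs"
  have "path_perm ps = path_perm qs"
    using eq assms by (simp add: fun.inj_map_strong fun_eq_iff inj_eq)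
  then show "ps = qs"
    using ps qs by (intro path_perm_inject[of ps r qs]) (auto simp: pieri_paths_def)
qed

lemma sum_pieri_perms:
  assumes w: "w \<in> S_n n" and n: "r \<le> n" "n + m \<le> N"
  shows "(\<Sum>v\<in>pieri_perms w r m. F v) = pieri_sum r m {r<..N} F w"
proof -
  let ?Phi = "fillings r m {r<..N}"
  let ?Psi = "{f \<in> ?Phi. bruhat_path w (pairs r f)}"
  have "pieri_sum r m {r<..N} F w = (\<Sum>f\<in>?Psi. F (w \<circ> path_perm (pairs r f)))"
    unfolding pieri_sum_def path_op_eq
    by (intro sum.inter_filter[symmetric] finite_fillings) simp
  also have "\<dots> = (\<Sum>ps\<in>pairs r ` ?Psi. F (w \<circ> path_perm ps))"
    by (rule sum.reindex_cong[OF _ refl refl, symmetric])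
      (rule inj_on_subset[OF pairs_inj_on_fillings], blast)
  also have "pairs r ` ?Psi = pieri_paths w r m"
    by (rule pairs_fillings_eq_pieri_paths[OF assms])
  also have "(\<Sum>ps\<in>pieri_paths w r m. F (w \<circ> path_perm ps)) = (\<Sum>v\<in>pieri_perms w r m. F v)"
    unfolding pieri_perms_eq[OF S_infinityI[OF w]]
    using sum.reindex[OF inj_on_path_perm_pieri_paths[OF S_infinity_inj[OF S_infinityI[OF w]]], of F r m]
    by (simp add: comp_def)
  finally show ?thesis ..
qed

section \<open>The cycle as a special case\<close>

lemma covers_sigma:
  assumes "1 \<le> r"
  shows "covers (sigma r k) r (r + k + 1)" "sigma r k \<circ> transpose r (r + k + 1) = sigma r (Suc k)"
proof -
  show eq: "sigma r k \<circ> transpose r (r + k + 1) = sigma r (Suc k)"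
    by (auto simp: fun_eq_iff sigma_def transpose_def)
  have "inj (sigma r k)"
    by (rule injI) (auto simp: sigma_def split: if_splits)
  then show "covers (sigma r k) r (r + k + 1)"
    by (auto simp: covers_def empty_box_def sigma_def)
qed

lemma bruhat_path_sigma:
  assumes "1 \<le> r"
  shows "bruhat_path (sigma r k) (map (Pair r) [Suc (r + k)..<Suc (r + k + m)])"
proof (induction m arbitrary: k)
  case (Suc m)
  have "[Suc (r + k)..<Suc (r + k + Suc m)] = Suc (r + k) # [Suc (r + Suc k)..<Suc (r + Suc k + m)]"
    by (simp add: upt_conv_Cons del: upt_Suc)
  then show ?case
    using Suc[of "Suc k"] covers_sigma[OF assms, of k] by (simp del: upt_Suc)
qed simp

text \<open>The only cover of the identity across the boundary between \<open>r\<close> and \<open>r + 1\<close> is by \<open>(r, r + 1)\<close>. As the path is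
  sorted, it continues in row \<open>r\<close>, and with the earlier entries excluded the next entry has to be the
  first unused one.\<close>

lemma bruhat_path_sigma_unique:
  assumes "1 \<le> r" and "bruhat_path (sigma r k) ps" and "sorted (map fst ps)" and "distinct (map snd ps)"
    and "\<forall>p\<in>set ps. fst p \<le> r \<and> r + k < snd p" and "0 < k \<Longrightarrow> \<forall>p\<in>set ps. fst p = r"
  shows "sigma r k \<circ> path_perm ps = sigma r (k + length ps)"
  using assms
proof (induction ps arbitrary: k)
  case (Cons p ps)
  obtain a b where p: "p = (a, b)" by force
  have cov: "covers (sigma r k) a b" and b: "r + k < b" and "a \<le> r"
    using Cons.prems by (auto simp: p)
  have empty: "\<not> (sigma r k a < sigma r k c \<and> sigma r k c < sigma r k b)" if "a < c" "c < b" for c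
    using cov that by (auto simp: covers_def empty_box_def)
  have a: "a = r"
  proof (cases "k = 0")
    case True
    have "\<not> a < r" using empty[of r] b True by (auto simp: sigma_def)
    then show ?thesis using \<open>a \<le> r\<close> by simp
  next
    case False
    then show ?thesis using Cons.prems(6) by (simp add: p)
  qed
  have b: "b = r + k + 1"
  proof (rule ccontr)
    assume "b \<noteq> r + k + 1"
    with b a empty[of "r + k + 1"] show False by (auto simp: sigma_def)
  qed
  have u: "sigma r k \<circ> transpose a b = sigma r (Suc k)"
    unfolding a b by (rule covers_sigma(2)[OF Cons.prems(1)])
  have "sigma r (Suc k) \<circ> path_perm ps = sigma r (Suc k + length ps)"
  proof (rule Cons.IH[OF Cons.prems(1)])
    show "bruhat_path (sigma r (Suc k)) ps" using Cons.prems(2) u by (simp add: p)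
    have "fst q = r" if "q \<in> set ps" for q
      using Cons.prems(3,5) that a by (force simp: p)
    then show "\<forall>q\<in>set ps. fst q = r" by blast
    have "snd q \<noteq> b" if "q \<in> set ps" for q using Cons.prems(4) that by (auto simp: p)
    then show "\<forall>q\<in>set ps. fst q \<le> r \<and> r + Suc k < snd q"
      using Cons.prems(5) b by fastforce
  qed (use Cons.prems in auto)
  then show ?case unfolding p path_perm_Cons comp_assoc[symmetric] u by simp
qed simp

lemma sigma_0: "sigma r 0 = id"
  by (auto simp: sigma_def fun_eq_iff)

lemma pieri_perms_id:
  assumes "1 \<le> r"
  shows "pieri_perms id r m = {sigma r m}"
proof -
  have unique: "id \<circ> path_perm ps = sigma r m" if "ps \<in> pieri_paths id r m" for ps
    using bruhat_path_sigma_unique[OF assms, of 0 ps] that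
    by (auto simp: pieri_paths_def sigma_0)
  have "map (Pair r) [Suc r..<Suc (r + m)] \<in> pieri_paths id r m"
    using bruhat_path_sigma[OF assms, of 0 m] assms
    by (auto simp: pieri_paths_def sigma_0 comp_def sorted_iff_nth_mono simp del: upt_Suc)
  then show ?thesis
    using unique unfolding pieri_perms_eq[OF id_in_S_infinity] by (auto simp del: id_comp)
qed

text \<open>The case \<open>w = 1\<close> of the expansion of \<open>P\<^sub>w h\<^sub>m(x\<^sub>1,\<dots>,x\<^sub>r)\<close>.\<close>

lemma schubert_sigma:
  assumes "1 \<le> r"
  shows "schubert (sigma r m) = complete_homogeneous m r"
proof -
  have "schubert (sigma r m) = (\<Sum>v\<in>pieri_perms id r m. schubert v)"
    by (simp add: pieri_perms_id[OF assms])
  also have "\<dots> = pieri_sum r m {r<..r + m} schubert id"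
    by (rule sum_pieri_perms[OF id_in_S_n]) auto
  also have "\<dots> = schubert id * complete_homogeneous m r"
    by (rule pieri_sum_schubert[OF id_in_S_n]) auto
  finally show ?thesis by simp
qed

theorem theorem4p1:
  fixes w :: "nat \<Rightarrow> nat" and r m :: nat
  assumes "w \<in> S_infinity" and "1 \<le> r" and "1 \<le> m"
  shows "schubert w * schubert (sigma r m) = (\<Sum>w'\<in>pieri_perms w r m. schubert w')"
proof -
  obtain k where "w \<in> S_n k" using assms(1) by (rule S_infinityE)
  \<comment> \<open>The bounds in \<open>pieri_sum_schubert\<close> require \<open>r\<close> to be among the permuted elements.\<close>
  then have w: "w \<in> S_n (max k r)" by (rule S_n_mono) simp
  show ?thesis
    unfolding sum_pieri_perms[OF w max.cobounded2 order_refl]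
      pieri_sum_schubert[OF w max.cobounded2 order_refl] schubert_sigma[OF assms(2)] ..
qed

end
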